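(* Let $\mathsf{V}$ be a variety of Heyting algebras. If every profinite member of $\mathsf{V}$ is isomorphic to the profinite completion of some Heyting algebra, then $\mathsf{V}\subseteq\mathsf{DHA}$.
   Context: For a poset $X$ and $x\in X$, ${\uparrow}x=\{y\in X: x\le y\}$. A Heyting algebra is profinite if it is isomorphic to the inverse limit of an inverse system of finite Heyting algebras. The profinite completion of a Heyting algebra $A$ is the inverse limit of the inverse system of its finite quotients $A/\theta$ ($\theta$ a congruence of finite index, ordered by reverse inclusion) with the canonical quotient maps. For a poset $X$, $\mathrm{Up}(X)$ is the Heyting algebra of upsets of $X$ ($U\to V=\{x:{\uparrow}x\cap U\subseteq V\}$). A poset satisfies the three point rule if for all distinct $x,y,z$, if $x,y$ are incomparable and $x\le z$ then $y\le z$. A poset $X$ is a diamond system if: (D1) each ${\uparrow}x$ satisfies the three point rule; (D2) no ${\uparrow}x$ contains a $3$-element antichain; (D3) for all $x$ and $y,z\in{\uparrow}x$ there is $w$ with $y,z\le w$; (D4) whenever $\bot\le x,y$, $x,y\le z,v$, $z,v\le\top$, there is $w$ with $x,y\le w\le z,v$. A diamond sequence is a diamond system in which any two elements have a common lower bound. $\mathsf{DHA}$ is the variety generated by $\{\mathrm{Up}(X): X$ a finite diamond sequence$\}$. *)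

theory Defs
  imports "HOL-Algebra.Congruence"
begin

section \<open>Heyting algebras\<close>

record 'a heyting = "'a partial_object" +
  meet :: "'a \<Rightarrow> 'a \<Rightarrow> 'a"
  join :: "'a \<Rightarrow> 'a \<Rightarrow> 'a"
  himp :: "'a \<Rightarrow> 'a \<Rightarrow> 'a"
  hbot :: 'a
  htop :: 'a

definition heyting_le :: "'a heyting \<Rightarrow> 'a \<Rightarrow> 'a \<Rightarrow> bool" where
  "heyting_le A x y \<longleftrightarrow> meet A x y = x"

text \<open>The trivial one-element algebra is admitted.\<close>

locale heyting_algebra =
  fixes A :: "'a heyting"
  assumes meet_closed: "\<lbrakk>x \<in> carrier A; y \<in> carrier A\<rbrakk> \<Longrightarrow> meet A x y \<in> carrier A"
    and join_closed: "\<lbrakk>x \<in> carrier A; y \<in> carrier A\<rbrakk> \<Longrightarrow> join A x y \<in> carrier A"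
    and himp_closed: "\<lbrakk>x \<in> carrier A; y \<in> carrier A\<rbrakk> \<Longrightarrow> himp A x y \<in> carrier A"
    and hbot_closed: "hbot A \<in> carrier A"
    and htop_closed: "htop A \<in> carrier A"
    and meet_assoc: "\<lbrakk>x \<in> carrier A; y \<in> carrier A; z \<in> carrier A\<rbrakk>
          \<Longrightarrow> meet A (meet A x y) z = meet A x (meet A y z)"
    and meet_comm: "\<lbrakk>x \<in> carrier A; y \<in> carrier A\<rbrakk> \<Longrightarrow> meet A x y = meet A y x"
    and join_assoc: "\<lbrakk>x \<in> carrier A; y \<in> carrier A; z \<in> carrier A\<rbrakk>
          \<Longrightarrow> join A (join A x y) z = join A x (join A y z)"
    and join_comm: "\<lbrakk>x \<in> carrier A; y \<in> carrier A\<rbrakk> \<Longrightarrow> join A x y = join A y x"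
    and meet_join_absorb: "\<lbrakk>x \<in> carrier A; y \<in> carrier A\<rbrakk> \<Longrightarrow> meet A x (join A x y) = x"
    and join_meet_absorb: "\<lbrakk>x \<in> carrier A; y \<in> carrier A\<rbrakk> \<Longrightarrow> join A x (meet A x y) = x"
    and hbot_least: "x \<in> carrier A \<Longrightarrow> heyting_le A (hbot A) x"
    and htop_greatest: "x \<in> carrier A \<Longrightarrow> heyting_le A x (htop A)"
    and residuation: "\<lbrakk>x \<in> carrier A; y \<in> carrier A; z \<in> carrier A\<rbrakk>
          \<Longrightarrow> heyting_le A (meet A z x) y \<longleftrightarrow> heyting_le A z (himp A x y)"

definition heyting_hom :: "'a heyting \<Rightarrow> 'b heyting \<Rightarrow> ('a \<Rightarrow> 'b) set" where
  "heyting_hom A B = {h. h \<in> carrier A \<rightarrow> carrier B \<and>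
     (\<forall>x\<in>carrier A. \<forall>y\<in>carrier A.
        h (meet A x y) = meet B (h x) (h y) \<and>
        h (join A x y) = join B (h x) (h y) \<and>
        h (himp A x y) = himp B (h x) (h y)) \<and>
     h (hbot A) = hbot B \<and> h (htop A) = htop B}"

definition heyting_iso :: "'a heyting \<Rightarrow> 'b heyting \<Rightarrow> bool" where
  "heyting_iso A B \<longleftrightarrow> (\<exists>h\<in>heyting_hom A B. bij_betw h (carrier A) (carrier B))"


section \<open>Varieties\<close>

datatype hterm = HVar nat | HBot | HTop | HMeet hterm hterm | HJoin hterm hterm | HImp hterm hterm

primrec heval :: "'a heyting \<Rightarrow> (nat \<Rightarrow> 'a) \<Rightarrow> hterm \<Rightarrow> 'a" where
  "heval A \<rho> (HVar n) = \<rho> n"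
| "heval A \<rho> HBot = hbot A"
| "heval A \<rho> HTop = htop A"
| "heval A \<rho> (HMeet s t) = meet A (heval A \<rho> s) (heval A \<rho> t)"
| "heval A \<rho> (HJoin s t) = join A (heval A \<rho> s) (heval A \<rho> t)"
| "heval A \<rho> (HImp s t) = himp A (heval A \<rho> s) (heval A \<rho> t)"

definition satisfies :: "'a heyting \<Rightarrow> hterm \<times> hterm \<Rightarrow> bool" where
  "satisfies A e \<longleftrightarrow> (\<forall>\<rho>. range \<rho> \<subseteq> carrier A \<longrightarrow> heval A \<rho> (fst e) = heval A \<rho> (snd e))"

text \<open>
  A variety is an equational class. It is represented by a set of defining equations, which, unlike
  a class closed under homomorphic images, subalgebras and products, makes sense over all carrier
  types at once: \<open>variety E\<close> is polymorphic and consists of the members with elements in \<open>'a\<close>.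
\<close>

definition variety :: "(hterm \<times> hterm) set \<Rightarrow> 'a heyting set" where
  "variety E = {A. heyting_algebra A \<and> (\<forall>e\<in>E. satisfies A e)}"

text \<open>
  The variety generated by \<open>K\<close> is the intersection of all varieties that contain \<open>K\<close>. Its members
  need not live on the carrier type of the generators.
\<close>

definition generated_variety :: "'b heyting set \<Rightarrow> 'a heyting set" where
  "generated_variety K = {A. \<forall>E. K \<subseteq> variety E \<longrightarrow> A \<in> variety E}"


section \<open>Inverse limits and profinite completions\<close>

text \<open>
  \<open>r\<close> is the order of the index set, \<open>(i, j) \<in> r\<close> meaning \<open>i \<le> j\<close>; in that case
  \<open>\<phi> i j\<close> is the transition map from \<open>H j\<close> to \<open>H i\<close>.
\<close>

definition inverse_system ::
  "'i set \<Rightarrow> 'i rel \<Rightarrow> ('i \<Rightarrow> 'a heyting) \<Rightarrow> ('i \<Rightarrow> 'i \<Rightarrow> 'a \<Rightarrow> 'a) \<Rightarrow> bool" where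
  "inverse_system I r H \<phi> \<longleftrightarrow>
     I \<noteq> {} \<and> partial_order_on I r \<and>
     (\<forall>i\<in>I. \<forall>j\<in>I. \<exists>k\<in>I. (i, k) \<in> r \<and> (j, k) \<in> r) \<and>
     (\<forall>i\<in>I. heyting_algebra (H i)) \<and>
     (\<forall>(i, j)\<in>r. \<phi> i j \<in> heyting_hom (H j) (H i)) \<and>
     (\<forall>i\<in>I. \<forall>x\<in>carrier (H i). \<phi> i i x = x) \<and>
     (\<forall>i j k. (i, j) \<in> r \<and> (j, k) \<in> r \<longrightarrow> (\<forall>x\<in>carrier (H k). \<phi> i j (\<phi> j k x) = \<phi> i k x))"

definition inverse_limit ::
  "'i set \<Rightarrow> 'i rel \<Rightarrow> ('i \<Rightarrow> 'a heyting) \<Rightarrow> ('i \<Rightarrow> 'i \<Rightarrow> 'a \<Rightarrow> 'a) \<Rightarrow> ('i \<Rightarrow> 'a) heyting" where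
  "inverse_limit I r H \<phi> =
     \<lparr>carrier = {f \<in> (\<Pi>\<^sub>E i\<in>I. carrier (H i)). \<forall>(i, j)\<in>r. \<phi> i j (f j) = f i},
      meet = (\<lambda>f g. \<lambda>i\<in>I. meet (H i) (f i) (g i)),
      join = (\<lambda>f g. \<lambda>i\<in>I. join (H i) (f i) (g i)),
      himp = (\<lambda>f g. \<lambda>i\<in>I. himp (H i) (f i) (g i)),
      hbot = (\<lambda>i\<in>I. hbot (H i)),
      htop = (\<lambda>i\<in>I. htop (H i))\<rparr>"

text \<open>
  An existential quantifier cannot range over types, so the finite algebras are taken on subsets of
  \<open>nat\<close> and the indices from \<open>'a rel\<close>. This loses no generality: a finite algebra has a copy on
  \<open>nat\<close>, and if \<open>P\<close> is the limit of an arbitrary inverse system of finite algebras, then it is also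
  the limit of the system of its finite quotients by the kernels of the projections, which are
  relations on \<open>P\<close>.
\<close>

definition profinite :: "'a heyting \<Rightarrow> bool" where
  "profinite P \<longleftrightarrow> heyting_algebra P \<and>
     (\<exists>(I :: 'a rel set) r (H :: 'a rel \<Rightarrow> nat heyting) \<phi>.
        inverse_system I r H \<phi> \<and> (\<forall>i\<in>I. finite (carrier (H i))) \<and>
        heyting_iso P (inverse_limit I r H \<phi>))"

definition heyting_congruence :: "'a heyting \<Rightarrow> 'a rel \<Rightarrow> bool" where
  "heyting_congruence A \<theta> \<longleftrightarrow> equiv (carrier A) \<theta> \<and>
     (\<forall>(x, x')\<in>\<theta>. \<forall>(y, y')\<in>\<theta>.
        (meet A x y, meet A x' y') \<in> \<theta> \<and>
        (join A x y, join A x' y') \<in> \<theta> \<and>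
        (himp A x y, himp A x' y') \<in> \<theta>)"

text \<open>For a congruence \<open>\<theta>\<close> each union below is a union of copies of one and the same class.\<close>

definition quotient_algebra :: "'a heyting \<Rightarrow> 'a rel \<Rightarrow> 'a set heyting" where
  "quotient_algebra A \<theta> =
     \<lparr>carrier = carrier A // \<theta>,
      meet = (\<lambda>C D. \<Union>x\<in>C. \<Union>y\<in>D. \<theta> `` {meet A x y}),
      join = (\<lambda>C D. \<Union>x\<in>C. \<Union>y\<in>D. \<theta> `` {join A x y}),
      himp = (\<lambda>C D. \<Union>x\<in>C. \<Union>y\<in>D. \<theta> `` {himp A x y}),
      hbot = \<theta> `` {hbot A},
      htop = \<theta> `` {htop A}\<rparr>"

definition finite_index_congruences :: "'a heyting \<Rightarrow> 'a rel set" where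
  "finite_index_congruences A = {\<theta>. heyting_congruence A \<theta> \<and> finite (carrier A // \<theta>)}"

text \<open>
  For \<open>\<theta>' \<subseteq> \<theta>\<close> the canonical map from \<open>A/\<theta>'\<close> to \<open>A/\<theta>\<close> sends a \<open>\<theta>'\<close>-class \<open>C\<close> to the \<open>\<theta>\<close>-class
  \<open>\<theta> `` C\<close> containing it.
\<close>

definition profinite_completion :: "'a heyting \<Rightarrow> ('a rel \<Rightarrow> 'a set) heyting" where
  "profinite_completion A =
     (let I = finite_index_congruences A
      in inverse_limit I {(\<theta>, \<theta>'). \<theta> \<in> I \<and> \<theta>' \<in> I \<and> \<theta>' \<subseteq> \<theta>}
           (quotient_algebra A) (\<lambda>\<theta> \<theta>' C. \<theta> `` C))"


section \<open>Diamond systems\<close>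

text \<open>
  A poset is a carrier \<open>X\<close> with a relation \<open>r\<close> such that \<open>partial_order_on X r\<close>; the upset
  generated by \<open>x\<close> is \<open>above r x\<close>.
\<close>

definition upsets :: "'a set \<Rightarrow> 'a rel \<Rightarrow> 'a set set" where
  "upsets X r = {U. U \<subseteq> X \<and> (\<forall>x\<in>U. above r x \<subseteq> U)}"

definition Up :: "'a set \<Rightarrow> 'a rel \<Rightarrow> 'a set heyting" where
  "Up X r =
     \<lparr>carrier = upsets X r,
      meet = (\<inter>),
      join = (\<union>),
      himp = (\<lambda>U V. {x \<in> X. above r x \<inter> U \<subseteq> V}),
      hbot = {},
      htop = X\<rparr>"

definition incomparable :: "'a rel \<Rightarrow> 'a \<Rightarrow> 'a \<Rightarrow> bool" where
  "incomparable r x y \<longleftrightarrow> (x, y) \<notin> r \<and> (y, x) \<notin> r"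

definition three_point_rule :: "'a set \<Rightarrow> 'a rel \<Rightarrow> bool" where
  "three_point_rule S r \<longleftrightarrow>
     (\<forall>x\<in>S. \<forall>y\<in>S. \<forall>z\<in>S. x \<noteq> y \<and> x \<noteq> z \<and> y \<noteq> z \<and> incomparable r x y \<and> (x, z) \<in> r
        \<longrightarrow> (y, z) \<in> r)"

definition antichain :: "'a rel \<Rightarrow> 'a set \<Rightarrow> bool" where
  "antichain r S \<longleftrightarrow> (\<forall>x\<in>S. \<forall>y\<in>S. x \<noteq> y \<longrightarrow> incomparable r x y)"

definition diamond_system :: "'a set \<Rightarrow> 'a rel \<Rightarrow> bool" where
  "diamond_system X r \<longleftrightarrow>
     partial_order_on X r \<and>
     (\<forall>x\<in>X. three_point_rule (above r x) r) \<and>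
     (\<forall>x\<in>X. \<not> (\<exists>S \<subseteq> above r x. card S = 3 \<and> antichain r S)) \<and>
     (\<forall>x\<in>X. \<forall>y\<in>above r x. \<forall>z\<in>above r x. \<exists>w\<in>X. (y, w) \<in> r \<and> (z, w) \<in> r) \<and>
     (\<forall>b\<in>X. \<forall>x\<in>X. \<forall>y\<in>X. \<forall>z\<in>X. \<forall>v\<in>X. \<forall>t\<in>X.
        (b, x) \<in> r \<and> (b, y) \<in> r \<and>
        (x, z) \<in> r \<and> (x, v) \<in> r \<and> (y, z) \<in> r \<and> (y, v) \<in> r \<and>
        (z, t) \<in> r \<and> (v, t) \<in> r
        \<longrightarrow> (\<exists>w\<in>X. (x, w) \<in> r \<and> (y, w) \<in> r \<and> (w, z) \<in> r \<and> (w, v) \<in> r))"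

definition diamond_sequence :: "'a set \<Rightarrow> 'a rel \<Rightarrow> bool" where
  "diamond_sequence X r \<longleftrightarrow> diamond_system X r \<and>
     (\<forall>x\<in>X. \<forall>y\<in>X. \<exists>w\<in>X. (w, x) \<in> r \<and> (w, y) \<in> r)"

text \<open>Every finite poset has an isomorphic copy on a subset of \<open>nat\<close>.\<close>

definition DHA :: "'a heyting set" where
  "DHA = generated_variety {Up X r | (X :: nat set) r. finite X \<and> diamond_sequence X r}"


section \<open>Universes\<close>

text \<open>
  An assumption about all algebras of a class cannot quantify over their carrier types. It is
  therefore stated for the algebras with elements in one type \<open>'u\<close>, which plays the role of a
  universe; the only requirement is that \<open>'u\<close> has at least the cardinality of the continuum
  (over a finite \<open>'u\<close>, say, every algebra would be finite).
\<close>

definition universe_type :: "'u itself \<Rightarrow> bool" where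
  "universe_type _ \<longleftrightarrow> (\<exists>f :: nat set \<Rightarrow> 'u. inj f)"

end

(*
  Suppose V contains an algebra outside DHA. Some equation true in all finite diamond sequences fails
  at a prime filter p of it. Consider the frame of prime filters above p, with the upsets given by
  elements of the algebra as admissible ones. If no upset of this frame has a p-morphic image (with admissible
  preimages) of the shape fork, three-atom diamond, pentagon or double diamond, then every admissible
  upset is incomparable to at most one other. This makes finitely generated subalgebras finite, and
  their dual posets are diamond sequences, so the equation holds at p after all. Hence one of
  the four shapes occurs, and V contains Up(Y) for every poset Y all of whose roots generate upsets
  of that shape.

  If Up(Y) is the profinite completion of A, then A acts on Y as an algebra of upsets. Sequences of
  points of Y with principal upsets of bounded size converge along an ultrafilter with respect to
  these upsets, because they define a congruence of finite index, and limits carry upsets of points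
  to upsets of points. For each of the four shapes there is an image-finite Y in which some sequence
  cannot have such limits.
*)
theory Submission
  imports Defs "HOL-Library.Countable" "HOL-Library.Nat_Bijection"
begin

section \<open>Heyting algebras, prime filters and general frames\<close>

text \<open>Each shape satisfies all axioms of a diamond system but one: the fork fails D3, the
  three-atom diamond D2, the pentagon D1, the double diamond D4. In an infinite frame these axioms
  are out of reach, since only admissible upsets can be manipulated; statements about incomparable
  members of \<open>S\<close> replace them. The fork has to be excluded before the other shapes: its
  absence makes every nonempty admissible upset dense, so that a nonempty \<open>K\<close> can serve
  as the top of the others.

  A finite algebra is its own completion, so \<open>Y\<close> must be infinite. The obstacle is that
  a limit of roots may collapse onto a point above it. Adding constant sequences prevents this: two
  incomparable points are forced into the upset of the limit, which must then be a root, and one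
  that \<open>Y\<close> lacks. The upsets of roots are of bounded size, so a finite list of
  sequences describes them, and the congruence defined by the list has finite index.

  Image-finiteness of \<open>Y\<close> makes \<open>Up Y\<close> profinite; countability bounds the
  number of its upsets by the continuum, the size demanded of the universe type.\<close>

context heyting_algebra
begin

abbreviation le (infix "\<sqsubseteq>" 50) where "x \<sqsubseteq> y \<equiv> heyting_le A x y"

lemma meet_idem: "x \<in> carrier A \<Longrightarrow> meet A x x = x"
  by (metis join_meet_absorb meet_closed meet_join_absorb)

lemma le_refl: "x \<in> carrier A \<Longrightarrow> x \<sqsubseteq> x"
  by (simp add: heyting_le_def meet_idem)

lemma le_antisym: "\<lbrakk>x \<in> carrier A; y \<in> carrier A; x \<sqsubseteq> y; y \<sqsubseteq> x\<rbrakk> \<Longrightarrow> x = y"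
  by (metis heyting_le_def meet_comm)

lemma le_trans: "\<lbrakk>x \<in> carrier A; y \<in> carrier A; z \<in> carrier A; x \<sqsubseteq> y; y \<sqsubseteq> z\<rbrakk> \<Longrightarrow> x \<sqsubseteq> z"
  by (metis heyting_le_def meet_assoc)

lemma meet_le1: "\<lbrakk>x \<in> carrier A; y \<in> carrier A\<rbrakk> \<Longrightarrow> meet A x y \<sqsubseteq> x"
  by (metis heyting_le_def meet_assoc meet_comm meet_idem)

lemma meet_le2: "\<lbrakk>x \<in> carrier A; y \<in> carrier A\<rbrakk> \<Longrightarrow> meet A x y \<sqsubseteq> y"
  by (metis meet_comm meet_le1)

lemma meet_greatest:
  "\<lbrakk>x \<in> carrier A; y \<in> carrier A; z \<in> carrier A; z \<sqsubseteq> x; z \<sqsubseteq> y\<rbrakk> \<Longrightarrow> z \<sqsubseteq> meet A x y"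
  by (metis heyting_le_def meet_assoc)

lemma le_iff_join: "\<lbrakk>x \<in> carrier A; y \<in> carrier A\<rbrakk> \<Longrightarrow> x \<sqsubseteq> y \<longleftrightarrow> join A x y = y"
  by (metis heyting_le_def join_comm join_meet_absorb meet_comm meet_join_absorb)

lemma join_ge1: "\<lbrakk>x \<in> carrier A; y \<in> carrier A\<rbrakk> \<Longrightarrow> x \<sqsubseteq> join A x y"
  by (simp add: heyting_le_def meet_join_absorb)

lemma join_ge2: "\<lbrakk>x \<in> carrier A; y \<in> carrier A\<rbrakk> \<Longrightarrow> y \<sqsubseteq> join A x y"
  by (metis join_comm join_ge1)

lemma join_least:
  "\<lbrakk>x \<in> carrier A; y \<in> carrier A; z \<in> carrier A; x \<sqsubseteq> z; y \<sqsubseteq> z\<rbrakk> \<Longrightarrow> join A x y \<sqsubseteq> z"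
  by (metis join_assoc join_closed le_iff_join)

lemma mp: "\<lbrakk>x \<in> carrier A; y \<in> carrier A\<rbrakk> \<Longrightarrow> meet A (himp A x y) x \<sqsubseteq> y"
  by (simp add: residuation himp_closed le_refl)

lemma himp_top_iff: "\<lbrakk>x \<in> carrier A; y \<in> carrier A\<rbrakk> \<Longrightarrow> himp A x y = htop A \<longleftrightarrow> x \<sqsubseteq> y"
  by (metis heyting_le_def himp_closed htop_closed htop_greatest le_antisym meet_comm residuation)

definition hfilter :: "'a set \<Rightarrow> bool" where
  "hfilter F \<longleftrightarrow> F \<subseteq> carrier A \<and> htop A \<in> F \<and> (\<forall>x\<in>F. \<forall>y\<in>F. meet A x y \<in> F) \<and>
     (\<forall>x\<in>F. \<forall>y\<in>carrier A. x \<sqsubseteq> y \<longrightarrow> y \<in> F)"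

definition prime_filter :: "'a set \<Rightarrow> bool" where
  "prime_filter F \<longleftrightarrow> hfilter F \<and> hbot A \<notin> F \<and>
     (\<forall>x\<in>carrier A. \<forall>y\<in>carrier A. join A x y \<in> F \<longrightarrow> x \<in> F \<or> y \<in> F)"

lemma hfilterD:
  assumes "hfilter F"
  shows "F \<subseteq> carrier A" "htop A \<in> F" "x \<in> F \<Longrightarrow> y \<in> F \<Longrightarrow> meet A x y \<in> F"
    "x \<in> F \<Longrightarrow> y \<in> carrier A \<Longrightarrow> x \<sqsubseteq> y \<Longrightarrow> y \<in> F"
  using assms unfolding hfilter_def by blast+

text \<open>This is the filter generated by \<open>F\<close> and \<open>a\<close>: by residuation,
  \<open>himp A a z \<in> F\<close> says that some member of \<open>F\<close>, met with
  \<open>a\<close>, lies below \<open>z\<close>.\<close>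

lemma filter_himp:
  assumes F: "hfilter F" and a: "a \<in> carrier A"
  shows "hfilter {z \<in> carrier A. himp A a z \<in> F}"
proof -
  have "himp A a (meet A x y) \<in> F"
    if "x \<in> carrier A" "y \<in> carrier A" "himp A a x \<in> F" "himp A a y \<in> F" for x y
  proof -
    let ?m = "meet A (himp A a x) (himp A a y)"
    have m: "?m \<in> carrier A" using that a by (simp add: himp_closed meet_closed)
    have "?m \<sqsubseteq> himp A a x" "?m \<sqsubseteq> himp A a y"
      using that a by (simp_all add: meet_le1 meet_le2 himp_closed)
    hence "meet A ?m a \<sqsubseteq> x" "meet A ?m a \<sqsubseteq> y" using that a m by (simp_all add: residuation)
    hence "meet A ?m a \<sqsubseteq> meet A x y" using that a m by (simp add: meet_greatest meet_closed)
    hence "?m \<sqsubseteq> himp A a (meet A x y)" using that a m by (simp add: residuation meet_closed)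
    moreover have "?m \<in> F" using that by (simp add: hfilterD(3)[OF F])
    moreover have "himp A a (meet A x y) \<in> carrier A" using that a by (simp add: himp_closed meet_closed)
    ultimately show ?thesis using hfilterD(4)[OF F] by blast
  qed
  moreover have "himp A a y \<in> F"
    if "x \<in> carrier A" "y \<in> carrier A" "himp A a x \<in> F" "x \<sqsubseteq> y" for x y
  proof -
    have "meet A (himp A a x) a \<sqsubseteq> y"
      using that a by (meson himp_closed le_trans meet_closed mp)
    hence "himp A a x \<sqsubseteq> himp A a y" using that a by (simp add: residuation himp_closed)
    thus ?thesis using hfilterD(4)[OF F] that a himp_closed by blast
  qed
  moreover have "himp A a (htop A) = htop A"
    using a by (simp add: himp_top_iff htop_closed htop_greatest)
  ultimately show ?thesis
    unfolding hfilter_def using hfilterD(2)[OF F] htop_closed meet_closed by auto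
qed

text \<open>Zorn yields a filter \<open>P\<close> maximal among those containing \<open>F\<close>
  and omitting \<open>v\<close>. By maximality, adjoining any \<open>x \<notin> P\<close> captures
  \<open>v\<close>, that is \<open>himp A x v \<in> P\<close>. Primeness follows, because
  \<open>himp A x v\<close> and \<open>himp A y v\<close> together send \<open>join A x y\<close>
  below \<open>v\<close>.\<close>

lemma prime_filter_extend:
  assumes F: "hfilter F" and v: "v \<in> carrier A" "v \<notin> F"
  obtains P where "prime_filter P" "F \<subseteq> P" "v \<notin> P"
proof -
  let ?\<F> = "{G. hfilter G \<and> F \<subseteq> G \<and> v \<notin> G}"
  have "\<exists>M\<in>?\<F>. \<forall>G\<in>?\<F>. M \<subseteq> G \<longrightarrow> G = M"
  proof (rule subset_Zorn_nonempty)
    show "?\<F> \<noteq> {}" using F v by auto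
    fix C assume C: "C \<noteq> {}" "subset.chain ?\<F> C"
    have CF: "\<And>G. G \<in> C \<Longrightarrow> hfilter G \<and> F \<subseteq> G \<and> v \<notin> G" using C(2) by (auto simp: subset.chain_def)
    have tot: "\<And>G H. G \<in> C \<Longrightarrow> H \<in> C \<Longrightarrow> G \<subseteq> H \<or> H \<subseteq> G"
      using C(2) by (auto simp: subset.chain_def)
    have "hfilter (\<Union>C)"
      unfolding hfilter_def
    proof (intro conjI ballI impI)
      show "\<Union>C \<subseteq> carrier A" using CF hfilterD(1) by blast
      show "htop A \<in> \<Union>C" using CF C(1) hfilterD(2) by blast
    next
      fix x y assume "x \<in> \<Union>C" "y \<in> \<Union>C"
      then obtain G where "G \<in> C" "x \<in> G" "y \<in> G" using tot by blast
      thus "meet A x y \<in> \<Union>C" using CF hfilterD(3) by blast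
    next
      fix x y assume "x \<in> \<Union>C" "y \<in> carrier A" "x \<sqsubseteq> y"
      thus "y \<in> \<Union>C" using CF hfilterD(4) by blast
    qed
    thus "\<Union>C \<in> ?\<F>" using CF C(1) by blast
  qed
  then obtain P where PF: "P \<in> ?\<F>" and mx: "\<forall>G\<in>?\<F>. P \<subseteq> G \<longrightarrow> G = P" ..
  from PF have P: "hfilter P" "F \<subseteq> P" "v \<notin> P" by simp_all
  have max: "G = P" if "hfilter G" "P \<subseteq> G" "v \<notin> G" for G
    using mx[rule_format, of G] that P(2) by simp
  have imp: "himp A x v \<in> P" if x: "x \<in> carrier A" "x \<notin> P" for x
  proof (rule ccontr)
    assume n: "himp A x v \<notin> P"
    let ?G = "{z \<in> carrier A. himp A x z \<in> P}"
    have "P \<subseteq> ?G"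
    proof
      fix z assume z: "z \<in> P"
      hence zc: "z \<in> carrier A" using P(1) hfilterD(1) by blast
      have "z \<sqsubseteq> himp A x z" using x zc by (simp add: residuation[symmetric] meet_le1)
      thus "z \<in> ?G" using hfilterD(4)[OF P(1) z] zc x himp_closed by simp
    qed
    moreover have "v \<notin> ?G" using n by simp
    ultimately have "?G = P" by (intro max filter_himp[OF P(1) x(1)])
    moreover have "x \<in> ?G" using x hfilterD(2)[OF P(1)] himp_top_iff[OF x(1) x(1)] le_refl[OF x(1)] by simp
    ultimately show False using x(2) by simp
  qed
  have "prime_filter P"
    unfolding prime_filter_def
  proof (intro conjI ballI impI)
    show "hbot A \<notin> P" using P v hfilterD(4) hbot_least by blast
  next
    fix x y assume xy: "x \<in> carrier A" "y \<in> carrier A" "join A x y \<in> P"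
    show "x \<in> P \<or> y \<in> P"
    proof (rule ccontr)
      assume n: "\<not> (x \<in> P \<or> y \<in> P)"
      let ?m = "meet A (himp A x v) (himp A y v)"
      have mP: "?m \<in> P" using n xy imp hfilterD(3)[OF P(1)] by blast
      have m: "?m \<in> carrier A" using xy v by (simp add: himp_closed meet_closed)
      have "?m \<sqsubseteq> himp A x v" "?m \<sqsubseteq> himp A y v"
        using xy v by (simp_all add: meet_le1 meet_le2 himp_closed)
      hence "meet A ?m x \<sqsubseteq> v" "meet A ?m y \<sqsubseteq> v" using xy m v by (simp_all add: residuation)
      hence "x \<sqsubseteq> himp A ?m v" "y \<sqsubseteq> himp A ?m v"
        using xy m v by (simp_all add: residuation[symmetric] meet_comm)
      hence "join A x y \<sqsubseteq> himp A ?m v" using xy m v by (simp add: join_least himp_closed)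
      hence "meet A (join A x y) ?m \<sqsubseteq> v" using xy m v by (simp add: residuation join_closed)
      moreover have "meet A (join A x y) ?m \<in> P" using xy mP hfilterD(3)[OF P(1)] by blast
      ultimately show False using P v hfilterD(4) by blast
    qed
  qed (fact P(1))
  thus ?thesis using P that by blast
qed

end

text \<open>Only a preorder, and \<open>r\<close> may also relate points outside \<open>X\<close>.
  An upset of a frame is therefore a frame for the same \<open>r\<close>, without restricting the
  relation.\<close>

locale frame =
  fixes X :: "'a set" and r :: "'a rel"
  assumes refl: "x \<in> X \<Longrightarrow> (x, x) \<in> r"
    and trans: "(x, y) \<in> r \<Longrightarrow> (y, z) \<in> r \<Longrightarrow> (x, z) \<in> r"
    and closed: "x \<in> X \<Longrightarrow> (x, y) \<in> r \<Longrightarrow> y \<in> X"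

lemma partial_order_frame: "partial_order_on X r \<Longrightarrow> frame X r"
  by standard (auto simp: partial_order_on_def preorder_on_def refl_on_def dest: transD)

lemma Up_simps [simp]:
  "carrier (Up X r) = upsets X r"
  "meet (Up X r) = (\<inter>)"
  "join (Up X r) = (\<union>)"
  "himp (Up X r) = (\<lambda>U V. {x \<in> X. above r x \<inter> U \<subseteq> V})"
  "hbot (Up X r) = {}"
  "htop (Up X r) = X"
  by (simp_all add: Up_def)

lemma upsets_iff: "U \<in> upsets X r \<longleftrightarrow> U \<subseteq> X \<and> (\<forall>x\<in>U. \<forall>y. (x, y) \<in> r \<longrightarrow> y \<in> U)"
  by (auto simp: upsets_def above_def)

lemma upsets_Int: "U \<in> upsets X r \<Longrightarrow> V \<in> upsets X r \<Longrightarrow> U \<inter> V \<in> upsets X r"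
  and upsets_Un: "U \<in> upsets X r \<Longrightarrow> V \<in> upsets X r \<Longrightarrow> U \<union> V \<in> upsets X r"
  and upsets_empty: "{} \<in> upsets X r"
  and upsets_subset: "U \<in> upsets X r \<Longrightarrow> U \<subseteq> X"
  by (auto simp: upsets_def)

lemma heyting_le_Up: "heyting_le (Up X r) U V \<longleftrightarrow> U \<subseteq> V"
  by (auto simp: heyting_le_def)

context frame
begin

lemma above_self: "x \<in> X \<Longrightarrow> x \<in> above r x"
  unfolding above_def using refl by blast

lemma above_upset: "x \<in> X \<Longrightarrow> above r x \<in> upsets X r"
  using trans closed by (auto simp: upsets_iff above_def)

lemma upset_frame: "Z \<in> upsets X r \<Longrightarrow> frame Z r"
  using refl trans by (unfold_locales) (auto simp: upsets_iff)

lemma himp_upset: "{x \<in> X. above r x \<inter> U \<subseteq> V} \<in> upsets X r"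
  using trans closed by (auto simp: upsets_iff above_def)

lemma Up_heyting: "heyting_algebra (Up X r)"
proof
  fix U V W assume *: "U \<in> carrier (Up X r)" "V \<in> carrier (Up X r)" "W \<in> carrier (Up X r)"
  have "W \<inter> U \<subseteq> V \<longleftrightarrow> W \<subseteq> {x \<in> X. above r x \<inter> U \<subseteq> V}"
  proof
    assume WU: "W \<inter> U \<subseteq> V"
    have "above r x \<subseteq> W" if "x \<in> W" for x using *(3) that by (auto simp: upsets_iff above_def)
    thus "W \<subseteq> {x \<in> X. above r x \<inter> U \<subseteq> V}" using WU *(3) by (auto simp: upsets_iff)
  next
    assume "W \<subseteq> {x \<in> X. above r x \<inter> U \<subseteq> V}"
    thus "W \<inter> U \<subseteq> V" using above_self by blast
  qed
  thus "heyting_le (Up X r) (meet (Up X r) W U) V \<longleftrightarrow> heyting_le (Up X r) W (himp (Up X r) U V)"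
    by (simp only: heyting_le_Up Up_simps)
next
  show "htop (Up X r) \<in> carrier (Up X r)" using closed by (auto simp: upsets_iff)
qed (auto simp: heyting_le_Up himp_upset upsets_Int upsets_Un upsets_empty dest: upsets_subset)

end

lemma heyting_homD:
  assumes "h \<in> heyting_hom A B"
  shows "x \<in> carrier A \<Longrightarrow> h x \<in> carrier B"
    "x \<in> carrier A \<Longrightarrow> y \<in> carrier A \<Longrightarrow> h (meet A x y) = meet B (h x) (h y)"
    "x \<in> carrier A \<Longrightarrow> y \<in> carrier A \<Longrightarrow> h (join A x y) = join B (h x) (h y)"
    "x \<in> carrier A \<Longrightarrow> y \<in> carrier A \<Longrightarrow> h (himp A x y) = himp B (h x) (h y)"
    "h (hbot A) = hbot B" "h (htop A) = htop B"
  using assms by (auto simp: heyting_hom_def)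

lemma (in heyting_algebra) heval_closed: "range \<rho> \<subseteq> carrier A \<Longrightarrow> heval A \<rho> t \<in> carrier A"
  by (induction t) (auto simp: meet_closed join_closed himp_closed hbot_closed htop_closed)

lemma (in frame) heval_upset: "range \<rho> \<subseteq> upsets X r \<Longrightarrow> heval (Up X r) \<rho> t \<in> upsets X r"
  using heyting_algebra.heval_closed[OF Up_heyting] by simp

lemma heval_hom:
  assumes A: "heyting_algebra A" and h: "h \<in> heyting_hom A B" and \<rho>: "range \<rho> \<subseteq> carrier A"
  shows "h (heval A \<rho> t) = heval B (\<lambda>n. h (\<rho> n)) t"
  by (induction t) (simp_all add: heyting_homD[OF h] heyting_algebra.heval_closed[OF A \<rho>])

text \<open>A general frame: the admissible upsets play the role of the clopen ones.\<close>

locale general_frame = frame +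
  fixes S :: "'a set set"
  assumes S_upsets: "S \<subseteq> upsets X r"
    and S_empty: "{} \<in> S"
    and S_top: "X \<in> S"
    and S_Int: "U \<in> S \<Longrightarrow> V \<in> S \<Longrightarrow> U \<inter> V \<in> S"
    and S_Un: "U \<in> S \<Longrightarrow> V \<in> S \<Longrightarrow> U \<union> V \<in> S"
    and S_imp: "U \<in> S \<Longrightarrow> V \<in> S \<Longrightarrow> {x \<in> X. above r x \<inter> U \<subseteq> V} \<in> S"

text \<open>Terms are evaluated among all upsets and only the valuation is confined to
  \<open>S\<close>, so that no separate algebra on \<open>S\<close> has to be formed.\<close>

definition valid_on :: "'a set \<Rightarrow> 'a rel \<Rightarrow> 'a set set \<Rightarrow> hterm \<times> hterm \<Rightarrow> bool" where
  "valid_on X r S e \<longleftrightarrow>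
     (\<forall>\<rho>. range \<rho> \<subseteq> S \<longrightarrow> heval (Up X r) \<rho> (fst e) = heval (Up X r) \<rho> (snd e))"

section \<open>Representation of a Heyting algebra by its prime filters\<close>

context heyting_algebra
begin

definition spectrum :: "'a set set" where
  "spectrum = {F. prime_filter F}"

definition spectrum_le :: "'a set rel" where
  "spectrum_le = {(F, G). F \<in> spectrum \<and> G \<in> spectrum \<and> F \<subseteq> G}"

definition spec :: "'a \<Rightarrow> 'a set set" where
  "spec a = {F \<in> spectrum. a \<in> F}"

lemma spectrumD:
  assumes "F \<in> spectrum"
  shows "hfilter F" "hbot A \<notin> F"
    "x \<in> carrier A \<Longrightarrow> y \<in> carrier A \<Longrightarrow> join A x y \<in> F \<Longrightarrow> x \<in> F \<or> y \<in> F"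
  using assms by (auto simp: spectrum_def prime_filter_def)

lemma spectrum_frame: "frame spectrum spectrum_le"
  by standard (auto simp: spectrum_le_def)

lemma spec_meet:
  assumes "a \<in> carrier A" "b \<in> carrier A"
  shows "spec (meet A a b) = spec a \<inter> spec b"
proof -
  have "meet A a b \<in> F \<longleftrightarrow> a \<in> F \<and> b \<in> F" if "F \<in> spectrum" for F
    using hfilterD(3,4)[OF spectrumD(1)[OF that]] assms meet_le1 meet_le2 by metis
  thus ?thesis by (auto simp: spec_def)
qed

lemma spec_join:
  assumes "a \<in> carrier A" "b \<in> carrier A"
  shows "spec (join A a b) = spec a \<union> spec b"
proof -
  have "join A a b \<in> F \<longleftrightarrow> a \<in> F \<or> b \<in> F" if "F \<in> spectrum" for F
    using hfilterD(4)[OF spectrumD(1)[OF that]] spectrumD(3)[OF that] assms join_ge1 join_ge2 join_closed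
    by metis
  thus ?thesis by (auto simp: spec_def)
qed

text \<open>If \<open>himp A a b \<notin> F\<close>, then \<open>b\<close> is outside the filter
  generated by \<open>F\<close> and \<open>a\<close>; a prime filter that extends it and omits
  \<open>b\<close> refutes the right-hand side at \<open>F\<close>.\<close>

lemma spec_himp:
  assumes a: "a \<in> carrier A" and b: "b \<in> carrier A"
  shows "spec (himp A a b) = {F \<in> spectrum. above spectrum_le F \<inter> spec a \<subseteq> spec b}"
proof (intro equalityI subsetI)
  fix F assume "F \<in> spec (himp A a b)"
  hence F: "F \<in> spectrum" "himp A a b \<in> F" by (auto simp: spec_def)
  have "b \<in> G" if G: "G \<in> spectrum" "F \<subseteq> G" "a \<in> G" for G
  proof -
    have "meet A (himp A a b) a \<in> G" using hfilterD(3)[OF spectrumD(1)[OF G(1)]] G F by blast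
    thus ?thesis using mp[OF a b] b hfilterD(4)[OF spectrumD(1)[OF G(1)]] by blast
  qed
  thus "F \<in> {F \<in> spectrum. above spectrum_le F \<inter> spec a \<subseteq> spec b}"
    using F by (auto simp: above_def spectrum_le_def spec_def)
next
  fix F assume "F \<in> {F \<in> spectrum. above spectrum_le F \<inter> spec a \<subseteq> spec b}"
  hence F: "F \<in> spectrum" and *: "\<And>G. G \<in> spectrum \<Longrightarrow> F \<subseteq> G \<Longrightarrow> a \<in> G \<Longrightarrow> b \<in> G"
    by (auto simp: above_def spectrum_le_def spec_def)
  show "F \<in> spec (himp A a b)"
  proof (rule ccontr)
    assume "F \<notin> spec (himp A a b)"
    hence n: "himp A a b \<notin> F" using F by (auto simp: spec_def)
    let ?G = "{z \<in> carrier A. himp A a z \<in> F}"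
    have "hfilter ?G" using filter_himp spectrumD(1) F a by blast
    then obtain P where P: "prime_filter P" "?G \<subseteq> P" "b \<notin> P"
      using n b prime_filter_extend by (metis (no_types, lifting) mem_Collect_eq)
    have "F \<subseteq> ?G"
    proof
      fix z assume z: "z \<in> F"
      hence zc: "z \<in> carrier A" using F spectrumD(1) hfilterD(1) by blast
      have "z \<sqsubseteq> himp A a z" using a zc by (simp add: residuation[symmetric] meet_le1)
      thus "z \<in> ?G" using hfilterD(4)[OF spectrumD(1)[OF F] z] zc a himp_closed by simp
    qed
    moreover have "himp A a a = htop A" using a by (simp add: himp_top_iff le_refl)
    hence "a \<in> ?G" using a hfilterD(2) spectrumD(1) F by auto
    ultimately show False using * P by (auto simp: spectrum_def)
  qed
qed

lemma spec_hom: "spec \<in> heyting_hom A (Up spectrum spectrum_le)"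
proof -
  have "spec (hbot A) = {}" "spec (htop A) = spectrum"
    using spectrumD hfilterD(2) by (auto simp: spec_def)
  moreover have "spec a \<in> upsets spectrum spectrum_le" for a
    by (auto simp: spec_def upsets_iff spectrum_le_def)
  ultimately show ?thesis
    by (auto simp: heyting_hom_def spec_meet spec_join spec_himp)
qed

lemma spec_inj: "inj_on spec (carrier A)"
proof -
  have "a \<sqsubseteq> b" if ab: "a \<in> carrier A" "b \<in> carrier A" "spec a \<subseteq> spec b" for a b
  proof (rule ccontr)
    assume n: "\<not> a \<sqsubseteq> b"
    have "hfilter {z \<in> carrier A. a \<sqsubseteq> z}"
      using ab(1) unfolding hfilter_def
      by (auto simp: htop_closed htop_greatest meet_closed meet_greatest intro: le_trans)
    then obtain P where "prime_filter P" "{z \<in> carrier A. a \<sqsubseteq> z} \<subseteq> P" "b \<notin> P"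
      using n ab(2) prime_filter_extend by (metis (no_types, lifting) mem_Collect_eq)
    thus False using ab le_refl by (auto simp: spec_def spectrum_def)
  qed
  thus ?thesis by (intro inj_onI le_antisym) auto
qed

lemma spec_general_frame: "general_frame spectrum spectrum_le (spec ` carrier A)"
proof -
  interpret frame spectrum spectrum_le by (rule spectrum_frame)
  show ?thesis
  proof
    show "spec ` carrier A \<subseteq> upsets spectrum spectrum_le"
      using heyting_homD(1)[OF spec_hom] by auto
    show "{} \<in> spec ` carrier A" "spectrum \<in> spec ` carrier A"
      using heyting_homD(5,6)[OF spec_hom] hbot_closed htop_closed by (auto simp: image_iff)
    fix U V assume "U \<in> spec ` carrier A" "V \<in> spec ` carrier A"
    then obtain a b where ab: "a \<in> carrier A" "b \<in> carrier A" "U = spec a" "V = spec b" by blast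
    show "U \<inter> V \<in> spec ` carrier A" using ab spec_meet meet_closed by (metis imageI)
    show "U \<union> V \<in> spec ` carrier A" using ab spec_join join_closed by (metis imageI)
    show "{x \<in> spectrum. above spectrum_le x \<inter> U \<subseteq> V} \<in> spec ` carrier A"
      unfolding ab(3,4) spec_himp[OF ab(1,2), symmetric] using ab(1,2) by (intro imageI himp_closed)
  qed
qed

lemma satisfies_iff_valid_spec:
  "satisfies A e \<longleftrightarrow> valid_on spectrum spectrum_le (spec ` carrier A) e"
proof
  assume s: "satisfies A e"
  show "valid_on spectrum spectrum_le (spec ` carrier A) e"
    unfolding valid_on_def
  proof (intro allI impI)
    fix \<rho> :: "nat \<Rightarrow> 'a set set" assume "range \<rho> \<subseteq> spec ` carrier A"
    hence "\<forall>n. \<exists>a\<in>carrier A. \<rho> n = spec a" by blast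
    then obtain \<sigma> where \<sigma>: "\<And>n. \<sigma> n \<in> carrier A" "\<And>n. \<rho> n = spec (\<sigma> n)" by metis
    have "\<rho> = (\<lambda>n. spec (\<sigma> n))" using \<sigma> by auto
    moreover have "range \<sigma> \<subseteq> carrier A" using \<sigma> by auto
    ultimately show "heval (Up spectrum spectrum_le) \<rho> (fst e) = heval (Up spectrum spectrum_le) \<rho> (snd e)"
      using s heval_hom[OF heyting_algebra_axioms spec_hom] by (metis satisfies_def)
  qed
next
  assume v: "valid_on spectrum spectrum_le (spec ` carrier A) e"
  show "satisfies A e"
    unfolding satisfies_def
  proof (intro allI impI)
    fix \<rho> :: "nat \<Rightarrow> 'a" assume \<rho>: "range \<rho> \<subseteq> carrier A"
    hence "range (\<lambda>n. spec (\<rho> n)) \<subseteq> spec ` carrier A" by auto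
    hence "spec (heval A \<rho> (fst e)) = spec (heval A \<rho> (snd e))"
      using v heval_hom[OF heyting_algebra_axioms spec_hom \<rho>] by (simp add: valid_on_def)
    thus "heval A \<rho> (fst e) = heval A \<rho> (snd e)"
      using spec_inj heval_closed[OF \<rho>] by (meson inj_onD)
  qed
qed

end

section \<open>Transfer of validity along p-morphisms\<close>

text \<open>A p-morphism defined on a generated subframe \<open>Z\<close> only. The last clause is
  continuity: preimages of upsets are traces on \<open>Z\<close> of admissible upsets.\<close>

definition pmap ::
  "'a set \<Rightarrow> 'a rel \<Rightarrow> 'a set set \<Rightarrow> 'a set \<Rightarrow> ('a \<Rightarrow> 'b) \<Rightarrow> 'b set \<Rightarrow> 'b rel \<Rightarrow> bool" where
  "pmap X r S Z f Y s \<longleftrightarrow> Z \<in> upsets X r \<and> f ` Z \<subseteq> Y \<and>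
     (\<forall>x\<in>Z. \<forall>y. (x, y) \<in> r \<longrightarrow> (f x, f y) \<in> s) \<and>
     (\<forall>x\<in>Z. \<forall>y. (f x, y) \<in> s \<longrightarrow> (\<exists>z. (x, z) \<in> r \<and> f z = y)) \<and>
     (\<forall>U\<in>upsets Y s. \<exists>W\<in>S. \<forall>x\<in>Z. f x \<in> U \<longleftrightarrow> x \<in> W)"

text \<open>Validity is tested point by point, so \<open>Y\<close> need not be the image of one
  p-morphism; a union of images will do. Thus one small shape found in \<open>X\<close> controls an
  infinite poset built from copies of that shape.\<close>

definition covers :: "'a set \<Rightarrow> 'a rel \<Rightarrow> 'a set set \<Rightarrow> 'b set \<Rightarrow> 'b rel \<Rightarrow> bool" where
  "covers X r S Y s \<longleftrightarrow> (\<forall>y\<in>Y. \<exists>Z f. pmap X r S Z f Y s \<and> y \<in> f ` Z)"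

lemma pmapD:
  assumes "pmap X r S Z f Y s"
  shows "Z \<in> upsets X r" "f ` Z \<subseteq> Y"
    "\<lbrakk>x \<in> Z; (x, y) \<in> r\<rbrakk> \<Longrightarrow> (f x, f y) \<in> s"
    "\<lbrakk>x \<in> Z; (f x, v) \<in> s\<rbrakk> \<Longrightarrow> \<exists>z. (x, z) \<in> r \<and> f z = v"
    "U \<in> upsets Y s \<Longrightarrow> \<exists>W\<in>S. \<forall>x\<in>Z. f x \<in> U \<longleftrightarrow> x \<in> W"
  using assms by (simp_all add: pmap_def)

lemma heval_pmap:
  assumes X: "frame X r" and Y: "frame Y s" and f: "pmap X r S Z f Y s"
    and \<rho>: "\<And>n. \<forall>x\<in>Z. f x \<in> \<rho> n \<longleftrightarrow> x \<in> \<sigma> n"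
  shows "\<forall>x\<in>Z. f x \<in> heval (Up Y s) \<rho> t \<longleftrightarrow> x \<in> heval (Up X r) \<sigma> t"
proof (induction t)
  case (HImp t u)
  let ?T = "heval (Up Y s) \<rho> t" and ?U = "heval (Up Y s) \<rho> u"
  let ?T' = "heval (Up X r) \<sigma> t" and ?U' = "heval (Up X r) \<sigma> u"
  note Z = pmapD(1)[OF f] and fZ = pmapD(2)[OF f] and mon = pmapD(3)[OF f] and bck = pmapD(4)[OF f]
  have up: "\<And>x y. x \<in> Z \<Longrightarrow> (x, y) \<in> r \<Longrightarrow> y \<in> Z" and ZX: "Z \<subseteq> X"
    using Z by (auto simp: upsets_iff)
  show ?case
  proof
    fix x assume x: "x \<in> Z"
    have "above s (f x) \<inter> ?T \<subseteq> ?U \<longleftrightarrow> above r x \<inter> ?T' \<subseteq> ?U'"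
    proof
      assume *: "above s (f x) \<inter> ?T \<subseteq> ?U"
      have "y \<in> ?U'" if "(x, y) \<in> r" "y \<in> ?T'" for y
        using * mon[OF x that(1)] up[OF x that(1)] that(2) HImp by (auto simp: above_def)
      thus "above r x \<inter> ?T' \<subseteq> ?U'" by (auto simp: above_def)
    next
      assume *: "above r x \<inter> ?T' \<subseteq> ?U'"
      have "y \<in> ?U" if y: "(f x, y) \<in> s" "y \<in> ?T" for y
      proof -
        obtain z where z: "(x, z) \<in> r" "f z = y" using bck[OF x y(1)] by blast
        hence "z \<in> Z" using up x by blast
        thus ?thesis using HImp z y(2) * by (auto simp: above_def)
      qed
      thus "above s (f x) \<inter> ?T \<subseteq> ?U" by (auto simp: above_def)
    qed
    thus "f x \<in> heval (Up Y s) \<rho> (HImp t u) \<longleftrightarrow> x \<in> heval (Up X r) \<sigma> (HImp t u)"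
      using x fZ ZX by auto
  qed
qed (use f \<rho> in \<open>auto simp: pmap_def upsets_iff\<close>)

lemma covers_satisfies:
  assumes X: "frame X r" and Y: "frame Y s" and c: "covers X r S Y s" and v: "valid_on X r S e"
  shows "satisfies (Up Y s) e"
  unfolding satisfies_def
proof (intro allI impI)
  fix \<rho> :: "nat \<Rightarrow> 'b set" assume \<rho>: "range \<rho> \<subseteq> carrier (Up Y s)"
  have sub: "heval (Up Y s) \<rho> t \<subseteq> Y" for t
    using frame.heval_upset[OF Y] \<rho> by (simp add: upsets_iff)
  have "y \<in> heval (Up Y s) \<rho> (fst e) \<longleftrightarrow> y \<in> heval (Up Y s) \<rho> (snd e)" if "y \<in> Y" for y
  proof -
    obtain Z f x where f: "pmap X r S Z f Y s" and x: "x \<in> Z" "y = f x"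
      using c \<open>y \<in> Y\<close> unfolding covers_def by blast
    define \<sigma> where "\<sigma> n = (SOME W. W \<in> S \<and> (\<forall>x\<in>Z. f x \<in> \<rho> n \<longleftrightarrow> x \<in> W))" for n
    have \<sigma>: "\<sigma> n \<in> S \<and> (\<forall>x\<in>Z. f x \<in> \<rho> n \<longleftrightarrow> x \<in> \<sigma> n)" for n
    proof -
      have "\<rho> n \<in> upsets Y s" using \<rho> by auto
      hence "\<exists>W. W \<in> S \<and> (\<forall>x\<in>Z. f x \<in> \<rho> n \<longleftrightarrow> x \<in> W)"
        using pmapD(5)[OF f] by blast
      thus ?thesis unfolding \<sigma>_def by (rule someI_ex)
    qed
    have eq: "\<forall>x\<in>Z. f x \<in> heval (Up Y s) \<rho> t \<longleftrightarrow> x \<in> heval (Up X r) \<sigma> t" for t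
      using \<sigma> by (intro heval_pmap[OF X Y f]) simp
    have "range \<sigma> \<subseteq> S" using \<sigma> by blast
    hence "heval (Up X r) \<sigma> (fst e) = heval (Up X r) \<sigma> (snd e)" using v by (simp add: valid_on_def)
    thus ?thesis using eq x by simp
  qed
  thus "heval (Up Y s) \<rho> (fst e) = heval (Up Y s) \<rho> (snd e)" using sub by blast
qed

text \<open>The image of a p-morphism is an upset, so it suffices to hit some point below each
  \<open>y\<close>. In the forbidden posets that point will be a root.\<close>

lemma coversI:
  assumes "\<And>y. y \<in> Y \<Longrightarrow> \<exists>x Z f. pmap X r S Z f Y s \<and> x \<in> f ` Z \<and> (x, y) \<in> s"
  shows "covers X r S Y s"
  unfolding covers_def
proof
  fix y assume "y \<in> Y"
  then obtain x Z f where f: "pmap X r S Z f Y s" and x: "x \<in> f ` Z" "(x, y) \<in> s"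
    using assms by blast
  then obtain z where z: "z \<in> Z" "x = f z" by blast
  then obtain w where "(z, w) \<in> r" "f w = y" using pmapD(4)[OF f, of z y] x by blast
  moreover have "w \<in> Z" using pmapD(1)[OF f] z calculation by (auto simp: upsets_iff)
  ultimately show "\<exists>Z f. pmap X r S Z f Y s \<and> y \<in> f ` Z" using f by blast
qed

context general_frame
begin

definition sees :: "'a \<Rightarrow> 'a set \<Rightarrow> bool" where
  "sees x U \<longleftrightarrow> (\<exists>y. (x, y) \<in> r \<and> y \<in> U)"

definition imp :: "'a set \<Rightarrow> 'a set \<Rightarrow> 'a set" where
  "imp U V = {x \<in> X. above r x \<inter> U \<subseteq> V}"

lemma imp_S: "U \<in> S \<Longrightarrow> V \<in> S \<Longrightarrow> imp U V \<in> S"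
  unfolding imp_def by (rule S_imp)

lemma imp_iff: "x \<in> imp U V \<longleftrightarrow> x \<in> X \<and> (\<forall>y. (x, y) \<in> r \<longrightarrow> y \<in> U \<longrightarrow> y \<in> V)"
  by (auto simp: imp_def above_def)

lemma impD: "x \<in> imp U V \<Longrightarrow> (x, y) \<in> r \<Longrightarrow> y \<in> U \<Longrightarrow> y \<in> V"
  by (simp add: imp_iff)

lemma imp_mp: "x \<in> imp U V \<Longrightarrow> x \<in> U \<Longrightarrow> x \<in> V"
  using impD[of x U V x] refl[of x] by (simp add: imp_iff)

lemma not_imp: "x \<in> X \<Longrightarrow> x \<notin> imp U V \<Longrightarrow> sees x (U - V)"
  by (auto simp: imp_iff sees_def)

lemma S_sub: "U \<in> S \<Longrightarrow> x \<in> U \<Longrightarrow> x \<in> X"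
  and S_up: "U \<in> S \<Longrightarrow> x \<in> U \<Longrightarrow> (x, y) \<in> r \<Longrightarrow> y \<in> U"
  using subsetD[OF S_upsets, of U] by (auto simp: upsets_iff)

lemma imp_greatest: "W \<in> S \<Longrightarrow> W \<inter> U \<subseteq> V \<Longrightarrow> W \<subseteq> imp U V"
  unfolding imp_iff subset_iff using S_sub S_up by blast

lemma imp_ge: "V \<in> S \<Longrightarrow> V \<subseteq> imp U V"
  by (rule imp_greatest) auto

lemma S_Union: "finite \<U> \<Longrightarrow> \<U> \<subseteq> S \<Longrightarrow> \<Union>\<U> \<in> S"
  by (induction \<U> rule: finite_induct) (auto simp: S_empty S_Un)

text \<open>When the image lies in a finite \<open>F\<close>, the preimage of an upset is a finite
  union of preimages of principal upsets, so admissibility has to be checked for these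
  alone.\<close>

lemma pmapI:
  assumes Z: "Z \<in> upsets X r" and F: "finite F" "F \<subseteq> Y" "\<And>x. x \<in> Z \<Longrightarrow> f x \<in> F"
    and s: "frame Y s"
    and mon: "\<And>x y. x \<in> Z \<Longrightarrow> y \<in> Z \<Longrightarrow> (x, y) \<in> r \<Longrightarrow> (f x, f y) \<in> s"
    and bck: "\<And>x y. x \<in> Z \<Longrightarrow> (f x, y) \<in> s \<Longrightarrow> \<exists>z. (x, z) \<in> r \<and> f z = y"
    and pre: "\<And>y. y \<in> F \<Longrightarrow> \<exists>W\<in>S. \<forall>x\<in>Z. (y, f x) \<in> s \<longleftrightarrow> x \<in> W"
  shows "pmap X r S Z f Y s"
proof -
  have "\<exists>W\<in>S. \<forall>x\<in>Z. f x \<in> U \<longleftrightarrow> x \<in> W" if U: "U \<in> upsets Y s" for U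
  proof -
    obtain W where W: "\<And>y. y \<in> F \<Longrightarrow> W y \<in> S" "\<And>y. y \<in> F \<Longrightarrow> \<forall>x\<in>Z. (y, f x) \<in> s \<longleftrightarrow> x \<in> W y"
      using pre by metis
    have "\<Union>(W ` (U \<inter> F)) \<in> S" using W F by (intro S_Union) auto
    moreover have "f x \<in> U \<longleftrightarrow> x \<in> \<Union>(W ` (U \<inter> F))" if x: "x \<in> Z" for x
    proof
      assume "f x \<in> U"
      moreover have "(f x, f x) \<in> s" using F x frame.refl[OF s] by blast
      ultimately show "x \<in> \<Union>(W ` (U \<inter> F))" using W(2) F x by blast
    next
      assume "x \<in> \<Union>(W ` (U \<inter> F))"
      then obtain y where "y \<in> U" "y \<in> F" "x \<in> W y" by blast
      thus "f x \<in> U" using W(2) x U by (auto simp: upsets_iff)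
    qed
    ultimately show ?thesis by blast
  qed
  moreover have "\<And>x y. x \<in> Z \<Longrightarrow> (x, y) \<in> r \<Longrightarrow> y \<in> Z" using Z by (auto simp: upsets_iff)
  moreover have "f ` Z \<subseteq> Y" using F by auto
  ultimately show ?thesis unfolding pmap_def using Z mon bck by simp
qed

end

section \<open>The four forbidden posets\<close>

text \<open>Every root \<open>Low n m k\<close> generates an upset of the forbidden shape, and every point lies above a
  root. Some choices of the parameters are left out on purpose (the third is not used except in
  \<open>fans\<close>): a limit of the points \<open>Mid n\<close> would force such a missing root to exist.\<close>

datatype pt = Top | Lt | Rt | Mid nat | Side nat | Low nat nat nat

definition rel_of :: "'a set \<Rightarrow> ('a \<Rightarrow> 'a set) \<Rightarrow> 'a rel" where
  "rel_of Y up = {(x, y). x \<in> Y \<and> y \<in> up x}"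

definition fork_up :: "pt \<Rightarrow> pt set" where
  "fork_up x = (case x of Low n m k \<Rightarrow> {x, Mid n, Mid m} | _ \<Rightarrow> {x})"

text \<open>Call \<open>2 * k\<close> and \<open>2 * k + 1\<close> partners: no root lies below two
  partners. Whichever \<open>Mid t\<close> turns out to be a limit, there is then an
  \<open>s \<noteq> t\<close> such that \<open>Mid s\<close> and \<open>Mid t\<close> have no common
  lower bound. Excluding only \<open>n = m\<close> would leave open that the roots
  \<open>Low n t 0\<close> converge to \<open>Mid t\<close> itself.\<close>

definition forks :: "pt set" where
  "forks = range Mid \<union> {Low n m 0 | n m. n div 2 \<noteq> m div 2}"

definition fan_up :: "pt \<Rightarrow> pt set" where
  "fan_up x = (case x of Low n m k \<Rightarrow> {x, Mid n, Mid m, Mid k, Top} | Mid n \<Rightarrow> {x, Top} | _ \<Rightarrow> {x})"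

text \<open>Distinct parameters suffice here: if the third \<open>Mid\<close> point of the roots
  tends to \<open>Mid t\<close> or \<open>Top\<close> while \<open>Mid t\<close> and
  \<open>Mid u\<close> stay fixed, the limit would have exactly two \<open>Mid\<close> points above
  it.\<close>

definition fans :: "pt set" where
  "fans = {Top} \<union> range Mid \<union> {Low n m k | n m k. n \<noteq> m \<and> n \<noteq> k \<and> m \<noteq> k}"

definition pentagon_up :: "pt \<Rightarrow> pt set" where
  "pentagon_up x = (case x of Low n m k \<Rightarrow> {x, Mid n, Lt, Side m, Top} | Mid n \<Rightarrow> {x, Lt, Top}
     | Side n \<Rightarrow> {x, Top} | Lt \<Rightarrow> {x, Top} | _ \<Rightarrow> {x})"

definition pentagons :: "pt set" where
  "pentagons = {Top, Lt} \<union> range Mid \<union> range Side \<union> {Low n m 0 | n m. n \<noteq> m}"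

definition double_up :: "pt \<Rightarrow> pt set" where
  "double_up x = (case x of Low n m k \<Rightarrow> {x, Mid n, Mid m, Lt, Rt, Top} | Mid n \<Rightarrow> {x, Lt, Rt, Top}
     | Lt \<Rightarrow> {x, Top} | Rt \<Rightarrow> {x, Top} | _ \<Rightarrow> {x})"

definition doubles :: "pt set" where
  "doubles = {Top, Lt, Rt} \<union> range Mid \<union> {Low n m 0 | n m. n div 2 \<noteq> m div 2}"

abbreviation "fork_rel \<equiv> rel_of forks fork_up"
abbreviation "fan_rel \<equiv> rel_of fans fan_up"
abbreviation "pentagon_rel \<equiv> rel_of pentagons pentagon_up"
abbreviation "double_rel \<equiv> rel_of doubles double_up"

lemma partial_order_rel_of:
  assumes "\<And>x. x \<in> Y \<Longrightarrow> x \<in> up x" "\<And>x. x \<in> Y \<Longrightarrow> up x \<subseteq> Y"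
    "\<And>x y. x \<in> Y \<Longrightarrow> y \<in> up x \<Longrightarrow> up y \<subseteq> up x"
    "\<And>x y. x \<in> Y \<Longrightarrow> y \<in> up x \<Longrightarrow> x \<in> up y \<Longrightarrow> x = y"
  shows "partial_order_on Y (rel_of Y up)"
  using assms unfolding partial_order_on_def preorder_on_def rel_of_def
  by (auto simp: refl_on_def trans_def antisym_def) blast+

lemma partial_order_forks: "partial_order_on forks fork_rel"
  by (rule partial_order_rel_of) (auto simp: forks_def fork_up_def)

lemma partial_order_fans: "partial_order_on fans fan_rel"
  by (rule partial_order_rel_of) (auto simp: fans_def fan_up_def)

lemma partial_order_pentagons: "partial_order_on pentagons pentagon_rel"
  by (rule partial_order_rel_of) (auto simp: pentagons_def pentagon_up_def)

lemma partial_order_doubles: "partial_order_on doubles double_rel"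
  by (rule partial_order_rel_of) (auto simp: doubles_def double_up_def)

section \<open>Criteria for mapping a frame onto each shape\<close>

context general_frame
begin

text \<open>\<open>W1\<close> and \<open>W2\<close> collapse to the two maximal points and the rest
  to the root; \<open>s1\<close> is the back condition at the root. The labels \<open>n\<close> and
  \<open>m\<close> are free, so one collapse serves all roots of \<open>forks\<close>.\<close>

lemma covers_forks:
  assumes W: "W1 \<in> S" "W2 \<in> S" "W1 \<inter> W2 = {}"
    and s1: "\<And>x. x \<in> X \<Longrightarrow> x \<notin> W1 \<union> W2 \<Longrightarrow> sees x W1 \<and> sees x W2"
    and p: "p \<in> X" "p \<notin> W1 \<union> W2"
  shows "covers X r S forks fork_rel"
proof (rule coversI)
  fix y assume y: "y \<in> forks"
  obtain n m where nm: "n div 2 \<noteq> m div 2" "y \<in> fork_up (Low n m 0)"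
  proof (cases y)
    case (Mid n)
    \<comment> \<open>\<open>n + 1\<close> may be the partner of \<open>n\<close>,
      \<open>n + 2\<close> never is.\<close>
    show ?thesis by (rule that[of n "n + 2"]) (simp_all add: Mid fork_up_def)
  qed (use y that in \<open>auto simp: forks_def fork_up_def\<close>)
  define f where "f x = (if x \<in> W1 then Mid n else if x \<in> W2 then Mid m else Low n m 0)" for x
  have "pmap X r S X f forks fork_rel"
  proof (rule pmapI[where F = "{Mid n, Mid m, Low n m 0}"])
    show "frame forks fork_rel" by (intro partial_order_frame partial_order_forks)
    fix x y assume "x \<in> X" "y \<in> X" "(x, y) \<in> r"
    thus "(f x, f y) \<in> fork_rel"
      using W(3) S_up[OF W(1)] S_up[OF W(2)] nm(1) by (auto simp: f_def rel_of_def forks_def fork_up_def)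
  next
    fix x y assume x: "x \<in> X" and y: "(f x, y) \<in> fork_rel"
    show "\<exists>z. (x, z) \<in> r \<and> f z = y"
    proof (cases "f x = y")
      case False
      hence "x \<notin> W1 \<union> W2" "y = Mid n \<or> y = Mid m"
        using y by (auto simp: f_def rel_of_def fork_up_def split: if_splits)
      moreover have "\<exists>z. (x, z) \<in> r \<and> z \<in> W1" "\<exists>z. (x, z) \<in> r \<and> z \<in> W2"
        using s1 x calculation(1) by (auto simp: sees_def)
      ultimately show ?thesis using W(3) unfolding f_def by (metis disjoint_iff)
    qed (use x refl in blast)
  next
    fix y assume "y \<in> {Mid n, Mid m, Low n m 0}"
    moreover have "\<forall>x\<in>X. (Mid n, f x) \<in> fork_rel \<longleftrightarrow> x \<in> W1"
      "\<forall>x\<in>X. (Mid m, f x) \<in> fork_rel \<longleftrightarrow> x \<in> W2" "\<forall>x\<in>X. (Low n m 0, f x) \<in> fork_rel \<longleftrightarrow> x \<in> X"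
      using W(3) nm(1) by (auto simp: f_def rel_of_def forks_def fork_up_def)
    ultimately show "\<exists>W\<in>S. \<forall>x\<in>X. (y, f x) \<in> fork_rel \<longleftrightarrow> x \<in> W" using W S_top by blast
  next
    show "X \<in> upsets X r" using S_top S_upsets by blast
  qed (use nm in \<open>auto simp: forks_def f_def\<close>)
  moreover have "f p = Low n m 0" using p by (auto simp: f_def)
  hence "Low n m 0 \<in> f ` X" using imageI[OF p(1), of f] by simp
  moreover have "(Low n m 0, y) \<in> fork_rel" using nm by (simp add: rel_of_def forks_def)
  ultimately show "\<exists>x Z f. pmap X r S Z f forks fork_rel \<and> x \<in> f ` Z \<and> (x, y) \<in> fork_rel" by blast
qed

lemma covers_fans:
  assumes W: "K \<in> S" "W1 \<in> S" "W2 \<in> S" "W3 \<in> S"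
    and K: "K \<subseteq> W1" "K \<subseteq> W2" "K \<subseteq> W3" "W1 \<inter> W2 \<subseteq> K" "W1 \<inter> W3 \<subseteq> K" "W2 \<inter> W3 \<subseteq> K"
    and sK: "\<And>x. x \<in> X \<Longrightarrow> sees x K"
    and s1: "\<And>x. x \<in> X \<Longrightarrow> x \<notin> W1 \<union> W2 \<union> W3 \<Longrightarrow> sees x (W1 - K) \<and> sees x (W2 - K) \<and> sees x (W3 - K)"
    and p: "p \<in> X" "p \<notin> W1 \<union> W2 \<union> W3"
  shows "covers X r S fans fan_rel"
proof (rule coversI)
  fix y assume y: "y \<in> fans"
  obtain n m k where nm: "n \<noteq> m" "n \<noteq> k" "m \<noteq> k" "y \<in> fan_up (Low n m k)"
  proof (cases y)
    case Top
    show ?thesis by (rule that[of 0 1 2]) (simp_all add: Top fan_up_def)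
  next
    case (Mid n)
    show ?thesis by (rule that[of n "n + 1" "n + 2"]) (simp_all add: Mid fan_up_def)
  qed (use y that in \<open>auto simp: fans_def fan_up_def\<close>)
  define f where "f x = (if x \<in> K then Top else if x \<in> W1 then Mid n else if x \<in> W2 then Mid m
    else if x \<in> W3 then Mid k else Low n m k)" for x
  have "pmap X r S X f fans fan_rel"
  proof (rule pmapI[where F = "{Top, Mid n, Mid m, Mid k, Low n m k}"])
    show "frame fans fan_rel" by (intro partial_order_frame partial_order_fans)
    fix x y assume "x \<in> X" "y \<in> X" and xy: "(x, y) \<in> r"
    have "x \<in> U \<Longrightarrow> y \<in> U" if "U \<in> S" for U using S_up that xy by blast
    from this[OF W(1)] this[OF W(2)] this[OF W(3)] this[OF W(4)]
    show "(f x, f y) \<in> fan_rel"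
      using K nm by (auto simp: f_def rel_of_def fans_def fan_up_def)
  next
    fix x y assume x: "x \<in> X" and y: "(f x, y) \<in> fan_rel"
    show "\<exists>z. (x, z) \<in> r \<and> f z = y"
    proof (cases "f x = y")
      case ne: False
      show ?thesis
      proof (cases "y = Top")
        case True
        thus ?thesis using sK[OF x] by (auto simp: f_def sees_def)
      next
        case False
        hence *: "x \<notin> W1 \<union> W2 \<union> W3" "y = Mid n \<or> y = Mid m \<or> y = Mid k"
          using y ne by (auto simp: f_def rel_of_def fan_up_def split: if_splits)
        have "\<exists>z. (x, z) \<in> r \<and> z \<in> W1 - K" "\<exists>z. (x, z) \<in> r \<and> z \<in> W2 - K" "\<exists>z. (x, z) \<in> r \<and> z \<in> W3 - K"
          using s1[OF x *(1)] by (auto simp: sees_def)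
        moreover have "z \<in> W1 - K \<Longrightarrow> f z = Mid n" "z \<in> W2 - K \<Longrightarrow> f z = Mid m"
          "z \<in> W3 - K \<Longrightarrow> f z = Mid k" for z
          using K by (auto simp: f_def)
        ultimately show ?thesis using *(2) by metis
      qed
    qed (use x refl in blast)
  next
    fix y assume "y \<in> {Top, Mid n, Mid m, Mid k, Low n m k}"
    moreover have "\<forall>x\<in>X. (Mid n, f x) \<in> fan_rel \<longleftrightarrow> x \<in> W1"
      "\<forall>x\<in>X. (Mid m, f x) \<in> fan_rel \<longleftrightarrow> x \<in> W2" "\<forall>x\<in>X. (Mid k, f x) \<in> fan_rel \<longleftrightarrow> x \<in> W3"
      "\<forall>x\<in>X. (Low n m k, f x) \<in> fan_rel \<longleftrightarrow> x \<in> X" "\<forall>x\<in>X. (Top, f x) \<in> fan_rel \<longleftrightarrow> x \<in> K"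
      using K nm(1-3) by (auto simp: f_def rel_of_def fans_def fan_up_def)
    ultimately show "\<exists>W\<in>S. \<forall>x\<in>X. (y, f x) \<in> fan_rel \<longleftrightarrow> x \<in> W" using W S_top by blast
  next
    show "X \<in> upsets X r" using S_top S_upsets by blast
  qed (use nm in \<open>auto simp: fans_def f_def\<close>)
  moreover have "f p = Low n m k" using p K by (auto simp: f_def)
  hence "Low n m k \<in> f ` X" using imageI[OF p(1), of f] by simp
  moreover have "(Low n m k, y) \<in> fan_rel" using nm by (simp add: rel_of_def fans_def)
  ultimately show "\<exists>x Z f. pmap X r S Z f fans fan_rel \<and> x \<in> f ` Z \<and> (x, y) \<in> fan_rel" by blast
qed

text \<open>\<open>K\<close> goes to \<open>Top\<close>, \<open>C - K\<close> to \<open>Lt\<close>,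
  \<open>A - C\<close> to \<open>Mid n\<close>, \<open>B - K\<close> to \<open>Side m\<close>, the
  remainder of \<open>Z\<close> to the root. The conditions \<open>sA\<close> and \<open>sR\<close>
  concern points of \<open>Z\<close> only, which is the gain from letting \<open>Z\<close> be a
  proper upset.\<close>

lemma covers_pentagons:
  assumes Z: "Z \<in> S" and W: "K \<in> S" "C \<in> S" "A \<in> S" "B \<in> S"
    and K: "K \<subseteq> C" "C \<subseteq> A" "K \<subseteq> B" "A \<inter> B \<subseteq> K"
    and sK: "\<And>x. x \<in> X \<Longrightarrow> sees x K"
    and sA: "\<And>x. x \<in> Z \<Longrightarrow> x \<in> A \<Longrightarrow> x \<notin> C \<Longrightarrow> sees x (C - K)"
    and sR: "\<And>x. x \<in> Z \<Longrightarrow> x \<notin> A \<Longrightarrow> x \<notin> B \<Longrightarrow> sees x (A - C) \<and> sees x (B - K)"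
    and p: "p \<in> Z" "p \<notin> A" "p \<notin> B"
  shows "covers X r S pentagons pentagon_rel"
proof (rule coversI)
  fix y assume y: "y \<in> pentagons"
  obtain n m where nm: "n \<noteq> m" "y \<in> pentagon_up (Low n m 0)"
  proof (cases y)
    case Top
    show ?thesis by (rule that[of 0 1]) (simp_all add: Top pentagon_up_def)
  next
    case Lt
    show ?thesis by (rule that[of 0 1]) (simp_all add: Lt pentagon_up_def)
  next
    case (Mid n)
    show ?thesis by (rule that[of n "n + 1"]) (simp_all add: Mid pentagon_up_def)
  next
    case (Side n)
    show ?thesis by (rule that[of "n + 1" n]) (simp_all add: Side pentagon_up_def)
  qed (use y that in \<open>auto simp: pentagons_def pentagon_up_def\<close>)
  have ZX: "\<And>x. x \<in> Z \<Longrightarrow> x \<in> X" using Z S_sub by blast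
  define f where "f x = (if x \<in> K then Top else if x \<in> C then Lt else if x \<in> A then Mid n
    else if x \<in> B then Side m else Low n m 0)" for x
  have "pmap X r S Z f pentagons pentagon_rel"
  proof (rule pmapI[where F = "{Top, Lt, Mid n, Side m, Low n m 0}"])
    show "frame pentagons pentagon_rel" by (intro partial_order_frame partial_order_pentagons)
    fix x y assume "x \<in> Z" "y \<in> Z" and xy: "(x, y) \<in> r"
    have "x \<in> U \<Longrightarrow> y \<in> U" if "U \<in> S" for U using S_up that xy by blast
    from this[OF W(1)] this[OF W(2)] this[OF W(3)] this[OF W(4)]
    show "(f x, f y) \<in> pentagon_rel"
      using K nm by (auto simp: f_def rel_of_def pentagons_def pentagon_up_def)
  next
    fix x y assume x: "x \<in> Z" and y: "(f x, y) \<in> pentagon_rel"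
    have fz: "z \<in> K \<Longrightarrow> f z = Top" "z \<in> C - K \<Longrightarrow> f z = Lt" "z \<in> A - C \<Longrightarrow> f z = Mid n"
      "z \<in> B - K \<Longrightarrow> f z = Side m" for z
      using K by (auto simp: f_def)
    have up: "\<And>z. (x, z) \<in> r \<Longrightarrow> z \<in> Z" using Z S_up x by blast
    show "\<exists>z. (x, z) \<in> r \<and> f z = y"
    proof (cases "f x = y")
      case ne: False
      consider "y = Top" | "y = Lt" "x \<in> A" "x \<notin> C" | "x \<notin> A" "x \<notin> B" "y \<in> {Lt, Mid n, Side m}"
        using y ne K by (auto simp: f_def rel_of_def pentagon_up_def split: if_splits)
      thus ?thesis
      proof cases
        case 1
        thus ?thesis using sK[OF ZX[OF x]] fz by (auto simp: sees_def)
      next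
        case 2
        thus ?thesis using sA[OF x] fz by (auto simp: sees_def)
      next
        case 3
        obtain u v where u: "(x, u) \<in> r" "u \<in> A - C" and v: "(x, v) \<in> r" "v \<in> B - K"
          using sR[OF x 3(1,2)] by (auto simp: sees_def)
        \<comment> \<open>From the root, \<open>Lt\<close> is reached through the point
          \<open>u\<close> sent to \<open>Mid n\<close>; hence \<open>sR\<close> does not have to
          speak of \<open>C - K\<close>.\<close>
        obtain w where w: "(u, w) \<in> r" "w \<in> C - K" using sA[of u] u up by (auto simp: sees_def)
        thus ?thesis using 3(3) u v fz trans by blast
      qed
    qed (use x ZX refl in blast)
  next
    fix y assume "y \<in> {Top, Lt, Mid n, Side m, Low n m 0}"
    moreover have "\<forall>x\<in>Z. (Mid n, f x) \<in> pentagon_rel \<longleftrightarrow> x \<in> A"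
      "\<forall>x\<in>Z. (Side m, f x) \<in> pentagon_rel \<longleftrightarrow> x \<in> B" "\<forall>x\<in>Z. (Lt, f x) \<in> pentagon_rel \<longleftrightarrow> x \<in> C"
      "\<forall>x\<in>Z. (Low n m 0, f x) \<in> pentagon_rel \<longleftrightarrow> x \<in> X" "\<forall>x\<in>Z. (Top, f x) \<in> pentagon_rel \<longleftrightarrow> x \<in> K"
      using K nm(1) ZX by (auto simp: f_def rel_of_def pentagons_def pentagon_up_def)
    ultimately show "\<exists>W\<in>S. \<forall>x\<in>Z. (y, f x) \<in> pentagon_rel \<longleftrightarrow> x \<in> W" using W S_top by blast
  next
    show "Z \<in> upsets X r" using Z S_upsets by blast
  qed (use nm in \<open>auto simp: pentagons_def f_def\<close>)
  moreover have "f p = Low n m 0" using p K by (auto simp: f_def)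
  hence "Low n m 0 \<in> f ` Z" using imageI[OF p(1), of f] by simp
  moreover have "(Low n m 0, y) \<in> pentagon_rel" using nm by (simp add: rel_of_def pentagons_def)
  ultimately show "\<exists>x Z f. pmap X r S Z f pentagons pentagon_rel \<and> x \<in> f ` Z \<and> (x, y) \<in> pentagon_rel" by blast
qed

text \<open>From the top, the levels are \<open>U \<inter> V\<close>, the pair \<open>U - V\<close>
  and \<open>V - U\<close>, the pair \<open>U' - V'\<close> and \<open>V' - U'\<close>, and the
  rest. The equation \<open>eq\<close> says that nothing lies between the two pairs, which is the
  failure of D4.\<close>

lemma covers_doubles:
  assumes W: "U \<in> S" "V \<in> S" "U' \<in> S" "V' \<in> S" and eq: "U \<union> V = U' \<inter> V'"
    and sK: "\<And>x. x \<in> X \<Longrightarrow> sees x (U \<inter> V)"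
    and sM: "\<And>x. x \<in> X \<Longrightarrow> x \<notin> U \<union> V \<Longrightarrow> sees x (U - V) \<and> sees x (V - U)"
    and sR: "\<And>x. x \<in> X \<Longrightarrow> x \<notin> U' \<union> V' \<Longrightarrow> sees x (U' - V') \<and> sees x (V' - U')"
    and p: "p \<in> X" "p \<notin> U' \<union> V'"
  shows "covers X r S doubles double_rel"
proof (rule coversI)
  fix y assume y: "y \<in> doubles"
  obtain n m where nm: "n div 2 \<noteq> m div 2" "y \<in> double_up (Low n m 0)"
  proof (cases y)
    case Top
    show ?thesis by (rule that[of 0 2]) (simp_all add: Top double_up_def)
  next
    case Lt
    show ?thesis by (rule that[of 0 2]) (simp_all add: Lt double_up_def)
  next
    case Rt
    show ?thesis by (rule that[of 0 2]) (simp_all add: Rt double_up_def)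
  next
    case (Mid n)
    show ?thesis by (rule that[of n "n + 2"]) (simp_all add: Mid double_up_def)
  qed (use y that in \<open>auto simp: doubles_def double_up_def\<close>)
  define f where "f x = (if x \<in> U \<inter> V then Top else if x \<in> U then Lt else if x \<in> V then Rt
    else if x \<in> U' then Mid n else if x \<in> V' then Mid m else Low n m 0)" for x
  have "pmap X r S X f doubles double_rel"
  proof (rule pmapI[where F = "{Top, Lt, Rt, Mid n, Mid m, Low n m 0}"])
    show "frame doubles double_rel" by (intro partial_order_frame partial_order_doubles)
    fix x y assume "x \<in> X" "y \<in> X" and xy: "(x, y) \<in> r"
    have "x \<in> U \<Longrightarrow> y \<in> U" if "U \<in> S" for U using S_up that xy by blast
    from this[OF W(1)] this[OF W(2)] this[OF W(3)] this[OF W(4)]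
    show "(f x, f y) \<in> double_rel"
      using eq nm by (auto simp: f_def rel_of_def doubles_def double_up_def)
  next
    fix x y assume x: "x \<in> X" and y: "(f x, y) \<in> double_rel"
    have fz: "z \<in> U \<inter> V \<Longrightarrow> f z = Top" "z \<in> U - V \<Longrightarrow> f z = Lt" "z \<in> V - U \<Longrightarrow> f z = Rt"
      "z \<in> U' - V' \<Longrightarrow> f z = Mid n" "z \<in> V' - U' \<Longrightarrow> f z = Mid m" for z
      using eq by (auto simp: f_def)
    show "\<exists>z. (x, z) \<in> r \<and> f z = y"
    proof (cases "f x = y")
      case ne: False
      consider "y = Top" | "y \<in> {Lt, Rt}" "x \<notin> U \<union> V" | "x \<notin> U' \<union> V'" "y \<in> {Mid n, Mid m}"
        using y ne eq by (auto simp: f_def rel_of_def double_up_def split: if_splits)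
      thus ?thesis
      proof cases
        case 1
        thus ?thesis using sK[OF x] fz by (auto simp: sees_def)
      next
        case 2
        obtain u v where "(x, u) \<in> r" "u \<in> U - V" "(x, v) \<in> r" "v \<in> V - U"
          using sM[OF x 2(2)] by (auto simp: sees_def)
        thus ?thesis using 2(1) fz by blast
      next
        case 3
        obtain u v where "(x, u) \<in> r" "u \<in> U' - V'" "(x, v) \<in> r" "v \<in> V' - U'"
          using sR[OF x 3(1)] by (auto simp: sees_def)
        thus ?thesis using 3(2) fz by blast
      qed
    qed (use x refl in blast)
  next
    fix y assume "y \<in> {Top, Lt, Rt, Mid n, Mid m, Low n m 0}"
    moreover have "\<forall>x\<in>X. (Mid n, f x) \<in> double_rel \<longleftrightarrow> x \<in> U'"
      "\<forall>x\<in>X. (Mid m, f x) \<in> double_rel \<longleftrightarrow> x \<in> V'" "\<forall>x\<in>X. (Lt, f x) \<in> double_rel \<longleftrightarrow> x \<in> U"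
      "\<forall>x\<in>X. (Rt, f x) \<in> double_rel \<longleftrightarrow> x \<in> V" "\<forall>x\<in>X. (Low n m 0, f x) \<in> double_rel \<longleftrightarrow> x \<in> X"
      "\<forall>x\<in>X. (Top, f x) \<in> double_rel \<longleftrightarrow> x \<in> U \<inter> V"
      using eq nm(1) by (auto simp: f_def rel_of_def doubles_def double_up_def)
    moreover have "U \<inter> V \<in> S" using W S_Int by blast
    ultimately show "\<exists>W\<in>S. \<forall>x\<in>X. (y, f x) \<in> double_rel \<longleftrightarrow> x \<in> W" using W S_top by blast
  next
    show "X \<in> upsets X r" using S_top S_upsets by blast
  qed (use nm in \<open>auto simp: doubles_def f_def\<close>)
  moreover have "f p = Low n m 0" using p eq by (auto simp: f_def)
  hence "Low n m 0 \<in> f ` X" using imageI[OF p(1), of f] by simp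
  moreover have "(Low n m 0, y) \<in> double_rel" using nm by (simp add: rel_of_def doubles_def)
  ultimately show "\<exists>x Z f. pmap X r S Z f doubles double_rel \<and> x \<in> f ` Z \<and> (x, y) \<in> double_rel" by blast
qed

end

section \<open>Frames omitting the forbidden posets\<close>

locale rooted_frame = general_frame +
  fixes p
  assumes root: "p \<in> X" "x \<in> X \<Longrightarrow> (p, x) \<in> r"
begin

lemma root_in_S: "U \<in> S \<Longrightarrow> p \<in> U \<Longrightarrow> U = X"
  using S_sub S_up root by blast

text \<open>Otherwise the pseudocomplement \<open>W1\<close> of \<open>U\<close> and its
  pseudocomplement \<open>W2\<close>, which contains \<open>U\<close>, are disjoint and nonempty,
  and a point outside both sees both. The frame collapses onto a fork with \<open>p\<close> over the
  root.\<close>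

lemma sees_nonempty:
  assumes nc: "\<not> covers X r S forks fork_rel" and U: "U \<in> S" "U \<noteq> {}" and x: "x \<in> X"
  shows "sees x U"
proof (rule ccontr)
  assume n: "\<not> sees x U"
  define W1 where "W1 = imp U {}"
  define W2 where "W2 = imp W1 {}"
  have W: "W1 \<in> S" "W2 \<in> S" unfolding W1_def W2_def by (intro imp_S U S_empty)+
  have disj: "W1 \<inter> W2 = {}"
    using imp_mp unfolding W2_def by blast
  have xW: "x \<in> W1" using n x by (auto simp: W1_def imp_iff sees_def)
  obtain u where u: "u \<in> U" using U by blast
  have "p \<notin> W1" using u root(2) S_sub[OF U(1) u] by (auto simp: W1_def imp_iff)
  moreover have "p \<notin> W2" using xW root(2) x by (auto simp: W2_def imp_iff)
  moreover have "sees y W1 \<and> sees y W2" if y: "y \<in> X" "y \<notin> W1 \<union> W2" for y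
  proof
    show "sees y W1" using not_imp[of y W1 "{}"] y by (simp add: W2_def)
    have "sees y U" using not_imp[of y U "{}"] y by (simp add: W1_def)
    then obtain z where z: "(y, z) \<in> r" "z \<in> U" by (auto simp: sees_def)
    have "z \<in> W2"
      unfolding W2_def imp_iff
    proof (intro conjI allI impI)
      show "z \<in> X" using S_sub U z by blast
      fix w assume w: "(z, w) \<in> r" "w \<in> W1"
      have "w \<in> U" using S_up U z(2) w by blast
      thus "w \<in> {}" using w(2) imp_mp unfolding W1_def by blast
    qed
    thus "sees y W2" using z by (auto simp: sees_def)
  qed
  ultimately have "covers X r S forks fork_rel"
    using covers_forks[OF W disj _ root(1)] by simp
  thus False using nc by simp
qed

end

text \<open>\<open>dense\<close> stands for the omission of the fork, from which
  \<open>sees_nonempty\<close> derives it.\<close>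

locale omitting_frame = rooted_frame +
  assumes dense: "U \<in> S \<Longrightarrow> U \<noteq> {} \<Longrightarrow> x \<in> X \<Longrightarrow> sees x U"
    and no_fan: "\<not> covers X r S fans fan_rel"
    and no_pentagon: "\<not> covers X r S pentagons pentagon_rel"
    and no_double: "\<not> covers X r S doubles double_rel"
begin

text \<open>Writing \<open>\<not>\<close> for the relative pseudocomplement \<open>U \<mapsto> imp U K\<close>, every \<open>C\<close> above \<open>K\<close> with
  \<open>\<not>C \<noteq> K\<close> is regular. If it is not, then \<open>C\<close> generates a piece of the Rieger-Nishimura ladder
  above \<open>K\<close>. It maps onto the pentagon in one of three ways, the second of which needs the
  restriction to the upset \<open>Z\<close>.\<close>

lemma regular:
  assumes K: "K \<in> S" "K \<noteq> {}" and C: "C \<in> S" "K \<subseteq> C" and BK: "imp C K \<noteq> K"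
  shows "imp (imp C K) K = C"
proof (rule ccontr)
  assume ne: "imp (imp C K) K \<noteq> C"
  define B where "B = imp C K"
  define A where "A = imp B K"
  define D where "D = imp A C"
  define E where "E = imp D (B \<union> C)"
  define Z where "Z = imp E (A \<union> B)"
  have S: "B \<in> S" "A \<in> S" "D \<in> S" "E \<in> S" "Z \<in> S"
    unfolding B_def A_def D_def E_def Z_def by (intro imp_S S_Un K C)+
  have KB: "K \<subseteq> B" unfolding B_def by (intro imp_ge K)
  have BC: "B \<inter> C \<subseteq> K" using imp_mp unfolding B_def by blast
  have AB: "A \<inter> B \<subseteq> K" using imp_mp unfolding A_def by blast
  have CA: "C \<subseteq> A" unfolding A_def using BC C by (intro imp_greatest) auto
  have BD: "B \<subseteq> D" unfolding D_def using AB C S by (intro imp_greatest) auto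
  have CD: "C \<subseteq> D" unfolding D_def using C by (intro imp_ge)
  have AD: "A \<inter> D \<subseteq> C" using imp_mp unfolding D_def by blast
  have DE: "D \<inter> E \<subseteq> B \<union> C" using imp_mp unfolding E_def by blast
  have ABE: "A \<union> B \<subseteq> E"
    unfolding E_def using AD S by (intro imp_greatest S_Un) auto
  have ABZ: "A \<union> B \<subseteq> Z" unfolding Z_def using S by (intro imp_ge S_Un)
  have DZ: "D \<subseteq> Z" unfolding Z_def using DE CA S by (intro imp_greatest) auto
  have sB: "sees x (B - K)" if "x \<in> X" "x \<notin> A" for x using that not_imp unfolding A_def by blast
  have sC: "sees x (C - K)" if "x \<in> X" "x \<notin> B" for x using that not_imp unfolding B_def by blast
  have sA: "sees x (A - C)" if "x \<in> X" "x \<notin> D" for x using that not_imp unfolding D_def by blast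
  have sD: "sees x (D - (B \<union> C))" if "x \<in> X" "x \<notin> E" for x using that not_imp unfolding E_def by blast
  have sE: "sees x (E - (A \<union> B))" if "x \<in> X" "x \<notin> Z" for x using that not_imp unfolding Z_def by blast
  have mono: "sees x V" if "sees x U" "U \<subseteq> V" for x U V using that unfolding sees_def by blast
  have pA: "p \<notin> A"
  proof
    assume "p \<in> A"
    hence "A = X" using root_in_S S by blast
    hence "B \<subseteq> K" using AB S_sub S by blast
    thus False using BK KB unfolding B_def by blast
  qed
  have pD: "p \<notin> D"
  proof
    assume "p \<in> D"
    hence "D = X" using root_in_S S by blast
    hence "A \<subseteq> C" using AD S_sub S by blast
    thus False using ne CA unfolding A_def B_def by blast
  qed
  have X: "\<And>U x. U \<in> S \<Longrightarrow> x \<in> U \<Longrightarrow> x \<in> X" by (rule S_sub)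
  have dn: "\<And>U x. U \<in> S \<Longrightarrow> K \<subseteq> U \<Longrightarrow> x \<in> X \<Longrightarrow> sees x U" using dense K by blast
  \<comment> \<open>The three pentagons. Case 1: the chain \<open>C\<close>, \<open>A\<close> and
    the side \<open>B\<close>, over the top \<open>K\<close>. Case 2: the chain
    \<open>B \<union> C\<close>, \<open>D\<close> and the side \<open>A\<close>, over
    \<open>C\<close>; a point of \<open>Z\<close> outside \<open>A\<close> and \<open>D\<close>
    cannot lie in \<open>E\<close>, hence sees \<open>D - (B \<union> C)\<close>. Case 3: the chain
    \<open>A \<union> B\<close>, \<open>E\<close> and the side \<open>D\<close>, over
    \<open>B \<union> C\<close>.\<close>
  consider "D = B \<union> C" | "\<not> Z \<subseteq> A \<union> D" | "D \<noteq> B \<union> C" "Z \<subseteq> A \<union> D" by blast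
  thus False
  proof cases
    case 1
    have "covers X r S pentagons pentagon_rel"
    proof (rule covers_pentagons[where Z = X and K = K and C = C and A = A and B = B and p = p])
      fix x assume "x \<in> X" "x \<in> A" "x \<notin> C"
      thus "sees x (C - K)" using sC AB C by blast
    next
      fix x assume "x \<in> X" "x \<notin> A" "x \<notin> B"
      thus "sees x (A - C) \<and> sees x (B - K)" using sA sB 1 CA by blast
    next
      show "p \<notin> B" using pD BD by blast
    qed (use S K C CA KB AB dn pA root S_top in auto)
    thus ?thesis using no_pentagon by simp
  next
    case 2
    then obtain q where q: "q \<in> Z" "q \<notin> A" "q \<notin> D" by blast
    have "covers X r S pentagons pentagon_rel"
    proof (rule covers_pentagons[where Z = Z and K = C and C = "B \<union> C" and A = D and B = A and p = q])
      fix x assume x: "x \<in> Z" "x \<in> D" "x \<notin> B \<union> C"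
      hence "x \<notin> A" using AD by blast
      hence "sees x (B - K)" using sB X[OF S(3) x(2)] by blast
      thus "sees x (B \<union> C - C)" by (rule mono) (use BC in blast)
    next
      fix x assume x: "x \<in> Z" "x \<notin> D" "x \<notin> A"
      have "x \<notin> E" using imp_mp[of x E "A \<union> B"] x BD unfolding Z_def by blast
      thus "sees x (D - (B \<union> C)) \<and> sees x (A - C)" using sA sD X[OF S(5) x(1)] x(2) by simp
    next
      show "\<And>x. x \<in> X \<Longrightarrow> sees x C" using dn C by blast
    qed (use S C BD CD CA AD q S_Un in auto)
    thus ?thesis using no_pentagon by simp
  next
    case 3
    have "covers X r S pentagons pentagon_rel"
    proof (rule covers_pentagons[where Z = X and K = "B \<union> C" and C = "A \<union> B" and A = E and B = D and p = p])
      fix x assume x: "x \<in> X" "x \<in> E" "x \<notin> A \<union> B"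
      hence "x \<notin> D" using DE CA by blast
      hence "sees x (A - C)" using sA x by blast
      thus "sees x (A \<union> B - (B \<union> C))" by (rule mono) (use AB C in blast)
    next
      fix x assume x: "x \<in> X" "x \<notin> E" "x \<notin> D"
      hence "x \<notin> Z" using 3 ABE by blast
      thus "sees x (E - (A \<union> B)) \<and> sees x (D - (B \<union> C))" using sE sD x by blast
    next
      show "p \<notin> E"
      proof
        assume "p \<in> E"
        hence "E = X" using root_in_S S by blast
        hence "D \<subseteq> B \<union> C" using DE S_sub S by blast
        thus False using 3 BD CD by blast
      qed
      show "\<And>x. x \<in> X \<Longrightarrow> sees x (B \<union> C)" using dn[of "B \<union> C"] S C KB S_Un by blast
    qed (use S C BD CD CA ABE DE pD root S_top S_Un in auto)
    thus ?thesis using no_pentagon by simp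
  qed
qed

text \<open>Three regular upsets, pairwise disjoint modulo \<open>K\<close>: if a point saw two of them without
  belonging to their union and without seeing the third, then collapsing one of the two would leave
  a dense, non-regular upset.\<close>

lemma two_of_three:
  assumes K: "K \<in> S" "K \<noteq> {}" and W: "W1 \<in> S" "W2 \<in> S" "W3 \<in> S"
    and KW: "K \<subseteq> W1" "K \<subseteq> W2" "K \<subset> W3"
    and disj: "W1 \<inter> W2 \<subseteq> K" "W1 \<inter> W3 \<subseteq> K" "W2 \<inter> W3 \<subseteq> K"
    and reg: "imp (imp W1 K) K = W1"
    and jn: "imp (W1 \<union> W2 \<union> W3) K = K"
  shows "imp W3 K \<subseteq> W1 \<union> W2"
proof -
  let ?C = "W1 \<union> W2"
  \<comment> \<open>\<open>W1\<close> takes over the role of \<open>K\<close>, and \<open>W3\<close>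
    witnesses that the pseudocomplement of \<open>?C\<close> relative to \<open>W1\<close> exceeds
    \<open>W1\<close>, as \<open>regular\<close> requires.\<close>
  have W3: "W3 \<subseteq> imp ?C W1" using disj KW W by (intro imp_greatest) auto
  have "imp (imp ?C W1) W1 = ?C"
  proof (rule regular)
    show "imp ?C W1 \<noteq> W1" using W3 disj(2) KW(3) by blast
  qed (use K KW W S_Un in auto)
  moreover have "imp W3 K \<subseteq> imp (imp ?C W1) W1"
  proof (rule imp_greatest)
    show "imp W3 K \<in> S" by (intro imp_S W K)
    show "imp W3 K \<inter> imp ?C W1 \<subseteq> W1"
    proof
      fix y assume y: "y \<in> imp W3 K \<inter> imp ?C W1"
      have "y \<in> imp (imp W1 K) K"
        unfolding imp_iff[of y]
      proof (intro conjI allI impI)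
        show "y \<in> X" using y by (simp add: imp_iff)
        fix q assume q: "(y, q) \<in> r" "q \<in> imp W1 K"
        \<comment> \<open>Above \<open>q\<close>, points of \<open>W2\<close> lie in
          \<open>W1\<close> because of \<open>y\<close>, points of \<open>W1\<close> lie in
          \<open>K\<close> because of \<open>q\<close>, and points of \<open>W3\<close> lie in
          \<open>K\<close> because of \<open>y\<close>.\<close>
        have "q \<in> imp (W1 \<union> W2 \<union> W3) K"
          unfolding imp_iff
        proof (intro conjI allI impI)
          show "q \<in> X" using q by (simp add: imp_iff)
          fix w assume w: "(q, w) \<in> r" "w \<in> W1 \<union> W2 \<union> W3"
          have yw: "(y, w) \<in> r" using trans q w by blast
          have "w \<in> W1 \<Longrightarrow> w \<in> K" using impD[OF q(2) w(1)] .
          moreover have "w \<in> W3 \<Longrightarrow> w \<in> K" using impD[OF _ yw] y by blast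
          moreover have "w \<in> W2 \<Longrightarrow> w \<in> W1" using impD[OF _ yw, of ?C W1] y by blast
          ultimately show "w \<in> K" using w(2) by blast
        qed
        thus "q \<in> K" using jn by simp
      qed
      thus "y \<in> W1" using reg by simp
    qed
  qed
  ultimately show ?thesis by simp
qed

text \<open>\<open>U1\<close> and \<open>U2\<close> are enlarged to their double pseudocomplements
  and \<open>U3\<close> to the pseudocomplement of the union of these. The new sets are still
  disjoint modulo \<open>K\<close>, are regular, and their union has pseudocomplement
  \<open>K\<close>. By \<open>two_of_three\<close> a point outside the union sees all three, and
  \<open>fans\<close> is covered.\<close>

lemma no_three_disjoint:
  assumes K: "K \<in> S" "K \<noteq> {}" and U: "U1 \<in> S" "U2 \<in> S" "U3 \<in> S"
    and KU: "K \<subset> U1" "K \<subset> U2" "K \<subset> U3"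
    and disj: "U1 \<inter> U2 \<subseteq> K" "U1 \<inter> U3 \<subseteq> K" "U2 \<inter> U3 \<subseteq> K"
  shows False
proof -
  define N where "N U = imp U K" for U
  have NS: "U \<in> S \<Longrightarrow> N U \<in> S" for U unfolding N_def by (intro imp_S K)
  have NK: "K \<subseteq> N U" for U unfolding N_def by (intro imp_ge K)
  have NI: "U \<inter> N U \<subseteq> K" for U unfolding N_def using imp_mp by blast
  have Ng: "W \<subseteq> N U" if "W \<in> S" "W \<inter> U \<subseteq> K" for U W
    unfolding N_def using that by (intro imp_greatest)
  have NN: "U \<subseteq> N (N U)" if "U \<in> S" for U using Ng NI that by blast
  have anti: "N V \<subseteq> N U" if "U \<subseteq> V" "V \<in> S" for U V using Ng[of "N V" U] NS NI[of V] that by blast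
  have NNN: "N (N (N U)) = N U" if "U \<in> S" for U using NN anti NS that by (meson subset_antisym)
  have NND: "N (N U) \<inter> V \<subseteq> K" if "U \<in> S" "V \<in> S" "U \<inter> V \<subseteq> K" for U V
    using Ng[of V U] NI[of "N U"] that by blast
  define W1 where "W1 = N (N U1)"
  define W2 where "W2 = N (N U2)"
  define W3 where "W3 = N (W1 \<union> W2)"
  have W: "W1 \<in> S" "W2 \<in> S" "W3 \<in> S" unfolding W1_def W2_def W3_def by (intro NS S_Un U)+
  have "W1 \<inter> U3 \<subseteq> K" "W2 \<inter> U3 \<subseteq> K" unfolding W1_def W2_def by (intro NND U disj)+
  hence U3: "U3 \<subseteq> W3" unfolding W3_def by (intro Ng U) blast
  have KW: "K \<subset> W1" "K \<subset> W2" "K \<subset> W3"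
    using KU NN[OF U(1)] NN[OF U(2)] U3 unfolding W1_def W2_def by blast+
  have W1U2: "U2 \<inter> W1 \<subseteq> K" using NND[OF U(1,2) disj(1)] unfolding W1_def by blast
  have d12: "W1 \<inter> W2 \<subseteq> K" using NND[OF U(2) W(1) W1U2] unfolding W2_def by blast
  have d3: "W1 \<inter> W3 \<subseteq> K" "W2 \<inter> W3 \<subseteq> K" using NI[of "W1 \<union> W2"] unfolding W3_def by blast+
  have reg: "N (N W1) = W1" "N (N W2) = W2" "N (N W3) = W3"
    unfolding W1_def W2_def W3_def by (intro NNN NS S_Un U)+
  have jn: "N (W1 \<union> W2 \<union> W3) = K"
  proof -
    have "W1 \<union> W2 \<union> W3 \<in> S" by (intro S_Un W)
    hence "N (W1 \<union> W2 \<union> W3) \<subseteq> N (W1 \<union> W2)" "N (W1 \<union> W2 \<union> W3) \<subseteq> N W3"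
      by (intro anti; blast)+
    thus ?thesis using NI[of W3] NK unfolding W3_def[symmetric] by blast
  qed
  have n3: "N W3 \<subseteq> W1 \<union> W2" unfolding N_def
    by (rule two_of_three) (use K W KW d12 d3 reg jn in \<open>auto simp: N_def\<close>)
  have n2: "N W2 \<subseteq> W1 \<union> W3" unfolding N_def
    by (rule two_of_three) (use K W KW d12 d3 reg jn in \<open>auto simp: N_def ac_simps\<close>)
  have n1: "N W1 \<subseteq> W2 \<union> W3" unfolding N_def
    by (rule two_of_three) (use K W KW d12 d3 reg jn in \<open>auto simp: N_def ac_simps\<close>)
  have "covers X r S fans fan_rel"
  proof (rule covers_fans[where K = K and p = p])
    fix x assume "x \<in> X" and x: "x \<notin> W1 \<union> W2 \<union> W3"
    thus "sees x (W1 - K) \<and> sees x (W2 - K) \<and> sees x (W3 - K)"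
      using n1 n2 n3 not_imp unfolding N_def by blast
  next
    have "p \<in> W \<Longrightarrow> X \<subseteq> W" if "W \<in> S" for W using root_in_S that by blast
    hence "p \<notin> W1" "p \<notin> W2" "p \<notin> W3" using W KW d12 d3 S_sub by blast+
    thus "p \<notin> W1 \<union> W2 \<union> W3" by simp
    show "\<And>x. x \<in> X \<Longrightarrow> sees x K" using dense K by blast
  qed (use K W KW d12 d3 root in auto)
  thus False using no_fan by simp
qed

section \<open>Incomparable admissible upsets: each has at most one partner\<close>

abbreviation inc (infix "\<parallel>" 50) where "U \<parallel> V \<equiv> \<not> U \<subseteq> V \<and> \<not> V \<subseteq> U"

lemma Int_nonempty: "U \<in> S \<Longrightarrow> V \<in> S \<Longrightarrow> U \<noteq> {} \<Longrightarrow> V \<noteq> {} \<Longrightarrow> U \<inter> V \<noteq> {}"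
proof -
  assume *: "U \<in> S" "V \<in> S" "U \<noteq> {}" "V \<noteq> {}"
  then obtain x where x: "x \<in> U" by blast
  hence "sees x V" using dense * S_sub by blast
  thus ?thesis using S_up[OF *(1) x] unfolding sees_def by blast
qed

text \<open>Modulo \<open>K = U \<inter> V\<close>, the sets \<open>C\<close>,
  \<open>V \<inter> imp C K\<close> and \<open>U\<close> are pairwise disjoint. \<open>U\<close>
  shows \<open>imp C K \<noteq> K\<close>, so \<open>C\<close> is regular, and then
  \<open>V \<inter> imp C K = K\<close> would give \<open>V \<subseteq> C\<close>.\<close>

lemma chain_disjoint:
  assumes S: "U \<in> S" "C \<in> S" "V \<in> S" and *: "U \<inter> V \<subset> C" "C \<subset> V" "\<not> U \<subseteq> V"
  shows False
proof -
  define K where "K = U \<inter> V"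
  have K: "K \<in> S" unfolding K_def by (intro S_Int S)
  have Kne: "K \<noteq> {}" unfolding K_def using * S by (intro Int_nonempty) auto
  have UB: "U \<subseteq> imp C K" using S * by (intro imp_greatest) (auto simp: K_def)
  have BK: "imp C K \<noteq> K" using UB * by (auto simp: K_def)
  have reg: "imp (imp C K) K = C" using regular K Kne S(2) * BK by (simp add: K_def)
  show False
  proof (rule no_three_disjoint[OF K Kne S(2), of "V \<inter> imp C K" U])
    show "V \<inter> imp C K \<in> S" by (intro S_Int S imp_S K)
    show "K \<subset> V \<inter> imp C K"
    proof
      show "K \<subseteq> V \<inter> imp C K" using imp_ge[OF K] by (auto simp: K_def)
      show "K \<noteq> V \<inter> imp C K"
      proof
        assume "K = V \<inter> imp C K"
        hence "V \<subseteq> imp (imp C K) K" using S by (intro imp_greatest) auto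
        thus False using reg * by blast
      qed
    qed
    show "C \<inter> (V \<inter> imp C K) \<subseteq> K" using imp_mp by blast
  qed (use S * in \<open>auto simp: K_def\<close>)
qed

text \<open>\<open>V \<union> (U \<inter> V')\<close> lies strictly between
  \<open>U \<inter> V'\<close> and \<open>V'\<close>, unless it equals \<open>V'\<close>; in that
  case \<open>U \<inter> V'\<close> lies strictly between \<open>V \<inter> U\<close> and
  \<open>U\<close>. Both situations are excluded by \<open>chain_disjoint\<close>.\<close>

lemma comparable_case:
  assumes S: "U \<in> S" "V \<in> S" "V' \<in> S" and *: "U \<parallel> V" "U \<parallel> V'" "V \<subset> V'"
  shows False
proof (cases "V \<union> (U \<inter> V') = V'")
  case False
  show False
    by (rule chain_disjoint[of U "V \<union> (U \<inter> V')" V']) (use S * False S_Un S_Int in auto)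
next
  case True
  show False
    by (rule chain_disjoint[of V "U \<inter> V'" U]) (use S * True S_Un S_Int in auto)
qed

text \<open>Two partners of \<open>U\<close> are themselves incomparable by
  \<open>comparable_case\<close>. The same lemma puts each pairwise intersection of the three sets
  inside the third set, so they are disjoint modulo \<open>U \<inter> V\<close>, against
  \<open>no_three_disjoint\<close>.\<close>

lemma incomparable_unique:
  assumes S: "U \<in> S" "V \<in> S" "V' \<in> S" and *: "U \<parallel> V" "U \<parallel> V'"
  shows "V = V'"
proof (rule ccontr)
  assume ne: "V \<noteq> V'"
  hence inc: "V \<parallel> V'" using comparable_case[OF S *] comparable_case[OF S(1,3,2) *(2,1)] by blast
  have cut: "P \<inter> Q \<subseteq> R" if "P \<in> S" "Q \<in> S" "R \<in> S" "P \<parallel> Q" "P \<parallel> R" "Q \<parallel> R" for P Q R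
    using comparable_case[of R "P \<inter> Q" P] that S_Int by blast
  define K where "K = U \<inter> V"
  have K: "K \<in> S" unfolding K_def by (intro S_Int S)
  have Kne: "K \<noteq> {}" unfolding K_def using * S by (intro Int_nonempty) auto
  have "U \<inter> V \<subseteq> V'" "U \<inter> V' \<subseteq> V" "V \<inter> V' \<subseteq> U" using cut S * inc by blast+
  thus False
    using no_three_disjoint[OF K Kne S] * inc unfolding K_def by blast
qed

lemma imp_cases:
  assumes "U \<in> S" "V \<in> S" "\<not> U \<subseteq> V"
  shows "imp U V = V \<or> U \<parallel> imp U V"
proof -
  have "V \<subseteq> imp U V" "imp U V \<inter> U \<subseteq> V" using imp_ge assms imp_mp by blast+
  thus ?thesis using assms by blast
qed

text \<open>By \<open>imp_cases\<close> a value larger than \<open>V\<close> would be a second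
  partner of \<open>U\<close>.\<close>

lemma imp_incomparable:
  assumes "U \<in> S" "V \<in> S" "U \<parallel> V"
  shows "imp U V = V"
  using imp_cases[of U V] incomparable_unique[of U V "imp U V"] imp_S assms by blast

text \<open>By \<open>imp_incomparable\<close>, a point outside \<open>Q\<close> sees
  \<open>P - Q\<close> whenever \<open>P\<close> and \<open>Q\<close> are incomparable; this
  supplies the hypotheses \<open>sM\<close> and \<open>sR\<close> of
  \<open>covers_doubles\<close>.\<close>

lemma no_double_diamond:
  assumes S: "U \<in> S" "V \<in> S" "U' \<in> S" "V' \<in> S" and *: "U \<parallel> V" "U' \<parallel> V'" and eq: "U \<union> V = U' \<inter> V'"
  shows False
proof -
  have "sees x (P - Q)" if "P \<in> S" "Q \<in> S" "P \<parallel> Q" "x \<in> X" "x \<notin> Q" for P Q x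
    using imp_incomparable not_imp that by metis
  moreover have "U \<inter> V \<noteq> {}" using * S by (intro Int_nonempty) auto
  moreover have "p \<notin> U'" "p \<notin> V'" using root_in_S S * S_sub by blast+
  ultimately have "covers X r S doubles double_rel"
    using S * root dense S_Int by (intro covers_doubles[OF S eq, of p]) auto
  thus False using no_double by simp
qed

text \<open>A set incomparable to the meet or the join is incomparable to \<open>U\<close> or to
  \<open>V\<close>, hence is the other one by uniqueness, but that one is comparable to both meet
  and join.\<close>

lemma chain_elements:
  assumes S: "U \<in> S" "V \<in> S" "R \<in> S" and *: "U \<parallel> V"
  shows "\<not> R \<parallel> U \<inter> V" "\<not> R \<parallel> U \<union> V"
proof -
  show "\<not> R \<parallel> U \<inter> V"
    using incomparable_unique[OF S(1,2,3)] incomparable_unique[OF S(2,1,3)] * by blast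
  show "\<not> R \<parallel> U \<union> V"
    using incomparable_unique[OF S(1,2,3)] incomparable_unique[OF S(2,1,3)] * by blast
qed

text \<open>Uniqueness of partners keeps the closure \<open>P\<close> of the generators under
  partners finite. Meets and joins of pairs close it off, because proper ones are comparable to
  everything in \<open>S\<close>, so incomparable members of the result already lie in
  \<open>P\<close>. An implication is \<open>X\<close>, its conclusion, or the partner of its
  premise.\<close>

lemma finite_subalgebra:
  assumes F: "finite F" "F \<subseteq> S"
  obtains \<B> where "finite \<B>" "F \<subseteq> \<B>" "\<B> \<subseteq> S" "{} \<in> \<B>" "X \<in> \<B>"
    "\<And>U V. U \<in> \<B> \<Longrightarrow> V \<in> \<B> \<Longrightarrow> U \<inter> V \<in> \<B> \<and> U \<union> V \<in> \<B> \<and> imp U V \<in> \<B>"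
proof -
  define P where "P = F \<union> {{}, X} \<union> {V \<in> S. \<exists>U\<in>F. U \<parallel> V}"
  define \<B> where "\<B> = (\<lambda>(U, V). U \<inter> V) ` (P \<times> P) \<union> (\<lambda>(U, V). U \<union> V) ` (P \<times> P)"
  have "finite {V \<in> S. U \<parallel> V}" if "U \<in> F" for U
  proof (cases "\<exists>V\<in>S. U \<parallel> V")
    case True
    then obtain V where "V \<in> S" "U \<parallel> V" by blast
    hence "{V \<in> S. U \<parallel> V} \<subseteq> {V}" using incomparable_unique F(2) that by blast
    thus ?thesis by (rule finite_subset) simp
  next
    case False
    hence "{V \<in> S. U \<parallel> V} = {}" by blast
    thus ?thesis by (metis finite.emptyI)
  qed
  moreover have "{V \<in> S. \<exists>U\<in>F. U \<parallel> V} = (\<Union>U\<in>F. {V \<in> S. U \<parallel> V})" by blast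
  ultimately have finP: "finite P" unfolding P_def using F(1) by simp
  have PS: "P \<subseteq> S" unfolding P_def using F(2) S_empty S_top by blast
  have Ptop: "U \<subseteq> X" if "U \<in> S" for U using S_sub that by blast
  have Ppart: "V \<in> P" if UV: "U \<in> P" "V \<in> S" "U \<parallel> V" for U V
  proof -
    consider "U \<in> F" | W where "W \<in> F" "W \<parallel> U"
      using UV Ptop[OF \<open>V \<in> S\<close>] unfolding P_def by blast
    thus ?thesis
    proof cases
      case 1
      thus ?thesis using UV unfolding P_def by blast
    next
      case 2
      hence "W = V" using incomparable_unique[of U W V] UV PS F(2) by blast
      thus ?thesis using 2 unfolding P_def by blast
    qed
  qed
  have PB: "P \<subseteq> \<B>"
  proof
    fix U assume "U \<in> P"
    hence "(\<lambda>(U, V). U \<inter> V) (U, U) \<in> \<B>" unfolding \<B>_def by blast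
    thus "U \<in> \<B>" by simp
  qed
  have BS: "\<B> \<subseteq> S" unfolding \<B>_def using S_Int S_Un subsetD[OF PS] by auto
  have inP: "U \<in> P" if UV: "U \<in> \<B>" "V \<in> S" "U \<parallel> V" for U V
  proof -
    obtain P1 P2 where P12: "P1 \<in> P" "P2 \<in> P" "U = P1 \<inter> P2 \<or> U = P1 \<union> P2"
      using UV(1) unfolding \<B>_def by auto
    show ?thesis
    proof (cases "P1 \<parallel> P2")
      case True
      thus ?thesis using chain_elements[of P1 P2 V] P12 PS UV by blast
    next
      case False
      hence "U = P1 \<or> U = P2" using P12 by blast
      thus ?thesis using P12 by blast
    qed
  qed
  have cl: "U \<inter> V \<in> \<B>" "U \<union> V \<in> \<B>" if UV: "U \<in> \<B>" "V \<in> \<B>" for U V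
  proof -
    have "U \<inter> V \<in> \<B> \<and> U \<union> V \<in> \<B>"
    proof (cases "U \<parallel> V")
      case True
      hence "(U, V) \<in> P \<times> P" using inP UV BS by blast
      hence "(\<lambda>(U, V). U \<inter> V) (U, V) \<in> \<B>" "(\<lambda>(U, V). U \<union> V) (U, V) \<in> \<B>" unfolding \<B>_def by blast+
      thus ?thesis by simp
    next
      case False
      thus ?thesis using UV by (metis Int_absorb1 Int_absorb2 Un_absorb1 Un_absorb2)
    qed
    thus "U \<inter> V \<in> \<B>" "U \<union> V \<in> \<B>" by blast+
  qed
  have "imp U V \<in> \<B>" if UV: "U \<in> \<B>" "V \<in> \<B>" for U V
  proof (cases "U \<subseteq> V")
    case True
    hence "imp U V = X" by (auto simp: imp_iff)
    thus ?thesis using PB unfolding P_def by blast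
  next
    case False
    have US: "U \<in> S" "V \<in> S" using UV BS by auto
    have iS: "imp U V \<in> S" using US by (rule imp_S)
    show ?thesis
    proof (cases "imp U V = V")
      case ne: False
      hence inc: "U \<parallel> imp U V" using imp_cases[OF US False] by simp
      show ?thesis using Ppart[OF inP[OF UV(1) iS inc] iS inc] PB by blast
    qed (use UV in simp)
  qed
  moreover have "finite \<B>" unfolding \<B>_def using finP by blast
  moreover have "F \<subseteq> \<B>" "{} \<in> \<B>" "X \<in> \<B>" using PB unfolding P_def by blast+
  ultimately show thesis using that[of \<B>] cl BS \<open>\<And>U V. _ \<Longrightarrow> _ \<Longrightarrow> imp U V \<in> \<B>\<close> by simp
qed

end

section \<open>Finite diamond sequences as images of omitting frames\<close>

primrec hvars :: "hterm \<Rightarrow> nat set" where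
  "hvars (HVar n) = {n}"
| "hvars HBot = {}"
| "hvars HTop = {}"
| "hvars (HMeet s t) = hvars s \<union> hvars t"
| "hvars (HJoin s t) = hvars s \<union> hvars t"
| "hvars (HImp s t) = hvars s \<union> hvars t"

lemma finite_hvars: "finite (hvars t)"
  by (induction t) auto

lemma heval_cong: "(\<And>n. n \<in> hvars t \<Longrightarrow> \<rho> n = \<sigma> n) \<Longrightarrow> heval A \<rho> t = heval A \<sigma> t"
  by (induction t) auto

context omitting_frame
begin

text \<open>Finite duality for the subalgebra containing the values of the variables: its join-prime
  members are the sets \<open>j x\<close>, they form a diamond sequence under reverse inclusion, and
  sending \<open>x\<close> to \<open>j x\<close> is a p-morphism onto it.\<close>

lemma valid_at_root:
  assumes e: "\<And>(Y :: nat set) s. finite Y \<Longrightarrow> diamond_sequence Y s \<Longrightarrow> satisfies (Up Y s) e"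
    and \<rho>: "range \<rho> \<subseteq> S"
  shows "p \<in> heval (Up X r) \<rho> (fst e) \<longleftrightarrow> p \<in> heval (Up X r) \<rho> (snd e)"
proof -
  define vs where "vs = hvars (fst e) \<union> hvars (snd e)"
  obtain \<B> where fin: "finite \<B>" and vB: "\<rho> ` vs \<subseteq> \<B>" and BS: "\<B> \<subseteq> S"
    and B0: "{} \<in> \<B>" and BX: "X \<in> \<B>"
    and cl: "\<And>U V. U \<in> \<B> \<Longrightarrow> V \<in> \<B> \<Longrightarrow> U \<inter> V \<in> \<B> \<and> U \<union> V \<in> \<B> \<and> imp U V \<in> \<B>"
    by (rule finite_subalgebra[of "\<rho> ` vs"]) (use \<rho> finite_hvars in \<open>auto simp: vs_def\<close>)
  have Bun: "\<Union>\<U> \<in> \<B>" if "finite \<U>" "\<U> \<subseteq> \<B>" for \<U>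
    using that by (induction \<U> rule: finite_induct) (auto simp: B0 cl)
  have Bint: "X \<inter> \<Inter>\<U> \<in> \<B>" if "finite \<U>" "\<U> \<subseteq> \<B>" for \<U>
    using that
  proof (induction \<U> rule: finite_induct)
    case (insert U \<U>)
    moreover have "X \<inter> \<Inter>(insert U \<U>) = U \<inter> (X \<inter> \<Inter>\<U>)" by auto
    ultimately show ?case by (simp add: cl)
  qed (simp add: BX)
  \<comment> \<open>The least member of the subalgebra containing \<open>x\<close>. Intersecting
    with \<open>X\<close> keeps \<open>j x\<close> in \<open>\<B>\<close> even if no member contains
    \<open>x\<close>.\<close>
  define j where "j x = X \<inter> \<Inter>{U \<in> \<B>. x \<in> U}" for x
  have jB: "j x \<in> \<B>" for x unfolding j_def by (rule Bint) (use fin in auto)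
  have jx: "x \<in> X \<Longrightarrow> x \<in> j x" for x by (auto simp: j_def)
  have jle: "j x \<subseteq> U" if "U \<in> \<B>" "x \<in> U" for x U using that by (auto simp: j_def)
  have jiff: "j x \<subseteq> U \<longleftrightarrow> x \<in> U" if "U \<in> \<B>" "x \<in> X" for x U using jle jx that by blast
  \<comment> \<open>The points are numbered because the generators of \<open>DHA\<close> live on
    subsets of \<open>nat\<close>.\<close>
  obtain k :: "nat \<Rightarrow> 'a set" and n where bij: "bij_betw k {..<n} (j ` X)"
  proof -
    have "finite (j ` X)" using fin jB by (meson finite_subset image_subsetI)
    thus ?thesis using that ex_bij_betw_nat_finite unfolding atLeast0LessThan by blast
  qed
  define I where "I = {..<n}"
  define s where "s = {(a, b). a \<in> I \<and> b \<in> I \<and> k b \<subseteq> k a}"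
  define f where "f x = inv_into I k (j x)" for x
  have kj: "k ` I = j ` X" and inj: "inj_on k I" using bij unfolding I_def bij_betw_def by blast+
  have fI: "f x \<in> I" and kf: "k (f x) = j x" if "x \<in> X" for x
  proof -
    have "j x \<in> k ` I" using that kj by simp
    thus "f x \<in> I" "k (f x) = j x" unfolding f_def by (rule inv_into_into, rule f_inv_into_f)
  qed
  have fk: "a \<in> I \<Longrightarrow> k a = j x \<Longrightarrow> f x = a" for a x
    unfolding f_def using inv_into_f_f[OF inj, of a] by simp
  have kI: "\<exists>x\<in>X. k a = j x" if "a \<in> I" for a using kj that by blast
  have kB: "k a \<in> \<B>" if "a \<in> I" for a using kI[OF that] jB by metis
  have kS: "k a \<in> S" if "a \<in> I" for a using kB[OF that] BS by blast
  have kne: "k a \<noteq> {}" if "a \<in> I" for a using kI[OF that] jx by blast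
  have keq: "a = b" if "a \<in> I" "b \<in> I" "k a = k b" for a b using inj that by (auto dest: inj_onD)
  have s_iff: "(a, b) \<in> s \<longleftrightarrow> k b \<subseteq> k a" if "a \<in> I" "b \<in> I" for a b using that by (simp add: s_def)
  have sI: "(a, b) \<in> s \<Longrightarrow> a \<in> I \<and> b \<in> I \<and> k b \<subseteq> k a" for a b by (simp add: s_def)
  have uniq: "b = c" if "a \<in> I" "b \<in> I" "c \<in> I" "k a \<parallel> k b" "k a \<parallel> k c" for a b c
    using keq incomparable_unique[of "k a" "k b" "k c"] kS that by blast
  have po: "partial_order_on I s"
    unfolding partial_order_on_def preorder_on_def refl_on_def trans_def antisym_def
    using keq by (auto simp: s_def)
  have sfr: "frame I s" by (rule partial_order_frame[OF po])
  have inc: "k a \<parallel> k b" if "incomparable s a b" "a \<in> I" "b \<in> I" for a b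
    using that s_iff by (auto simp: incomparable_def)
  have "diamond_system I s"
    unfolding diamond_system_def
  proof (intro conjI ballI impI)
    show "partial_order_on I s" by (rule po)
  next
    fix x assume "x \<in> I"
    have "(b, c) \<in> s" if "a \<in> I" "b \<in> I" "c \<in> I" "b \<noteq> c" "a \<noteq> c" "incomparable s a b" "(a, c) \<in> s" for a b c
    proof (rule ccontr)
      assume "(b, c) \<notin> s"
      have ab: "k a \<parallel> k b" using inc that by blast
      have ca: "k c \<subseteq> k a" using that by (simp add: s_iff)
      have "\<not> k c \<subseteq> k b" using \<open>(b, c) \<notin> s\<close> that by (simp add: s_iff)
      moreover have "\<not> k b \<subseteq> k c" using ab ca by blast
      ultimately have "a = c" using uniq[of b a c] ab that by blast
      thus False using that by simp
    qed
    thus "three_point_rule (above s x) s"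
      unfolding three_point_rule_def above_def using sI by blast
    show "\<not> (\<exists>S\<subseteq>above s x. card S = 3 \<and> antichain s S)"
    proof
      assume "\<exists>S\<subseteq>above s x. card S = 3 \<and> antichain s S"
      then obtain a b c where abc: "{a, b, c} \<subseteq> above s x" "antichain s {a, b, c}" "a \<noteq> b" "b \<noteq> c" "a \<noteq> c"
        by (auto simp: card_3_iff)
      hence I3: "a \<in> I" "b \<in> I" "c \<in> I" using sI by (auto simp: above_def)
      have "k a \<parallel> k b" "k a \<parallel> k c" using abc I3 inc by (auto simp: antichain_def)
      thus False using uniq[OF I3] abc by simp
    qed
  next
    fix x y z assume "x \<in> I" "y \<in> above s x" "z \<in> above s x"
    hence yz: "y \<in> I" "z \<in> I" using sI by (auto simp: above_def)
    have "k y \<inter> k z \<noteq> {}" using yz by (intro Int_nonempty kS kne)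
    then obtain w where w: "w \<in> k y \<inter> k z" by blast
    have wX: "w \<in> X" using w kS[OF yz(1)] S_sub by blast
    have "j w \<subseteq> k y" "j w \<subseteq> k z" using w jle kB yz by blast+
    hence "(y, f w) \<in> s" "(z, f w) \<in> s" using yz fI[OF wX] kf[OF wX] by (simp_all add: s_iff)
    thus "\<exists>w\<in>I. (y, w) \<in> s \<and> (z, w) \<in> s" using fI[OF wX] by blast
  next
    fix b x y z v t assume I: "b \<in> I" "x \<in> I" "y \<in> I" "z \<in> I" "v \<in> I" "t \<in> I"
      and *: "(b, x) \<in> s \<and> (b, y) \<in> s \<and> (x, z) \<in> s \<and> (x, v) \<in> s \<and> (y, z) \<in> s \<and> (y, v) \<in> s \<and> (z, t) \<in> s \<and> (v, t) \<in> s"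
    have le: "k z \<subseteq> k x" "k v \<subseteq> k x" "k z \<subseteq> k y" "k v \<subseteq> k y" using * sI by blast+
    have "\<exists>w\<in>I. k w \<subseteq> k x \<and> k w \<subseteq> k y \<and> k z \<subseteq> k w \<and> k v \<subseteq> k w"
    proof (cases "k x \<parallel> k y \<and> k z \<parallel> k v")
      case False
      thus ?thesis using le I by blast
    next
      case True
      hence "k z \<union> k v \<noteq> k x \<inter> k y" using no_double_diamond[of "k z" "k v" "k x" "k y"] kS I by blast
      \<comment> \<open>This point gives the interpolant required by D4: \<open>j w\<close> is not
        contained in \<open>k z\<close>, and it is not incomparable to it either, since the only
        partner of \<open>k z\<close> is \<open>k v\<close> and \<open>w \<notin> k v\<close>. Hence
        \<open>j w\<close> contains \<open>k z\<close>, and likewise \<open>k v\<close>.\<close>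
      then obtain w where w: "w \<in> k x" "w \<in> k y" "w \<notin> k z" "w \<notin> k v" using le by blast
      have wX: "w \<in> X" using w(1) kS[OF I(2)] S_sub by blast
      have wj: "w \<in> j w" by (rule jx[OF wX])
      have fw: "f w \<in> I" "k (f w) = j w" using fI kf wX by blast+
      have "j w \<subseteq> k x" "j w \<subseteq> k y" using w jle kB I by blast+
      moreover have "k z \<subseteq> j w" using uniq[OF I(4) fw(1) I(5)] True w wj fw(2) by blast
      moreover have "k v \<subseteq> j w" using uniq[OF I(5) fw(1) I(4)] True w wj fw(2) by blast
      ultimately show ?thesis using fw by metis
    qed
    thus "\<exists>w\<in>I. (x, w) \<in> s \<and> (y, w) \<in> s \<and> (w, z) \<in> s \<and> (w, v) \<in> s" using I by (auto simp: s_iff)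
  qed
  \<comment> \<open>The index of \<open>j p = X\<close> is a least element, which turns the diamond
    system into a diamond sequence.\<close>
  moreover have "\<exists>w\<in>I. (w, x) \<in> s \<and> (w, y) \<in> s" if "x \<in> I" "y \<in> I" for x y
  proof -
    have "p \<in> j p" using jx root by blast
    hence "k (f p) = X" using kf[OF root(1)] root_in_S[of "j p"] jB BS by blast
    moreover have "k a \<subseteq> X" if "a \<in> I" for a using kS[OF that] S_sub by blast
    ultimately show ?thesis using that fI[OF root(1)] by (metis s_iff)
  qed
  ultimately have "diamond_sequence I s" by (simp add: diamond_sequence_def)
  hence sat: "satisfies (Up I s) e" using e by (simp add: I_def)
  have pm: "pmap X r S X f I s"
  proof (rule pmapI[where F = I])
    show "X \<in> upsets X r" using S_top S_upsets by blast
    show "finite I" "I \<subseteq> I" by (simp_all add: I_def)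
    show "\<And>x. x \<in> X \<Longrightarrow> f x \<in> I" by (rule fI)
    show "frame I s" by (rule sfr)
  next
    fix x y assume xy: "x \<in> X" "y \<in> X" "(x, y) \<in> r"
    have "y \<in> j x" using S_up[of "j x" x y] jB BS jx xy by blast
    hence "j y \<subseteq> j x" using jle jB by blast
    thus "(f x, f y) \<in> s" using fI kf xy by (simp add: s_iff)
  next
    fix x a assume x: "x \<in> X" and a: "(f x, a) \<in> s"
    have aI: "a \<in> I" and ka: "k a \<subseteq> j x" using sI[OF a] kf[OF x] by simp_all
    then obtain y where y: "y \<in> X" "k a = j y" using kI by blast
    \<comment> \<open>The largest member of the subalgebra omitting \<open>y\<close>. A point
      \<open>z\<close> of \<open>j y - m\<close> has \<open>j z = j y\<close>: if \<open>y\<close>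
      were not in \<open>j z\<close>, then \<open>j z\<close>, and with it \<open>z\<close>, would
      be inside \<open>m\<close>.\<close>
    define m where "m = \<Union>{U \<in> \<B>. y \<notin> U}"
    have mB: "m \<in> \<B>" unfolding m_def by (rule Bun) (use fin in auto)
    have ym: "y \<notin> m" by (auto simp: m_def)
    have "x \<notin> imp (j y) m"
    proof
      assume "x \<in> imp (j y) m"
      hence "j x \<subseteq> imp (j y) m" using jle cl jB mB by blast
      hence "y \<in> imp (j y) m" using ka y jx by blast
      thus False using imp_mp jx[OF y(1)] ym by blast
    qed
    then obtain z where z: "(x, z) \<in> r" "z \<in> j y" "z \<notin> m"
      using not_imp[OF x] by (auto simp: sees_def)
    have zX: "z \<in> X" using closed x z by blast
    have "j z \<subseteq> j y" using z jle jB by blast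
    moreover have "y \<in> j z" using z(3) jB[of z] jx[OF zX] unfolding m_def by blast
    hence "j y \<subseteq> j z" using jle jB by blast
    ultimately have "f z = a" using fk aI y(2) by blast
    thus "\<exists>z. (x, z) \<in> r \<and> f z = a" using z by blast
  next
    fix a assume a: "a \<in> I"
    have "(a, f x) \<in> s \<longleftrightarrow> x \<in> k a" if "x \<in> X" for x
      using a fI kf jiff kB that by (simp add: s_iff)
    thus "\<exists>W\<in>S. \<forall>x\<in>X. (a, f x) \<in> s \<longleftrightarrow> x \<in> W" using kS a by blast
  qed
  \<comment> \<open>Variables not occurring in \<open>e\<close> get the value \<open>{}\<close>, so
    that all values lie in the finite subalgebra.\<close>
  define \<rho>' where "\<rho>' i = (if i \<in> vs then \<rho> i else {})" for i
  define \<sigma> where "\<sigma> i = {a \<in> I. k a \<subseteq> \<rho>' i}" for i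
  have \<rho>'B: "\<rho>' i \<in> \<B>" for i using vB B0 by (auto simp: \<rho>'_def)
  have hev: "heval (Up X r) \<rho> t = heval (Up X r) \<rho>' t" if "hvars t \<subseteq> vs" for t
    using that by (intro heval_cong) (auto simp: \<rho>'_def)
  have "\<forall>x\<in>X. f x \<in> \<sigma> i \<longleftrightarrow> x \<in> \<rho>' i" for i
    using fI kf jiff \<rho>'B by (simp add: \<sigma>_def)
  hence tr: "\<forall>x\<in>X. f x \<in> heval (Up I s) \<sigma> t \<longleftrightarrow> x \<in> heval (Up X r) \<rho>' t" for t
    by (rule heval_pmap[OF frame_axioms sfr pm])
  have "\<sigma> i \<in> upsets I s" for i using sI by (auto simp: \<sigma>_def upsets_iff)
  hence "range \<sigma> \<subseteq> carrier (Up I s)" by auto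
  hence "heval (Up I s) \<sigma> (fst e) = heval (Up I s) \<sigma> (snd e)" using sat unfolding satisfies_def by blast
  thus ?thesis using bspec[OF tr root(1), symmetric] hev[of "fst e"] hev[of "snd e"] by (simp add: vs_def)
qed

end

section \<open>From an algebra outside \<open>DHA\<close> to a forbidden poset\<close>

lemma (in general_frame) restrict:
  assumes Z: "Z \<in> upsets X r"
  shows "general_frame Z r ((\<lambda>U. Z \<inter> U) ` S)"
proof -
  interpret Z: frame Z r by (rule upset_frame[OF Z])
  show ?thesis
  proof
    show "(\<lambda>U. Z \<inter> U) ` S \<subseteq> upsets Z r" using Z S_up by (auto simp: upsets_iff)
    show "{} \<in> (\<lambda>U. Z \<inter> U) ` S" using S_empty by (metis Int_empty_right imageI)
    show "Z \<in> (\<lambda>U. Z \<inter> U) ` S" using S_top Z by (metis Int_absorb2 imageI upsets_subset)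
    fix U V assume "U \<in> (\<lambda>U. Z \<inter> U) ` S" "V \<in> (\<lambda>U. Z \<inter> U) ` S"
    then obtain U' V' where UV: "U = Z \<inter> U'" "V = Z \<inter> V'" "U' \<in> S" "V' \<in> S" by blast
    have "U \<inter> V = Z \<inter> (U' \<inter> V')" "U \<union> V = Z \<inter> (U' \<union> V')" using UV by auto
    thus "U \<inter> V \<in> (\<lambda>U. Z \<inter> U) ` S" "U \<union> V \<in> (\<lambda>U. Z \<inter> U) ` S"
      using S_Int[OF UV(3,4)] S_Un[OF UV(3,4)] by simp_all
    have "above r x \<subseteq> Z" "x \<in> X" if "x \<in> Z" for x using Z that by (auto simp: upsets_def)
    hence "{x \<in> Z. above r x \<inter> U \<subseteq> V} = Z \<inter> {x \<in> X. above r x \<inter> U' \<subseteq> V'}"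
      unfolding UV by blast
    thus "{x \<in> Z. above r x \<inter> U \<subseteq> V} \<in> (\<lambda>U. Z \<inter> U) ` S" using S_imp[OF UV(3,4)] by simp
  qed
qed

lemma (in general_frame) restrict_heval:
  assumes Z: "Z \<in> upsets X r"
  shows "heval (Up Z r) (\<lambda>n. Z \<inter> \<rho> n) t = Z \<inter> heval (Up X r) \<rho> t"
proof (induction t)
  case (HImp t u)
  have "above r x \<subseteq> Z" "x \<in> X" if "x \<in> Z" for x using Z that by (auto simp: upsets_def)
  thus ?case using HImp by (auto simp: upsets_def; blast)
qed (use Z in \<open>auto simp: upsets_def\<close>)

lemma not_DHA_forbidden:
  assumes A: "(A :: 'c heyting) \<in> variety V" "A \<notin> DHA"
  obtains Y s where "(Y, s) \<in> {(forks, fork_rel), (fans, fan_rel), (pentagons, pentagon_rel), (doubles, double_rel)}"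
    and "\<And>e. e \<in> V \<Longrightarrow> satisfies (Up Y s) e"
proof -
  note found = that
  interpret A: heyting_algebra A using A by (simp add: variety_def)
  obtain E where E: "{Up X r | (X :: nat set) r. finite X \<and> diamond_sequence X r} \<subseteq> variety E"
    and AE: "A \<notin> variety E"
    using A(2) unfolding DHA_def generated_variety_def by blast
  obtain e where e: "e \<in> E" "\<not> satisfies A e"
    using AE A.heyting_algebra_axioms unfolding variety_def by blast
  let ?X = A.spectrum and ?r = A.spectrum_le and ?S = "A.spec ` carrier A"
  interpret G: general_frame ?X ?r ?S by (rule A.spec_general_frame)
  obtain \<rho> where \<rho>: "range \<rho> \<subseteq> ?S" and ne: "heval (Up ?X ?r) \<rho> (fst e) \<noteq> heval (Up ?X ?r) \<rho> (snd e)"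
    using e(2) A.satisfies_iff_valid_spec unfolding valid_on_def by blast
  have "range \<rho> \<subseteq> upsets ?X ?r" using \<rho> G.S_upsets by blast
  hence "heval (Up ?X ?r) \<rho> t \<subseteq> ?X" for t by (rule upsets_subset[OF G.heval_upset])
  then obtain p where p: "p \<in> ?X"
    and pne: "\<not> (p \<in> heval (Up ?X ?r) \<rho> (fst e) \<longleftrightarrow> p \<in> heval (Up ?X ?r) \<rho> (snd e))"
    using ne by blast
  define Z where "Z = above ?r p"
  have Z: "Z \<in> upsets ?X ?r" unfolding Z_def by (rule G.above_upset[OF p])
  have pZ: "p \<in> Z" unfolding Z_def by (rule G.above_self[OF p])
  let ?T = "(\<lambda>U. Z \<inter> U) ` ?S"
  interpret Z: general_frame Z ?r ?T by (rule G.restrict[OF Z])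
  interpret Z: rooted_frame Z ?r ?T p
    by unfold_locales (use pZ in \<open>auto simp: Z_def above_def\<close>)
  have valid: "valid_on Z ?r ?T e'" if "e' \<in> V" for e'
    unfolding valid_on_def
  proof (intro allI impI)
    fix \<sigma> :: "nat \<Rightarrow> 'c set set" assume \<sigma>: "range \<sigma> \<subseteq> ?T"
    define \<tau> where "\<tau> n = (SOME U. U \<in> ?S \<and> \<sigma> n = Z \<inter> U)" for n
    have \<tau>: "\<tau> n \<in> ?S \<and> \<sigma> n = Z \<inter> \<tau> n" for n
      unfolding \<tau>_def by (rule someI_ex) (use \<sigma> in blast)
    hence \<sigma>_eq: "\<sigma> = (\<lambda>n. Z \<inter> \<tau> n)" by blast
    have "satisfies A e'" using A(1) that by (simp add: variety_def)
    moreover have "range \<tau> \<subseteq> ?S" using \<tau> by blast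
    ultimately have "heval (Up ?X ?r) \<tau> (fst e') = heval (Up ?X ?r) \<tau> (snd e')"
      using A.satisfies_iff_valid_spec unfolding valid_on_def by blast
    thus "heval (Up Z ?r) \<sigma> (fst e') = heval (Up Z ?r) \<sigma> (snd e')"
      unfolding \<sigma>_eq G.restrict_heval[OF Z] by simp
  qed
  have cov: thesis if "covers Z ?r ?T Y s" "partial_order_on Y s"
    "(Y, s) \<in> {(forks, fork_rel), (fans, fan_rel), (pentagons, pentagon_rel), (doubles, double_rel)}" for Y s
    using that(3)
    by (rule found) (rule covers_satisfies[OF Z.frame_axioms partial_order_frame[OF that(2)] that(1) valid])
  show thesis
  proof (rule ccontr)
    assume nt: "\<not> thesis"
    have nc: "\<not> covers Z ?r ?T forks fork_rel" "\<not> covers Z ?r ?T fans fan_rel"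
      "\<not> covers Z ?r ?T pentagons pentagon_rel" "\<not> covers Z ?r ?T doubles double_rel"
      using nt cov[OF _ partial_order_forks] cov[OF _ partial_order_fans]
        cov[OF _ partial_order_pentagons] cov[OF _ partial_order_doubles] by blast+
    interpret Z: omitting_frame Z ?r ?T p
      by unfold_locales (erule (2) Z.sees_nonempty[OF nc(1)] | rule nc)+
    have "p \<in> heval (Up Z ?r) (\<lambda>n. Z \<inter> \<rho> n) (fst e) \<longleftrightarrow> p \<in> heval (Up Z ?r) (\<lambda>n. Z \<inter> \<rho> n) (snd e)"
    proof (rule Z.valid_at_root)
      have "Z \<inter> \<rho> n \<in> ?T" for n using \<rho> by (intro imageI[of _ _ "\<lambda>U. Z \<inter> U"]) (rule subsetD, auto)
      thus "range (\<lambda>n. Z \<inter> \<rho> n) \<subseteq> ?T" by (rule image_subsetI)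
      fix Y :: "nat set" and s assume "finite Y" "diamond_sequence Y s"
      hence "Up Y s \<in> variety E" using E by blast
      thus "satisfies (Up Y s) e" using e(1) by (simp add: variety_def)
    qed
    thus False using pne pZ unfolding G.restrict_heval[OF Z] by blast
  qed
qed

section \<open>Points of a profinite completion\<close>

lemma congruenceD:
  assumes "heyting_congruence A \<theta>"
  shows "equiv (carrier A) \<theta>"
    "(x, x') \<in> \<theta> \<Longrightarrow> (y, y') \<in> \<theta> \<Longrightarrow> (meet A x y, meet A x' y') \<in> \<theta>"
    "(x, x') \<in> \<theta> \<Longrightarrow> (y, y') \<in> \<theta> \<Longrightarrow> (join A x y, join A x' y') \<in> \<theta>"
    "(x, x') \<in> \<theta> \<Longrightarrow> (y, y') \<in> \<theta> \<Longrightarrow> (himp A x y, himp A x' y') \<in> \<theta>"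
  using assms unfolding heyting_congruence_def by blast+

lemma congruenceI:
  assumes "equiv (carrier A) \<theta>"
    and "\<And>x x' y y'. (x, x') \<in> \<theta> \<Longrightarrow> (y, y') \<in> \<theta> \<Longrightarrow>
      (meet A x y, meet A x' y') \<in> \<theta> \<and> (join A x y, join A x' y') \<in> \<theta> \<and> (himp A x y, himp A x' y') \<in> \<theta>"
  shows "heyting_congruence A \<theta>"
  using assms unfolding heyting_congruence_def by auto

lemma quotient_ops:
  assumes \<theta>: "heyting_congruence A \<theta>" and ab: "a \<in> carrier A" "b \<in> carrier A"
  shows "meet (quotient_algebra A \<theta>) (\<theta> `` {a}) (\<theta> `` {b}) = \<theta> `` {meet A a b}"
    "join (quotient_algebra A \<theta>) (\<theta> `` {a}) (\<theta> `` {b}) = \<theta> `` {join A a b}"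
    "himp (quotient_algebra A \<theta>) (\<theta> `` {a}) (\<theta> `` {b}) = \<theta> `` {himp A a b}"
proof -
  note eq = congruenceD(1)[OF \<theta>]
  have *: "(\<Union>x\<in>\<theta> `` {a}. \<Union>y\<in>\<theta> `` {b}. \<theta> `` {f x y}) = \<theta> `` {f a b}"
    if f: "\<And>x x' y y'. (x, x') \<in> \<theta> \<Longrightarrow> (y, y') \<in> \<theta> \<Longrightarrow> (f x y, f x' y') \<in> \<theta>" for f
    by (rule UN_equiv_class2[OF eq eq _ ab], rule congruent2I', rule equiv_class_eq[OF eq], rule f)
  show "meet (quotient_algebra A \<theta>) (\<theta> `` {a}) (\<theta> `` {b}) = \<theta> `` {meet A a b}"
    "join (quotient_algebra A \<theta>) (\<theta> `` {a}) (\<theta> `` {b}) = \<theta> `` {join A a b}"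
    "himp (quotient_algebra A \<theta>) (\<theta> `` {a}) (\<theta> `` {b}) = \<theta> `` {himp A a b}"
    unfolding quotient_algebra_def by (simp_all add: * congruenceD(2-4)[OF \<theta>])
qed

text \<open>A congruence is determined by the class of the top: if \<open>himp A a b\<close> is
  related to the top, then \<open>a\<close> is related to \<open>meet A a (himp A a b)\<close>,
  which is \<open>meet A a b\<close>, and symmetrically for \<open>b\<close>.\<close>

lemma (in heyting_algebra) congruence_iff_himp:
  assumes \<theta>: "heyting_congruence A \<theta>" and ab: "a \<in> carrier A" "b \<in> carrier A"
  shows "(a, b) \<in> \<theta> \<longleftrightarrow> (himp A a b, htop A) \<in> \<theta> \<and> (himp A b a, htop A) \<in> \<theta>"
proof
  have rf: "x \<in> carrier A \<Longrightarrow> (x, x) \<in> \<theta>" for x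
    using congruenceD(1)[OF \<theta>] by (auto simp: equiv_def refl_on_def)
  have tr: "(x, y) \<in> \<theta> \<Longrightarrow> (y, z) \<in> \<theta> \<Longrightarrow> (x, z) \<in> \<theta>" and sy: "(x, y) \<in> \<theta> \<Longrightarrow> (y, x) \<in> \<theta>" for x y z
    using congruenceD(1)[OF \<theta>] by (auto simp: equiv_def sym_def dest: transD)
  have self: "himp A x x = htop A" if "x \<in> carrier A" for x
    using that by (simp add: himp_top_iff le_refl)
  {
    assume "(a, b) \<in> \<theta>"
    hence "(himp A a b, himp A b b) \<in> \<theta>" "(himp A b a, himp A a a) \<in> \<theta>"
      using congruenceD(4)[OF \<theta>] rf ab sy by blast+
    thus "(himp A a b, htop A) \<in> \<theta> \<and> (himp A b a, htop A) \<in> \<theta>" using self ab by simp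
  next
    assume *: "(himp A a b, htop A) \<in> \<theta> \<and> (himp A b a, htop A) \<in> \<theta>"
    have mh: "meet A x (himp A x y) = meet A x y" if xy: "x \<in> carrier A" "y \<in> carrier A" for x y
    proof (rule le_antisym)
      show "meet A x (himp A x y) \<sqsubseteq> meet A x y"
        using xy mp[of x y]
        by (intro meet_greatest) (simp_all add: meet_closed himp_closed meet_le1 meet_comm)
      have "meet A x y \<sqsubseteq> himp A x y"
        using xy meet_le2 meet_assoc meet_idem
        by (simp add: residuation[symmetric] meet_closed) (metis meet_closed meet_comm meet_le2)
      thus "meet A x y \<sqsubseteq> meet A x (himp A x y)"
        using xy by (intro meet_greatest) (simp_all add: meet_closed himp_closed meet_le1)
    qed (use xy in \<open>simp_all add: meet_closed himp_closed\<close>)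
    have top: "meet A x (htop A) = x" if "x \<in> carrier A" for x
      using that htop_greatest by (simp add: heyting_le_def)
    have "(meet A a (himp A a b), meet A a (htop A)) \<in> \<theta>" "(meet A b (himp A b a), meet A b (htop A)) \<in> \<theta>"
      using * rf ab by (auto intro: congruenceD(2)[OF \<theta>])
    hence "(meet A a b, a) \<in> \<theta>" "(meet A b a, b) \<in> \<theta>" using ab mh top by simp_all
    thus "(a, b) \<in> \<theta>" using tr sy meet_comm ab by metis
  }
qed

lemma finite_index_Int:
  assumes "\<theta> \<in> finite_index_congruences A" "\<theta>' \<in> finite_index_congruences A"
  shows "\<theta> \<inter> \<theta>' \<in> finite_index_congruences A"
proof -
  have c: "heyting_congruence A \<theta>" "heyting_congruence A \<theta>'"
    and f: "finite (carrier A // \<theta>)" "finite (carrier A // \<theta>')"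
    using assms by (auto simp: finite_index_congruences_def)
  have "equiv (carrier A) (\<theta> \<inter> \<theta>')"
    using congruenceD(1)[OF c(1)] congruenceD(1)[OF c(2)]
    unfolding equiv_def refl_on_def sym_def trans_def by blast
  hence "heyting_congruence A (\<theta> \<inter> \<theta>')"
    by (rule congruenceI) (simp add: congruenceD(2-4)[OF c(1)] congruenceD(2-4)[OF c(2)])
  moreover have "carrier A // (\<theta> \<inter> \<theta>') \<subseteq> (\<lambda>(C, D). C \<inter> D) ` ((carrier A // \<theta>) \<times> (carrier A // \<theta>'))"
  proof
    fix C assume "C \<in> carrier A // (\<theta> \<inter> \<theta>')"
    then obtain a where a: "a \<in> carrier A" "C = (\<theta> \<inter> \<theta>') `` {a}" by (auto simp: quotient_def)
    hence "C = (\<lambda>(C, D). C \<inter> D) (\<theta> `` {a}, \<theta>' `` {a})" by auto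
    moreover have "(\<theta> `` {a}, \<theta>' `` {a}) \<in> (carrier A // \<theta>) \<times> (carrier A // \<theta>')"
      using a by (simp add: quotientI)
    ultimately show "C \<in> (\<lambda>(C, D). C \<inter> D) ` ((carrier A // \<theta>) \<times> (carrier A // \<theta>'))" by (rule image_eqI)
  qed
  hence "finite (carrier A // (\<theta> \<inter> \<theta>'))" by (rule finite_subset) (use f in simp)
  ultimately show ?thesis by (simp add: finite_index_congruences_def)
qed

section \<open>Finite-index congruences as finite upsets of the dual poset\<close>

locale completion_iso =
  frame Y s + A: heyting_algebra A
  for Y :: "'y set" and s and A :: "'b heyting" +
  fixes g :: "'y set \<Rightarrow> 'b rel \<Rightarrow> 'b set"
  assumes antisym: "(x, y) \<in> s \<Longrightarrow> (y, x) \<in> s \<Longrightarrow> x = y"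
    and g_hom: "g \<in> heyting_hom (Up Y s) (profinite_completion A)"
    and g_bij: "bij_betw g (upsets Y s) (carrier (profinite_completion A))"
begin

abbreviation "Cong \<equiv> finite_index_congruences A"
abbreviation "Ups \<equiv> upsets Y s"

definition imp :: "'y set \<Rightarrow> 'y set \<Rightarrow> 'y set" where
  "imp U V = {x \<in> Y. above s x \<inter> U \<subseteq> V}"

lemma imp_iff: "x \<in> imp U V \<longleftrightarrow> x \<in> Y \<and> (\<forall>y. (x, y) \<in> s \<longrightarrow> y \<in> U \<longrightarrow> y \<in> V)"
  by (auto simp: imp_def above_def)

lemma imp_Ups: "imp U V \<in> Ups"
  unfolding imp_def by (rule himp_upset)

lemma Cong_congruence: "\<theta> \<in> Cong \<Longrightarrow> heyting_congruence A \<theta>"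
  and Cong_finite: "\<theta> \<in> Cong \<Longrightarrow> finite (carrier A // \<theta>)"
  by (simp_all add: finite_index_congruences_def)

lemma Cong_equiv: "\<theta> \<in> Cong \<Longrightarrow> equiv (carrier A) \<theta>"
  by (rule congruenceD(1)[OF Cong_congruence])

lemma in_completion_iff:
  "f \<in> carrier (profinite_completion A) \<longleftrightarrow>
     f \<in> (\<Pi>\<^sub>E \<theta>\<in>Cong. carrier A // \<theta>) \<and>
     (\<forall>\<theta>\<in>Cong. \<forall>\<theta>'\<in>Cong. \<theta>' \<subseteq> \<theta> \<longrightarrow> \<theta> `` f \<theta>' = f \<theta>)"
  by (simp add: profinite_completion_def inverse_limit_def Let_def quotient_algebra_def) blast

lemma g_in: "U \<in> Ups \<Longrightarrow> g U \<in> carrier (profinite_completion A)"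
  using heyting_homD(1)[OF g_hom] by simp

lemma g_class:
  assumes "U \<in> Ups" "\<theta> \<in> Cong"
  obtains a where "a \<in> carrier A" "g U \<theta> = \<theta> `` {a}"
proof -
  have "g U \<theta> \<in> carrier A // \<theta>" using g_in[OF assms(1)] assms(2) by (auto simp: in_completion_iff)
  thus ?thesis using that by (auto simp: quotient_def)
qed

lemma g_trans: "U \<in> Ups \<Longrightarrow> \<theta> \<in> Cong \<Longrightarrow> \<theta>' \<in> Cong \<Longrightarrow> \<theta>' \<subseteq> \<theta> \<Longrightarrow> \<theta> `` g U \<theta>' = g U \<theta>"
  using g_in in_completion_iff by blast

lemma g_ops:
  assumes "\<theta> \<in> Cong" "U \<in> Ups" "V \<in> Ups"
  shows "g (U \<inter> V) \<theta> = meet (quotient_algebra A \<theta>) (g U \<theta>) (g V \<theta>)"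
    "g (U \<union> V) \<theta> = join (quotient_algebra A \<theta>) (g U \<theta>) (g V \<theta>)"
    "g (imp U V) \<theta> = himp (quotient_algebra A \<theta>) (g U \<theta>) (g V \<theta>)"
  using heyting_homD(2-4)[OF g_hom, of U V] assms
  by (simp_all add: imp_def profinite_completion_def inverse_limit_def Let_def)

lemma g_top: "\<theta> \<in> Cong \<Longrightarrow> g Y \<theta> = \<theta> `` {htop A}"
  and g_bot: "\<theta> \<in> Cong \<Longrightarrow> g {} \<theta> = \<theta> `` {hbot A}"
  using heyting_homD(5,6)[OF g_hom]
  by (simp_all add: profinite_completion_def inverse_limit_def Let_def quotient_algebra_def)

lemma Y_Ups: "Y \<in> Ups"
  using closed by (auto simp: upsets_iff)

lemma g_eqI:
  assumes "U \<in> Ups" "V \<in> Ups" "\<And>\<theta>. \<theta> \<in> Cong \<Longrightarrow> g U \<theta> = g V \<theta>"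
  shows "U = V"
proof -
  have "g U \<in> (\<Pi>\<^sub>E \<theta>\<in>Cong. carrier A // \<theta>)" "g V \<in> (\<Pi>\<^sub>E \<theta>\<in>Cong. carrier A // \<theta>)"
    using g_in[OF assms(1)] g_in[OF assms(2)] by (simp_all add: in_completion_iff)
  hence "g U = g V" using assms(3) by (rule PiE_ext)
  thus ?thesis using g_bij assms by (auto simp: bij_betw_def dest: inj_onD)
qed

lemma g_surj:
  assumes "f \<in> carrier (profinite_completion A)"
  obtains U where "U \<in> Ups" "g U = f"
  using g_bij assms unfolding bij_betw_def by (metis imageE)

lemma g_eq_iff_top:
  assumes \<theta>: "\<theta> \<in> Cong" and UV: "U \<in> Ups" "V \<in> Ups"
  shows "g U \<theta> = g V \<theta> \<longleftrightarrow> g (imp U V) \<theta> = g Y \<theta> \<and> g (imp V U) \<theta> = g Y \<theta>"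
proof -
  obtain a b where a: "a \<in> carrier A" "g U \<theta> = \<theta> `` {a}" and b: "b \<in> carrier A" "g V \<theta> = \<theta> `` {b}"
    using g_class[OF UV(1) \<theta>] g_class[OF UV(2) \<theta>] by metis
  note [simp] = eq_equiv_class_iff[OF Cong_equiv[OF \<theta>]]
  show ?thesis
    using A.congruence_iff_himp[OF Cong_congruence[OF \<theta>] a(1) b(1)] a b
    by (simp add: g_ops[OF \<theta>] g_top[OF \<theta>] UV quotient_ops[OF Cong_congruence[OF \<theta>]]
      A.himp_closed A.htop_closed)
qed

text \<open>The meet of all upsets that \<open>\<theta>\<close> identifies with the top is computed coordinatewise in the
  completion. It exists there because the quotients are finite.\<close>

lemma least_in_kernel:
  assumes \<theta>: "\<theta> \<in> Cong"
  obtains W where "W \<in> Ups" "\<And>U. U \<in> Ups \<Longrightarrow> g U \<theta> = g Y \<theta> \<longleftrightarrow> W \<subseteq> U"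
proof -
  define N where "N = {U \<in> Ups. g U \<theta> = g Y \<theta>}"
  have NU: "U \<in> Ups" if "U \<in> N" for U using that by (simp add: N_def)
  have YN: "Y \<in> N" by (simp add: N_def Y_Ups)
  have NI: "U \<inter> V \<in> N" if "U \<in> N" "V \<in> N" for U V
  proof -
    have "g (U \<inter> V) \<theta> = g (Y \<inter> Y) \<theta>"
      unfolding g_ops(1)[OF \<theta> Y_Ups Y_Ups] using that by (simp only: N_def mem_Collect_eq g_ops(1)[OF \<theta>])
    thus ?thesis using that by (simp add: N_def upsets_Int)
  qed
  have up: "V \<in> N" if "U \<in> N" "V \<in> Ups" "U \<subseteq> V" for U V
  proof -
    have "g (V \<inter> Y) \<theta> = g (V \<inter> U) \<theta>" using that \<theta> Y_Ups by (simp add: N_def g_ops(1)[OF \<theta>])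
    moreover have "V \<inter> Y = V" "V \<inter> U = U" using that upsets_subset by blast+
    ultimately show ?thesis using that by (simp add: N_def)
  qed
  \<comment> \<open>At one coordinate only finitely many values occur, so a finite intersection of
    members of \<open>N\<close> attains the least of them.\<close>
  have "\<exists>M\<in>N. \<forall>U\<in>N. g (M \<inter> U) \<theta>' = g M \<theta>'" if \<theta>': "\<theta>' \<in> Cong" for \<theta>'
  proof -
    have "g U \<theta>' \<in> carrier A // \<theta>'" if "U \<in> N" for U
      using g_in[OF NU[OF that]] \<theta>' by (auto simp: in_completion_iff)
    hence "finite ((\<lambda>U. g U \<theta>') ` N)"
      by (intro finite_subset[OF _ Cong_finite[OF \<theta>']]) blast
    then obtain R where R: "R \<subseteq> N" "finite R" "(\<lambda>U. g U \<theta>') ` N = (\<lambda>U. g U \<theta>') ` R"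
      using finite_subset_image[of "(\<lambda>U. g U \<theta>') ` N" "\<lambda>U. g U \<theta>'" N] by blast
    have M: "Y \<inter> \<Inter>R' \<in> N" if "finite R'" "R' \<subseteq> N" for R'
      using that
    proof (induction R' rule: finite_induct)
      case (insert U R')
      have "Y \<inter> \<Inter>(insert U R') = U \<inter> (Y \<inter> \<Inter>R')" by auto
      thus ?case using insert NI by simp
    qed (simp add: YN)
    let ?M = "Y \<inter> \<Inter>R"
    have MN: "?M \<in> N" using M R by blast
    have "g (?M \<inter> U) \<theta>' = g ?M \<theta>'" if U: "U \<in> N" for U
    proof -
      obtain V where V: "V \<in> R" "g U \<theta>' = g V \<theta>'" using R(3) U by (metis (no_types, lifting) image_iff)
      have "g (?M \<inter> U) \<theta>' = g (?M \<inter> V) \<theta>'"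
        using V R(1) NU[OF MN] NU[OF U] NU[of V] by (simp add: g_ops(1)[OF \<theta>'] subset_iff)
      moreover have "?M \<inter> V = ?M" using V by blast
      ultimately show ?thesis by simp
    qed
    thus ?thesis using MN by blast
  qed
  then obtain M where MN: "\<And>\<theta>'. \<theta>' \<in> Cong \<Longrightarrow> M \<theta>' \<in> N"
    and min: "\<And>\<theta>' U. \<theta>' \<in> Cong \<Longrightarrow> U \<in> N \<Longrightarrow> g (M \<theta>' \<inter> U) \<theta>' = g (M \<theta>') \<theta>'"
    by metis
  \<comment> \<open>The least values are compatible: each of \<open>M \<theta>1\<close> and
    \<open>M \<theta>2\<close> can be replaced by their intersection without changing its value at
    its own coordinate.\<close>
  have "(\<lambda>\<theta>'\<in>Cong. g (M \<theta>') \<theta>') \<in> carrier (profinite_completion A)"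
    unfolding in_completion_iff
  proof (intro conjI ballI impI)
    have "g (M \<theta>') \<theta>' \<in> carrier A // \<theta>'" if "\<theta>' \<in> Cong" for \<theta>'
      using g_in[OF NU[OF MN[OF that]]] that by (auto simp: in_completion_iff)
    thus "(\<lambda>\<theta>'\<in>Cong. g (M \<theta>') \<theta>') \<in> (\<Pi>\<^sub>E \<theta>\<in>Cong. carrier A // \<theta>)" by auto
  next
    fix \<theta>1 \<theta>2 assume *: "\<theta>1 \<in> Cong" "\<theta>2 \<in> Cong" "\<theta>2 \<subseteq> \<theta>1"
    have MU: "M \<theta>1 \<in> Ups" "M \<theta>2 \<in> Ups" "M \<theta>2 \<inter> M \<theta>1 \<in> Ups"
      using NU MN * upsets_Int by blast+
    have "\<theta>1 `` g (M \<theta>2) \<theta>2 = \<theta>1 `` g (M \<theta>2 \<inter> M \<theta>1) \<theta>2" using min[OF *(2) MN[OF *(1)]] by simp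
    also have "\<dots> = g (M \<theta>1 \<inter> M \<theta>2) \<theta>1" using g_trans[OF MU(3) *(1,2,3)] by (simp add: Int_commute)
    also have "\<dots> = g (M \<theta>1) \<theta>1" using min[OF *(1) MN[OF *(2)]] by simp
    finally show "\<theta>1 `` (\<lambda>\<theta>'\<in>Cong. g (M \<theta>') \<theta>') \<theta>2 = (\<lambda>\<theta>'\<in>Cong. g (M \<theta>') \<theta>') \<theta>1" using * by simp
  qed
  then obtain W where W: "W \<in> Ups" "g W = (\<lambda>\<theta>'\<in>Cong. g (M \<theta>') \<theta>')" by (rule g_surj)
  have gW: "g W \<theta>' = g (M \<theta>') \<theta>'" if "\<theta>' \<in> Cong" for \<theta>' using W that by simp
  have WN: "W \<in> N" using W(1) gW[OF \<theta>] MN[OF \<theta>] by (simp add: N_def)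
  have "W \<subseteq> U" if U: "U \<in> N" for U
  proof -
    have "W \<inter> U = W"
    proof (rule g_eqI)
      fix \<theta>' assume \<theta>': "\<theta>' \<in> Cong"
      have "g (W \<inter> U) \<theta>' = g (M \<theta>' \<inter> U) \<theta>'"
        using W(1) NU[OF U] NU[OF MN[OF \<theta>']] gW[OF \<theta>'] by (simp add: g_ops(1)[OF \<theta>'])
      thus "g (W \<inter> U) \<theta>' = g W \<theta>'" using min[OF \<theta>' U] gW[OF \<theta>'] by simp
    qed (use W NU[OF U] upsets_Int in auto)
    thus ?thesis by blast
  qed
  hence "g U \<theta> = g Y \<theta> \<longleftrightarrow> W \<subseteq> U" if "U \<in> Ups" for U
    using up[OF WN that] that by (auto simp: N_def)
  thus ?thesis using that W(1) by blast
qed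

text \<open>The generator of the filter of upsets that \<open>\<theta>\<close> identifies with the
  top. The quotient by \<open>\<theta>\<close> thereby becomes restriction of upsets to
  \<open>ker \<theta>\<close>, see \<open>ker_eq_iff\<close>.\<close>

definition ker :: "'b rel \<Rightarrow> 'y set" where
  "ker \<theta> = (SOME W. W \<in> Ups \<and> (\<forall>U\<in>Ups. g U \<theta> = g Y \<theta> \<longleftrightarrow> W \<subseteq> U))"

lemma ker:
  assumes "\<theta> \<in> Cong"
  shows ker_Ups: "ker \<theta> \<in> Ups" and ker_top: "U \<in> Ups \<Longrightarrow> g U \<theta> = g Y \<theta> \<longleftrightarrow> ker \<theta> \<subseteq> U"
proof -
  have "\<exists>W. W \<in> Ups \<and> (\<forall>U\<in>Ups. g U \<theta> = g Y \<theta> \<longleftrightarrow> W \<subseteq> U)"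
    using least_in_kernel[OF assms] by metis
  from someI_ex[OF this]
  show "ker \<theta> \<in> Ups" "U \<in> Ups \<Longrightarrow> g U \<theta> = g Y \<theta> \<longleftrightarrow> ker \<theta> \<subseteq> U" unfolding ker_def by blast+
qed

lemma ker_eq_iff:
  assumes \<theta>: "\<theta> \<in> Cong" and UV: "U \<in> Ups" "V \<in> Ups"
  shows "g U \<theta> = g V \<theta> \<longleftrightarrow> U \<inter> ker \<theta> = V \<inter> ker \<theta>"
proof -
  have K: "ker \<theta> \<subseteq> Y" "\<And>x y. x \<in> ker \<theta> \<Longrightarrow> (x, y) \<in> s \<Longrightarrow> y \<in> ker \<theta>"
    using ker_Ups[OF \<theta>] by (auto simp: upsets_iff)
  have *: "ker \<theta> \<subseteq> imp P Q \<longleftrightarrow> P \<inter> ker \<theta> \<subseteq> Q" if "P \<in> Ups" for P Q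
  proof
    assume "ker \<theta> \<subseteq> imp P Q"
    thus "P \<inter> ker \<theta> \<subseteq> Q" unfolding imp_def using K(1) above_self by blast
  next
    assume "P \<inter> ker \<theta> \<subseteq> Q"
    thus "ker \<theta> \<subseteq> imp P Q" unfolding imp_iff subset_iff using K by blast
  qed
  have "g U \<theta> = g V \<theta> \<longleftrightarrow> U \<inter> ker \<theta> \<subseteq> V \<and> V \<inter> ker \<theta> \<subseteq> U"
    unfolding g_eq_iff_top[OF \<theta> UV] ker_top[OF \<theta> imp_Ups] using * UV by simp
  thus ?thesis by blast
qed

text \<open>Distinct points of \<open>ker \<theta>\<close> have principal upsets with distinct
  traces on it, hence with distinct classes in the finite quotient.\<close>

lemma ker_finite:
  assumes \<theta>: "\<theta> \<in> Cong"
  shows "finite (ker \<theta>)"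
proof -
  have KY: "ker \<theta> \<subseteq> Y" using ker_Ups[OF \<theta>] upsets_subset by blast
  have "inj_on (\<lambda>y. g (above s y) \<theta>) (ker \<theta>)"
  proof (rule inj_onI)
    fix x y assume xy: "x \<in> ker \<theta>" "y \<in> ker \<theta>" "g (above s x) \<theta> = g (above s y) \<theta>"
    have "above s x \<inter> ker \<theta> = above s y \<inter> ker \<theta>"
      using xy KY above_upset ker_eq_iff[OF \<theta>] by blast
    moreover have "x \<in> above s x" "y \<in> above s y" using xy KY above_self by blast+
    ultimately have "(x, y) \<in> s" "(y, x) \<in> s" using xy by (auto simp: above_def)
    thus "x = y" by (rule antisym)
  qed
  moreover have "(\<lambda>y. g (above s y) \<theta>) ` ker \<theta> \<subseteq> carrier A // \<theta>"
  proof (rule image_subsetI)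
    fix y assume "y \<in> ker \<theta>"
    hence "above s y \<in> Ups" using KY above_upset by blast
    thus "g (above s y) \<theta> \<in> carrier A // \<theta>" using g_in[of "above s y"] \<theta> by (auto simp: in_completion_iff)
  qed
  ultimately show ?thesis using Cong_finite[OF \<theta>] by (rule inj_on_finite)
qed

lemma not_below_Ups: "{z \<in> Y. (z, y) \<notin> s} \<in> Ups"
  unfolding upsets_iff using trans closed by blast

text \<open>If no kernel contained \<open>y\<close>, then the largest upset omitting
  \<open>y\<close> would contain every kernel, so agree with \<open>Y\<close> at every coordinate,
  so equal \<open>Y\<close>.\<close>

lemma ker_cover:
  assumes y: "y \<in> Y"
  obtains \<theta> where "\<theta> \<in> Cong" "y \<in> ker \<theta>"
proof (rule ccontr)
  assume n: "\<not> thesis"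
  have "{z \<in> Y. (z, y) \<notin> s} = Y"
  proof (rule g_eqI[OF not_below_Ups Y_Ups])
    fix \<theta> assume \<theta>: "\<theta> \<in> Cong"
    hence yn: "y \<notin> ker \<theta>" using n that by blast
    have "(z, y) \<notin> s" if "z \<in> ker \<theta>" for z
      using yn ker_Ups[OF \<theta>] that by (auto simp: upsets_iff)
    hence "ker \<theta> \<subseteq> {z \<in> Y. (z, y) \<notin> s}" using ker_Ups[OF \<theta>] by (auto simp: upsets_iff)
    thus "g {z \<in> Y. (z, y) \<notin> s} \<theta> = g Y \<theta>" using ker_top[OF \<theta> not_below_Ups] by blast
  qed
  thus False using y refl by blast
qed

lemma ker_mono:
  assumes "\<theta> \<in> Cong" "\<theta>' \<in> Cong" "\<theta>' \<subseteq> \<theta>"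
  shows "ker \<theta> \<subseteq> ker \<theta>'"
proof -
  have "g (ker \<theta>') \<theta>' = g Y \<theta>'" using ker_top[OF assms(2) ker_Ups[OF assms(2)]] by simp
  hence "g (ker \<theta>') \<theta> = g Y \<theta>"
    using g_trans[OF ker_Ups[OF assms(2)] assms] g_trans[OF Y_Ups assms] by metis
  thus ?thesis using ker_top[OF assms(1) ker_Ups[OF assms(2)]] by simp
qed

lemma ker_cover2:
  assumes "y \<in> Y" "z \<in> Y"
  obtains \<theta> where "\<theta> \<in> Cong" "y \<in> ker \<theta>" "z \<in> ker \<theta>"
proof -
  obtain \<theta>1 \<theta>2 where *: "\<theta>1 \<in> Cong" "y \<in> ker \<theta>1" "\<theta>2 \<in> Cong" "z \<in> ker \<theta>2"
    using ker_cover assms by metis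
  have i: "\<theta>1 \<inter> \<theta>2 \<in> Cong" using * by (intro finite_index_Int)
  show ?thesis
    using that[OF i] ker_mono[OF *(1) i] ker_mono[OF *(3) i] * by blast
qed

text \<open>The image of the canonical map from \<open>A\<close>, seen in \<open>Up Y\<close>.\<close>

definition clop :: "'b \<Rightarrow> 'y set" where
  "clop a = (SOME U. U \<in> Ups \<and> g U = (\<lambda>\<theta>\<in>Cong. \<theta> `` {a}))"

abbreviation "Clop \<equiv> clop ` carrier A"

lemma clop:
  assumes a: "a \<in> carrier A"
  shows clop_Ups: "clop a \<in> Ups" and g_clop: "\<theta> \<in> Cong \<Longrightarrow> g (clop a) \<theta> = \<theta> `` {a}"
proof -
  have "\<theta> `` (\<theta>' `` {a}) = \<theta> `` {a}" if "\<theta> \<in> Cong" "\<theta>' \<in> Cong" "\<theta>' \<subseteq> \<theta>" for \<theta> \<theta>'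
    using Cong_equiv[OF that(1)] Cong_equiv[OF that(2)] that(3) a
    unfolding equiv_def refl_on_def trans_def by blast
  hence "(\<lambda>\<theta>\<in>Cong. \<theta> `` {a}) \<in> carrier (profinite_completion A)"
    unfolding in_completion_iff using a by (auto simp: quotientI)
  hence "\<exists>U. U \<in> Ups \<and> g U = (\<lambda>\<theta>\<in>Cong. \<theta> `` {a})" using g_surj by metis
  from someI_ex[OF this] have "clop a \<in> Ups \<and> g (clop a) = (\<lambda>\<theta>\<in>Cong. \<theta> `` {a})"
    unfolding clop_def .
  thus "clop a \<in> Ups" "\<theta> \<in> Cong \<Longrightarrow> g (clop a) \<theta> = \<theta> `` {a}" by simp_all
qed

lemma clop_ops:
  assumes "a \<in> carrier A" "b \<in> carrier A"
  shows "clop (meet A a b) = clop a \<inter> clop b" "clop (join A a b) = clop a \<union> clop b"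
    "clop (himp A a b) = imp (clop a) (clop b)"
  by (rule g_eqI; simp add: assms A.meet_closed A.join_closed A.himp_closed clop_Ups upsets_Int
      upsets_Un imp_Ups g_clop g_ops quotient_ops[OF Cong_congruence])+

lemma clop_consts: "clop (hbot A) = {}" "clop (htop A) = Y"
  by (rule g_eqI; simp add: clop_Ups upsets_empty Y_Ups g_clop g_bot g_top A.hbot_closed A.htop_closed)+

lemma Clop_closed:
  assumes "U \<in> Clop" "V \<in> Clop"
  shows "U \<inter> V \<in> Clop" "U \<union> V \<in> Clop" "imp U V \<in> Clop"
proof -
  obtain a b where ab: "a \<in> carrier A" "b \<in> carrier A" "U = clop a" "V = clop b" using assms by blast
  show "U \<inter> V \<in> Clop" "U \<union> V \<in> Clop" "imp U V \<in> Clop"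
    unfolding ab(3,4) clop_ops[OF ab(1,2), symmetric]
    using A.meet_closed[OF ab(1,2)] A.join_closed[OF ab(1,2)] A.himp_closed[OF ab(1,2)] by blast+
qed

lemma Clop_consts: "{} \<in> Clop" "Y \<in> Clop"
  using imageI[OF A.hbot_closed, of clop] imageI[OF A.htop_closed, of clop] by (simp_all add: clop_consts)

lemma Clop_Ups: "U \<in> Clop \<Longrightarrow> U \<in> Ups"
  using clop_Ups by blast

text \<open>Every class of \<open>\<theta>\<close> has a representative in \<open>A\<close>, and
  classes of \<open>\<theta>\<close> are traces on \<open>ker \<theta>\<close>.\<close>

lemma Clop_approx:
  assumes \<theta>: "\<theta> \<in> Cong" and U: "U \<in> Ups"
  shows "\<exists>V. V \<in> Clop \<and> V \<inter> ker \<theta> = U \<inter> ker \<theta>"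
proof -
  obtain a where a: "a \<in> carrier A" "g U \<theta> = \<theta> `` {a}" using g_class[OF U \<theta>] .
  have "g (clop a) \<theta> = g U \<theta>" using a g_clop \<theta> by simp
  hence "clop a \<inter> ker \<theta> = U \<inter> ker \<theta>" using ker_eq_iff[OF \<theta> clop_Ups[OF a(1)] U] by simp
  thus ?thesis using a by blast
qed

lemma Clop_separates_le:
  assumes yz: "y \<in> Y" "z \<in> Y" and le: "\<And>U. U \<in> Clop \<Longrightarrow> y \<in> U \<Longrightarrow> z \<in> U"
  shows "(y, z) \<in> s"
proof -
  obtain \<theta> where \<theta>: "\<theta> \<in> Cong" "y \<in> ker \<theta>" "z \<in> ker \<theta>" using ker_cover2[OF yz] .
  obtain V where V: "V \<in> Clop" "V \<inter> ker \<theta> = above s y \<inter> ker \<theta>"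
    using Clop_approx[OF \<theta>(1) above_upset[OF yz(1)]] by blast
  have "y \<in> V" using V(2) \<theta> above_self[OF yz(1)] by blast
  hence "z \<in> above s y" using le V \<theta> by blast
  thus ?thesis by (simp add: above_def)
qed

lemma Clop_separates:
  assumes "y \<in> Y" "z \<in> Y" "\<And>U. U \<in> Clop \<Longrightarrow> y \<in> U \<longleftrightarrow> z \<in> U"
  shows "y = z"
  using assms by (intro antisym Clop_separates_le) auto

text \<open>This is where being the full completion matters: all finite-index congruences of
  \<open>A\<close> are coordinates, also one that is imposed from outside through \<open>K\<close>,
  and so each is given by a finite upset of \<open>Y\<close>.\<close>

lemma finite_kernel_principal:
  assumes fin: "finite (K ` Ups)"
    and cong: "\<And>U U' V V'. \<lbrakk>U \<in> Ups; U' \<in> Ups; V \<in> Ups; V' \<in> Ups; K U = K U'; K V = K V'\<rbrakk>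
      \<Longrightarrow> K (U \<inter> V) = K (U' \<inter> V') \<and> K (U \<union> V) = K (U' \<union> V') \<and> K (imp U V) = K (imp U' V')"
  shows "\<exists>\<theta>\<in>Cong. \<forall>U\<in>Clop. \<forall>V\<in>Clop. K U = K V \<longleftrightarrow> U \<inter> ker \<theta> = V \<inter> ker \<theta>"
proof -
  define \<theta> where "\<theta> = {(a, b). a \<in> carrier A \<and> b \<in> carrier A \<and> K (clop a) = K (clop b)}"
  have eq: "equiv (carrier A) \<theta>"
    unfolding equiv_def refl_on_def sym_def trans_def by (auto simp: \<theta>_def)
  have "(meet A x y, meet A x' y') \<in> \<theta> \<and> (join A x y, join A x' y') \<in> \<theta> \<and> (himp A x y, himp A x' y') \<in> \<theta>"
    if "(x, x') \<in> \<theta>" "(y, y') \<in> \<theta>" for x x' y y'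
  proof -
    have *: "x \<in> carrier A" "x' \<in> carrier A" "y \<in> carrier A" "y' \<in> carrier A"
      "K (clop x) = K (clop x')" "K (clop y) = K (clop y')"
      using that by (auto simp: \<theta>_def)
    show ?thesis
      using cong[OF clop_Ups[OF *(1)] clop_Ups[OF *(2)] clop_Ups[OF *(3)] clop_Ups[OF *(4)] *(5,6)] *(1-4)
      by (simp add: \<theta>_def A.meet_closed A.join_closed A.himp_closed clop_ops)
  qed
  hence "heyting_congruence A \<theta>" by (rule congruenceI[OF eq])
  moreover have "carrier A // \<theta> \<subseteq> (\<lambda>k. {b \<in> carrier A. K (clop b) = k}) ` (K ` Ups)"
  proof
    fix C assume "C \<in> carrier A // \<theta>"
    then obtain a where a: "a \<in> carrier A" "C = \<theta> `` {a}" by (auto simp: quotient_def)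
    hence "C = {b \<in> carrier A. K (clop b) = K (clop a)}" by (auto simp: \<theta>_def)
    thus "C \<in> (\<lambda>k. {b \<in> carrier A. K (clop b) = k}) ` (K ` Ups)" using clop_Ups[OF a(1)] by blast
  qed
  hence "finite (carrier A // \<theta>)" by (rule finite_subset) (use fin in simp)
  ultimately have \<theta>: "\<theta> \<in> Cong" by (simp add: finite_index_congruences_def)
  have "K U = K V \<longleftrightarrow> U \<inter> ker \<theta> = V \<inter> ker \<theta>" if UV: "U \<in> Clop" "V \<in> Clop" for U V
  proof -
    obtain a b where ab: "a \<in> carrier A" "b \<in> carrier A" "U = clop a" "V = clop b" using UV by blast
    have "K U = K V \<longleftrightarrow> (a, b) \<in> \<theta>" using ab by (simp add: \<theta>_def)
    also have "\<dots> \<longleftrightarrow> g U \<theta> = g V \<theta>"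
      using eq_equiv_class_iff[OF eq ab(1,2)] ab \<theta> by (simp add: g_clop)
    finally show ?thesis using ker_eq_iff[OF \<theta>] UV Clop_Ups by blast
  qed
  thus ?thesis using \<theta> by blast
qed

end

section \<open>Limits of sequences of points along an ultrafilter\<close>

locale completion_limit = completion_iso +
  fixes F :: "'i filter"
  assumes ultra: "eventually P F \<or> eventually (\<lambda>n. \<not> P n) F"
    and proper: "F \<noteq> bot"
begin

lemma eventually_not: "eventually (\<lambda>n. \<not> P n) F \<longleftrightarrow> \<not> eventually P F"
proof
  assume "eventually (\<lambda>n. \<not> P n) F"
  thus "\<not> eventually P F" using eventually_conj[of P F "\<lambda>n. \<not> P n"] proper by (auto simp: trivial_limit_def)
qed (use ultra in blast)

lemma eventually_disj: "eventually (\<lambda>n. P n \<or> Q n) F \<longleftrightarrow> eventually P F \<or> eventually Q F"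
proof
  assume *: "eventually (\<lambda>n. P n \<or> Q n) F"
  show "eventually P F \<or> eventually Q F"
  proof (rule ccontr)
    assume "\<not> ?thesis"
    hence "eventually (\<lambda>n. \<not> P n) F" "eventually (\<lambda>n. \<not> Q n) F" using ultra by blast+
    with * have "eventually (\<lambda>n. False) F" by eventually_elim simp
    thus False using proper by (simp add: trivial_limit_def)
  qed
qed (auto elim: eventually_mono)

lemma eventually_Bex:
  assumes "finite W"
  shows "eventually (\<lambda>n. \<exists>y\<in>W. P y n) F \<longleftrightarrow> (\<exists>y\<in>W. eventually (P y) F)"
  using assms proper by (induction W rule: finite_induct) (auto simp: eventually_disj trivial_limit_def)

text \<open>Convergence along \<open>F\<close> in the topology generated by the members of
  \<open>Clop\<close> and their complements.\<close>

definition lim :: "('i \<Rightarrow> 'a) \<Rightarrow> 'a \<Rightarrow> bool" where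
  "lim e y \<longleftrightarrow> y \<in> Y \<and> (\<forall>U\<in>Clop. y \<in> U \<longleftrightarrow> eventually (\<lambda>n. e n \<in> U) F)"

lemma lim_unique: "lim e y \<Longrightarrow> lim e z \<Longrightarrow> y = z"
  by (rule Clop_separates) (auto simp: lim_def)

lemma lim_const: "y \<in> Y \<Longrightarrow> lim (\<lambda>_. y) y"
  using proper by (auto simp: lim_def eventually_const)

lemma lim_cong:
  assumes "lim e y" "eventually (\<lambda>n. e n = e' n) F"
  shows "lim e' y"
proof -
  have "eventually (\<lambda>n. e n \<in> U) F \<longleftrightarrow> eventually (\<lambda>n. e' n \<in> U) F" for U
    by (rule eventually_cong[OF assms(2)]) simp
  thus ?thesis using assms(1) by (simp add: lim_def)
qed

text \<open>The congruence \<open>e n \<in> U \<longleftrightarrow> e n \<in> V\<close> for almost all \<open>n\<close> and all \<open>e \<in> E\<close> has finite index,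
  so the completion supplies limit points for the sequences in \<open>E\<close>.\<close>

lemma limits_exist:
  assumes E: "finite E" "e0 \<in> E" and e0: "\<And>n. e0 n \<in> Y"
    and ab: "\<And>n. above s (e0 n) = (\<lambda>e. e n) ` E"
  obtains f where "\<forall>e\<in>E. lim e (f e)" "above s (f e0) = f ` E"
proof -
  have abn: "(e0 n, y) \<in> s \<longleftrightarrow> (\<exists>e\<in>E. y = e n)" for n y using ab[of n] by (auto simp: above_def)
  have eY: "e n \<in> Y" if "e \<in> E" for e n using abn closed[OF e0] that by blast
  define K where "K U = {e \<in> E. eventually (\<lambda>n. e n \<in> U) F}" for U
  have KInt: "K (U \<inter> V) = K U \<inter> K V" and KUn: "K (U \<union> V) = K U \<union> K V" for U V
    by (auto simp: K_def eventually_conj_iff eventually_disj)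
  \<comment> \<open>Membership of \<open>e n\<close> in \<open>imp U V\<close> depends only on the
    traces of \<open>U\<close> and \<open>V\<close> on \<open>above s (e0 n)\<close>, which consists
    of the values at \<open>n\<close> of the sequences in \<open>E\<close>. Finiteness of
    \<open>E\<close> makes the agreements hold simultaneously.\<close>
  have Kimp: "K (imp U V) = K (imp U' V')" if UV: "K U = K U'" "K V = K V'" for U V U' V'
  proof -
    have same: "eventually (\<lambda>n. e n \<in> P \<longleftrightarrow> e n \<in> Q) F" if "K P = K Q" "e \<in> E" for P Q e
    proof -
      have "eventually (\<lambda>n. e n \<in> P) F \<longleftrightarrow> eventually (\<lambda>n. e n \<in> Q) F"
        using that unfolding K_def by blast
      hence "eventually (\<lambda>n. e n \<in> P \<and> e n \<in> Q) F \<or> eventually (\<lambda>n. e n \<notin> P \<and> e n \<notin> Q) F"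
        using eventually_not[of "\<lambda>n. e n \<in> P"] eventually_not[of "\<lambda>n. e n \<in> Q"]
        by (auto simp: eventually_conj_iff)
      thus ?thesis by (auto elim: eventually_mono)
    qed
    have "eventually (\<lambda>n. \<forall>e\<in>E. (e n \<in> U \<longleftrightarrow> e n \<in> U') \<and> (e n \<in> V \<longleftrightarrow> e n \<in> V')) F"
      using same UV E(1) by (intro eventually_ball_finite ballI eventually_conj) auto
    hence "eventually (\<lambda>n. \<forall>e\<in>E. e n \<in> imp U V \<longleftrightarrow> e n \<in> imp U' V') F"
    proof (rule eventually_mono)
      fix n assume *: "\<forall>e\<in>E. (e n \<in> U \<longleftrightarrow> e n \<in> U') \<and> (e n \<in> V \<longleftrightarrow> e n \<in> V')"
      have "y \<in> U \<longleftrightarrow> y \<in> U'" "y \<in> V \<longleftrightarrow> y \<in> V'" if "e \<in> E" "(e n, y) \<in> s" for e y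
      proof -
        have "(e0 n, y) \<in> s" using trans abn that by blast
        then obtain e' where "e' \<in> E" "y = e' n" using abn by blast
        thus "y \<in> U \<longleftrightarrow> y \<in> U'" "y \<in> V \<longleftrightarrow> y \<in> V'" using * by simp_all
      qed
      thus "\<forall>e\<in>E. e n \<in> imp U V \<longleftrightarrow> e n \<in> imp U' V'" unfolding imp_iff by blast
    qed
    hence "eventually (\<lambda>n. e n \<in> imp U V \<longleftrightarrow> e n \<in> imp U' V') F" if "e \<in> E" for e
      by (rule eventually_mono) (use that in blast)
    hence "eventually (\<lambda>n. e n \<in> imp U V) F \<longleftrightarrow> eventually (\<lambda>n. e n \<in> imp U' V') F" if "e \<in> E" for e
      by (rule eventually_cong) (use that in auto)
    thus ?thesis unfolding K_def by blast
  qed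
  have "K ` Ups \<subseteq> Pow E" by (auto simp: K_def)
  hence fin: "finite (K ` Ups)" using E(1) by (meson finite_Pow_iff finite_subset)
  have cong: "K (U \<inter> V) = K (U' \<inter> V') \<and> K (U \<union> V) = K (U' \<union> V') \<and> K (imp U V) = K (imp U' V')"
    if "U \<in> Ups" "U' \<in> Ups" "V \<in> Ups" "V' \<in> Ups" "K U = K U'" "K V = K V'" for U U' V V'
    using that(5,6) Kimp[OF that(5,6)] by (simp add: KInt KUn)
  have "\<exists>\<theta>\<in>Cong. \<forall>U\<in>Clop. \<forall>V\<in>Clop. K U = K V \<longleftrightarrow> U \<inter> ker \<theta> = V \<inter> ker \<theta>"
    using fin cong by (rule finite_kernel_principal)
  then obtain \<theta> where \<theta>: "\<theta> \<in> Cong"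
    and "\<forall>U\<in>Clop. \<forall>V\<in>Clop. K U = K V \<longleftrightarrow> U \<inter> ker \<theta> = V \<inter> ker \<theta>" ..
  hence K: "K U = K V \<longleftrightarrow> U \<inter> ker \<theta> = V \<inter> ker \<theta>" if "U \<in> Clop" "V \<in> Clop" for U V
    using that by blast
  define W where "W = ker \<theta>"
  have W: "finite W" "W \<subseteq> Y" "\<And>x y. x \<in> W \<Longrightarrow> (x, y) \<in> s \<Longrightarrow> y \<in> W"
    using ker_finite[OF \<theta>] ker_Ups[OF \<theta>] by (auto simp: W_def upsets_iff)
  \<comment> \<open>Inside \<open>W\<close>, the set \<open>P y\<close> cuts out the points above
    \<open>y\<close> and \<open>Q y\<close> the points not below \<open>y\<close>; by antisymmetry
    \<open>P y - Q y\<close> meets \<open>W\<close> in \<open>y\<close> alone.\<close>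
  define P where "P y = (SOME U. U \<in> Clop \<and> U \<inter> W = above s y \<inter> W)" for y
  define Q where "Q y = (SOME U. U \<in> Clop \<and> U \<inter> W = {z \<in> Y. (z, y) \<notin> s} \<inter> W)" for y
  have P: "P y \<in> Clop" "P y \<inter> W = above s y \<inter> W" if "y \<in> W" for y
  proof -
    have "above s y \<in> Ups" using that W(2) above_upset by blast
    from someI_ex[OF Clop_approx[OF \<theta> this]] show "P y \<in> Clop" "P y \<inter> W = above s y \<inter> W"
      unfolding P_def W_def by (rule conjunct1, rule conjunct2)
  qed
  have Q: "Q y \<in> Clop" "Q y \<inter> W = {z \<in> Y. (z, y) \<notin> s} \<inter> W" for y
  proof -
    from someI_ex[OF Clop_approx[OF \<theta> not_below_Ups[of y]]]
    show "Q y \<in> Clop" "Q y \<inter> W = {z \<in> Y. (z, y) \<notin> s} \<inter> W"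
      unfolding Q_def W_def by (rule conjunct1, rule conjunct2)
  qed
  have PW: "z \<in> P y \<longleftrightarrow> (y, z) \<in> s" if "y \<in> W" "z \<in> W" for y z
    using P(2)[OF that(1)] that(2) unfolding above_def by blast
  have QW: "z \<in> Q y \<longleftrightarrow> (z, y) \<notin> s" if "z \<in> W" for y z
    using Q(2)[of y] that W(2) by blast
  have UP: "\<Union>(P ` T) \<in> Clop" if "T \<subseteq> W" for T
  proof -
    have "finite T" using that W(1) finite_subset by blast
    thus ?thesis using that
      by (induction T rule: finite_induct) (simp_all add: Clop_consts Clop_closed P(1))
  qed
  \<comment> \<open>If \<open>T\<close> generates the trace of \<open>U\<close> on \<open>W\<close>,
    then \<open>K\<close> identifies \<open>U\<close> with the union of the sets \<open>P z\<close>
    for \<open>z \<in> T\<close>, and an ultrafilter that accepts a finite union accepts one of its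
    terms.\<close>
  have pick: "\<exists>z\<in>T. eventually (\<lambda>n. e n \<in> P z) F"
    if TU: "T \<subseteq> W" "U \<in> Clop" "U \<inter> W \<subseteq> T" "\<And>z. z \<in> T \<Longrightarrow> above s z \<inter> W \<subseteq> U" "e \<in> E"
      "eventually (\<lambda>n. e n \<in> U) F" for T U e
  proof -
    have fT: "finite T" using that(1) W(1) finite_subset by blast
    have "\<Union>(P ` T) \<inter> W = U \<inter> W"
    proof
      have "P z \<inter> W \<subseteq> U" if "z \<in> T" for z using P(2)[of z] TU(1) TU(4)[OF that] that by auto
      thus "\<Union>(P ` T) \<inter> W \<subseteq> U \<inter> W" by blast
      have "z \<in> P z" if "z \<in> T" for z using PW[of z z] refl[of z] TU(1) W(2) that by auto
      thus "U \<inter> W \<subseteq> \<Union>(P ` T) \<inter> W" using TU(3) by blast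
    qed
    hence "K (\<Union>(P ` T)) = K U" using K[OF UP[OF that(1)] that(2)] by (simp add: W_def)
    hence "eventually (\<lambda>n. \<exists>z\<in>T. e n \<in> P z) F" using that(5,6) unfolding K_def by auto
    thus ?thesis by (simp add: eventually_Bex[OF fT])
  qed
  have "\<exists>y\<in>W. eventually (\<lambda>n. e n \<in> P y) F \<and> \<not> eventually (\<lambda>n. e n \<in> Q y) F" if e: "e \<in> E" for e
  proof -
    have "\<exists>y. y \<in> W \<and> eventually (\<lambda>n. e n \<in> P y) F"
      using pick[of W Y e] Clop_consts W(2) closed e eY[OF e] by (auto simp: above_def)
    \<comment> \<open>Among the candidates, \<open>y\<close> has the fewest points of
      \<open>W\<close> above it. If \<open>e n\<close> were also eventually in \<open>Q y\<close>,
      then \<open>pick\<close>, applied to the points strictly above \<open>y\<close>, would give a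
      candidate with fewer.\<close>
    then obtain y where y: "y \<in> W" "eventually (\<lambda>n. e n \<in> P y) F"
      and least: "\<And>z. z \<in> W \<Longrightarrow> eventually (\<lambda>n. e n \<in> P z) F \<Longrightarrow> card (above s y \<inter> W) \<le> card (above s z \<inter> W)"
      using ex_has_least_nat[of "\<lambda>y. y \<in> W \<and> eventually (\<lambda>n. e n \<in> P y) F" _ "\<lambda>y. card (above s y \<inter> W)"]
      by blast
    have "\<not> eventually (\<lambda>n. e n \<in> Q y) F"
    proof
      assume "eventually (\<lambda>n. e n \<in> Q y) F"
      hence ev: "eventually (\<lambda>n. e n \<in> P y \<inter> Q y) F" using y(2) by (simp add: eventually_conj_iff)
      let ?T = "{z \<in> W. (y, z) \<in> s \<and> z \<noteq> y}"
      have "\<exists>z\<in>?T. eventually (\<lambda>n. e n \<in> P z) F"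
      proof (rule pick[OF _ Clop_closed(1)[OF P(1)[OF y(1)] Q(1)[of y]] _ _ e ev])
        have "(y, y) \<in> s" using refl[of y] y(1) W(2) by blast
        thus "P y \<inter> Q y \<inter> W \<subseteq> ?T" using PW[OF y(1)] QW by auto
        fix z assume z: "z \<in> ?T"
        show "above s z \<inter> W \<subseteq> P y \<inter> Q y"
        proof
          fix w assume w: "w \<in> above s z \<inter> W"
          hence zw: "(z, w) \<in> s" by (simp add: above_def)
          have "(y, w) \<in> s" using trans[OF _ zw, of y] z by simp
          moreover have "(w, y) \<notin> s" using trans[OF zw, of y] antisym[of y z] z by auto
          ultimately show "w \<in> P y \<inter> Q y" using w PW[OF y(1), of w] QW[of w y] by simp
        qed
      qed auto
      then obtain z where z: "z \<in> W" "(y, z) \<in> s" "z \<noteq> y" "eventually (\<lambda>n. e n \<in> P z) F" by blast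
      have "above s z \<inter> W \<subset> above s y \<inter> W"
      proof
        show "above s z \<inter> W \<subseteq> above s y \<inter> W" using trans[OF z(2)] unfolding above_def by blast
        have "y \<in> above s y \<inter> W" using y(1) W(2) above_self by blast
        moreover have "y \<notin> above s z" using z(3) antisym[OF z(2)] by (auto simp: above_def)
        ultimately show "above s z \<inter> W \<noteq> above s y \<inter> W" by blast
      qed
      hence "card (above s z \<inter> W) < card (above s y \<inter> W)" using W(1) by (intro psubset_card_mono) auto
      thus False using least[OF z(1,4)] by simp
    qed
    thus ?thesis using y by blast
  qed
  then obtain f where "\<forall>e\<in>E. f e \<in> W \<and> eventually (\<lambda>n. e n \<in> P (f e)) F
      \<and> \<not> eventually (\<lambda>n. e n \<in> Q (f e)) F"
    using bchoice[of E "\<lambda>e y. y \<in> W \<and> eventually (\<lambda>n. e n \<in> P y) F \<and> \<not> eventually (\<lambda>n. e n \<in> Q y) F"]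
    by blast
  hence fW: "f e \<in> W" and fP: "eventually (\<lambda>n. e n \<in> P (f e)) F"
    and fQ: "\<not> eventually (\<lambda>n. e n \<in> Q (f e)) F" if "e \<in> E" for e
    using that by blast+
  have mem: "f e \<in> U \<longleftrightarrow> eventually (\<lambda>n. e n \<in> U) F" if e: "e \<in> E" and U: "U \<in> Clop" for e U
  proof
    have Uup: "\<And>x y. x \<in> U \<Longrightarrow> (x, y) \<in> s \<Longrightarrow> y \<in> U" using Clop_Ups[OF U] by (simp add: upsets_iff)
    {
      assume "f e \<in> U"
      hence "U \<inter> P (f e) \<inter> W = P (f e) \<inter> W" using Uup PW[OF fW[OF e]] by blast
      hence "K (U \<inter> P (f e)) = K (P (f e))"
        using K[OF Clop_closed(1)[OF U P(1)[OF fW[OF e]]] P(1)[OF fW[OF e]]] by (simp add: W_def)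
      hence "e \<in> K U" using fP[OF e] e unfolding KInt by (auto simp: K_def)
      thus "eventually (\<lambda>n. e n \<in> U) F" by (simp add: K_def)
    next
      assume ev: "eventually (\<lambda>n. e n \<in> U) F"
      show "f e \<in> U"
      proof (rule ccontr)
        assume "f e \<notin> U"
        hence "U \<inter> Q (f e) \<inter> W = U \<inter> W" using Uup QW by blast
        hence "K (U \<inter> Q (f e)) = K U" using K[OF Clop_closed(1)[OF U Q(1)] U] by (simp add: W_def)
        hence "e \<in> K (Q (f e))" using ev e unfolding KInt by (auto simp: K_def)
        thus False using fQ[OF e] by (simp add: K_def)
      qed
    }
  qed
  hence lim: "lim e (f e)" if "e \<in> E" for e using that fW W(2) unfolding lim_def by blast
  have "above s (f e0) = f ` E"
  proof
    show "f ` E \<subseteq> above s (f e0)"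
    proof (rule image_subsetI)
      fix e assume e: "e \<in> E"
      have "(f e0, f e) \<in> s"
      proof (rule Clop_separates_le)
        show "f e0 \<in> Y" "f e \<in> Y" using fW E(2) e W(2) by blast+
        fix U assume U: "U \<in> Clop" "f e0 \<in> U"
        hence "eventually (\<lambda>n. e0 n \<in> U) F" using mem E(2) by blast
        hence "eventually (\<lambda>n. e n \<in> U) F"
        proof (rule eventually_mono)
          fix n assume "e0 n \<in> U"
          moreover have "(e0 n, e n) \<in> s" using abn e by blast
          ultimately show "e n \<in> U" using Clop_Ups[OF U(1)] by (simp add: upsets_iff)
        qed
        thus "f e \<in> U" using mem e U by blast
      qed
      thus "f e \<in> above s (f e0)" by (simp add: above_def)
    qed
    \<comment> \<open>A point \<open>z\<close> above \<open>f e0\<close> refutes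
      \<open>imp (P z) (Q z)\<close> there, so almost every \<open>e0 n\<close> has a point of
      \<open>P z - Q z\<close> above it. As \<open>E\<close> is finite, a single \<open>e\<close>
      provides it for almost all \<open>n\<close>, and then \<open>f e\<close> lies in
      \<open>P z - Q z\<close>, so it is \<open>z\<close>.\<close>
    show "above s (f e0) \<subseteq> f ` E"
    proof
      fix z assume "z \<in> above s (f e0)"
      hence z: "(f e0, z) \<in> s" by (simp add: above_def)
      have zW: "z \<in> W" using z fW[OF E(2)] W(3) by blast
      have "z \<in> P z" "z \<notin> Q z" using PW[OF zW zW] QW[OF zW] refl zW W(2) by blast+
      hence "f e0 \<notin> imp (P z) (Q z)" using z by (auto simp: imp_iff)
      hence "\<not> eventually (\<lambda>n. e0 n \<in> imp (P z) (Q z)) F"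
        using mem[OF E(2) Clop_closed(3)[OF P(1)[OF zW] Q(1)]] by blast
      hence "eventually (\<lambda>n. e0 n \<notin> imp (P z) (Q z)) F" by (simp add: eventually_not)
      hence "eventually (\<lambda>n. \<exists>e\<in>E. e n \<in> P z \<and> e n \<notin> Q z) F"
        by (rule eventually_mono) (use abn e0 in \<open>auto simp: imp_iff\<close>)
      then obtain e where e: "e \<in> E" "eventually (\<lambda>n. e n \<in> P z \<and> e n \<notin> Q z) F"
        using eventually_Bex[OF E(1), of "\<lambda>e n. e n \<in> P z \<and> e n \<notin> Q z"] by blast
      hence "f e \<in> P z" "f e \<notin> Q z"
        using mem[OF e(1) P(1)[OF zW]] mem[OF e(1) Q(1)] by (auto simp: eventually_conj_iff eventually_not)
      hence "(z, f e) \<in> s" "(f e, z) \<in> s" using PW zW QW fW[OF e(1)] by blast+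
      hence "z = f e" by (rule antisym)
      thus "z \<in> f ` E" using e(1) by blast
    qed
  qed
  thus thesis using that lim by blast
qed

end

text \<open>The powerset of \<open>nat\<close> is \<open>Up UNIV Id\<close> and its ultrafilters are
  the prime filters, so \<open>prime_filter_extend\<close> applies to the filter of cofinite sets
  and the empty set.\<close>

lemma nonprincipal_ultrafilter:
  obtains F :: "nat filter" where "\<forall>P. eventually P F \<or> eventually (\<lambda>n. \<not> P n) F" "F \<noteq> bot"
    "\<forall>m. eventually (\<lambda>n. n \<noteq> m) F"
proof -
  have fr: "frame (UNIV :: nat set) Id" by standard auto
  interpret A: heyting_algebra "Up (UNIV :: nat set) Id" by (rule frame.Up_heyting[OF fr])
  have ups: "upsets (UNIV :: nat set) Id = UNIV" by (auto simp: upsets_iff)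
  have "A.hfilter {U. finite (- U)}"
    unfolding A.hfilter_def heyting_le_Up by (auto simp: ups intro: finite_subset)
  then obtain P where P: "A.prime_filter P" "{U. finite (- U)} \<subseteq> P" "{} \<notin> P"
    using A.prime_filter_extend[of "{U. finite (- U)}" "{}"] by (auto simp: ups)
  have flt: "A.hfilter P" using P(1) by (simp add: A.prime_filter_def)
  have cup: "U \<in> P \<or> V \<in> P" if "U \<union> V = UNIV" for U V
    using P(1) A.hfilterD(2)[OF flt] that unfolding A.prime_filter_def by (simp add: ups)
  define F where "F = Abs_filter (\<lambda>Q. Collect Q \<in> P)"
  have ev: "eventually Q F \<longleftrightarrow> Collect Q \<in> P" for Q
    unfolding F_def
  proof (rule eventually_Abs_filter, unfold_locales)
    show "{x. True} \<in> P" using A.hfilterD(2)[OF flt] by simp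
  next
    fix Q R assume "Collect Q \<in> P" "Collect R \<in> P"
    hence "Collect Q \<inter> Collect R \<in> P" using A.hfilterD(3)[OF flt] by fastforce
    thus "{x. Q x \<and> R x} \<in> P" by (simp add: Collect_conj_eq)
  next
    fix Q R assume "\<forall>x. Q x \<longrightarrow> R x" "Collect Q \<in> P"
    thus "Collect R \<in> P" using A.hfilterD(4)[OF flt, of "Collect Q" "Collect R"]
      by (auto simp: ups heyting_le_Up)
  qed
  show thesis
  proof (rule that[of F])
    show "\<forall>Q. eventually Q F \<or> eventually (\<lambda>n. \<not> Q n) F"
      unfolding ev by (intro allI cup) auto
    show "F \<noteq> bot" using P(3) ev[of "\<lambda>_. False"] by (auto simp: trivial_limit_def)
    show "\<forall>m. eventually (\<lambda>n. n \<noteq> m) F"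
    proof
      fix m :: nat
      have "- {n. n \<noteq> m} = {m}" by auto
      hence "finite (- {n. n \<noteq> m})" by simp
      thus "eventually (\<lambda>n. n \<noteq> m) F" unfolding ev using P(2) by blast
    qed
  qed
qed

section \<open>Four algebras that are not profinite completions\<close>

lemma rel_of_above: "x \<in> Y \<Longrightarrow> above (rel_of Y up) x = up x"
  by (auto simp: above_def rel_of_def)

lemma completion_limitI:
  assumes po: "partial_order_on Y s" and A: "heyting_algebra A"
    and iso: "heyting_iso (Up Y s) (profinite_completion A)"
  obtains g and F :: "nat filter" where "completion_limit Y s A g F" "\<forall>m. eventually (\<lambda>n. n \<noteq> m) F"
proof -
  obtain g where g: "g \<in> heyting_hom (Up Y s) (profinite_completion A)"
    "bij_betw g (upsets Y s) (carrier (profinite_completion A))"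
    using iso by (auto simp: heyting_iso_def)
  obtain F :: "nat filter" where F: "\<forall>P. eventually P F \<or> eventually (\<lambda>n. \<not> P n) F" "F \<noteq> bot"
    "\<forall>m. eventually (\<lambda>n. n \<noteq> m) F" by (rule nonprincipal_ultrafilter)
  interpret frame Y s by (rule partial_order_frame[OF po])
  interpret heyting_algebra A by (rule A)
  have "completion_limit Y s A g F"
    by unfold_locales (use po g F in \<open>auto simp: partial_order_on_def antisym_def\<close>)
  thus ?thesis using that F(3) by blast
qed

text \<open>The limit of \<open>Mid\<close> is maximal, hence some \<open>Mid t\<close>. With
  \<open>s\<close> the partner of \<open>t\<close>, the limit of the roots
  \<open>Low (d n) s 0\<close> would lie below both \<open>Mid t\<close> and
  \<open>Mid s\<close>.\<close>

lemma forks_not_completion: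
  assumes A: "heyting_algebra A" and iso: "heyting_iso (Up forks fork_rel) (profinite_completion A)"
  shows False
proof -
  obtain g F where "completion_limit forks fork_rel A g (F :: nat filter)"
    and np: "\<forall>m. eventually (\<lambda>n. n \<noteq> m) F"
    by (rule completion_limitI[OF partial_order_forks A iso])
  then interpret completion_limit forks fork_rel A g F by simp
  have in_Y: "Mid n \<in> forks" for n by (simp add: forks_def)
  obtain f where f: "lim Mid (f Mid)" "above fork_rel (f Mid) = f ` {Mid}"
    by (rule limits_exist[of "{Mid}" Mid]) (simp_all add: in_Y rel_of_above fork_up_def)
  have "f Mid \<in> forks" using f(1) by (simp add: lim_def)
  then obtain t where t: "f Mid = Mid t"
    using f(2) by (auto simp: forks_def rel_of_above fork_up_def)
  \<comment> \<open>The partner of \<open>t\<close>.\<close>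
  define s where "s = (if even t then t + 1 else t - 1)"
  have s: "s \<noteq> t" "s div 2 = t div 2"
    by (auto simp: s_def elim!: evenE oddE)
  \<comment> \<open>Changes the identity only at \<open>s\<close> and \<open>t\<close>, where
    \<open>Low n s 0\<close> is missing; \<open>F\<close> is nonprincipal, so the limit of
    \<open>Mid\<close> is unaffected.\<close>
  define d where "d n = (if n div 2 = s div 2 then s + 2 else n)" for n
  have d: "d n div 2 \<noteq> s div 2" for n by (simp add: d_def)
  have "eventually (\<lambda>n. d n = n) F"
  proof -
    have "eventually (\<lambda>n. n \<noteq> s \<and> n \<noteq> t) F" by (intro eventually_conj np[rule_format])
    thus ?thesis by (rule eventually_mono) (use s in \<open>auto simp: d_def; presburger\<close>)
  qed
  hence "eventually (\<lambda>n. Mid n = Mid (d n)) F" by (rule eventually_mono) simp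
  hence lim1: "lim (\<lambda>n. Mid (d n)) (Mid t)"
    using lim_cong[of Mid "f Mid" "\<lambda>n. Mid (d n)"] f(1) unfolding t by simp
  let ?E = "{\<lambda>n. Low (d n) s 0, \<lambda>n. Mid (d n), \<lambda>n. Mid s}"
  have lowY: "Low (d n) s 0 \<in> forks" for n using d by (simp add: forks_def)
  obtain h where h: "\<forall>e\<in>?E. lim e (h e)"
    and ab: "above fork_rel (h (\<lambda>n. Low (d n) s 0)) = h ` ?E"
    by (rule limits_exist[of ?E "\<lambda>n. Low (d n) s 0"]) (simp_all add: lowY rel_of_above fork_up_def)
  have "h (\<lambda>n. Mid (d n)) = Mid t" by (rule lim_unique[OF h[rule_format] lim1]) simp
  moreover have "h (\<lambda>n. Mid s) = Mid s" by (rule lim_unique[OF h[rule_format] lim_const[OF in_Y]]) simp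
  moreover obtain x where x: "h (\<lambda>n. Low (d n) s 0) = x" by blast
  moreover have xY: "x \<in> forks" using h[rule_format, of "\<lambda>n. Low (d n) s 0"] x by (simp add: lim_def)
  ultimately have "fork_up x = {x, Mid t, Mid s}" using ab by (simp add: rel_of_above insert_commute)
  hence "Mid t \<in> fork_up x" "Mid s \<in> fork_up x" by simp_all
  thus False using xY s by (auto simp: forks_def fork_up_def)
qed

text \<open>As for the forks, with constant sequences for the three top points. The limit of
  \<open>Mid\<close> has \<open>Lt\<close> and \<open>Rt\<close> above it, so it is none of those
  three, and its upset has at most four points, so it is no root.\<close>

lemma doubles_not_completion:
  assumes A: "heyting_algebra A" and iso: "heyting_iso (Up doubles double_rel) (profinite_completion A)"
  shows False
proof -
  obtain g F where "completion_limit doubles double_rel A g (F :: nat filter)"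
    and np: "\<forall>m. eventually (\<lambda>n. n \<noteq> m) F"
    by (rule completion_limitI[OF partial_order_doubles A iso])
  then interpret completion_limit doubles double_rel A g F by simp
  have in_Y: "Mid n \<in> doubles" "Lt \<in> doubles" "Rt \<in> doubles" "Top \<in> doubles" for n
    by (simp_all add: doubles_def)
  let ?C = "{\<lambda>n :: nat. Lt, \<lambda>n. Rt, \<lambda>n. Top}"
  obtain f where f: "\<forall>e\<in>insert Mid ?C. lim e (f e)"
    and ab: "above double_rel (f Mid) = f ` insert Mid ?C"
    by (rule limits_exist[of "insert Mid ?C" Mid]) (simp_all add: in_Y rel_of_above double_up_def)
  have "f (\<lambda>n. Lt) = Lt" "f (\<lambda>n. Rt) = Rt" "f (\<lambda>n. Top) = Top"
    by (rule lim_unique[OF f[rule_format] lim_const]; simp add: in_Y)+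
  moreover have "f Mid \<in> doubles" using f[rule_format, of Mid] by (simp add: lim_def)
  ultimately obtain t where t: "f Mid = Mid t"
    using ab by (auto simp: doubles_def rel_of_above double_up_def)
  define s where "s = (if even t then t + 1 else t - 1)"
  have s: "s \<noteq> t" "s div 2 = t div 2"
    by (auto simp: s_def elim!: evenE oddE)
  define d where "d n = (if n div 2 = s div 2 then s + 2 else n)" for n
  have d: "d n div 2 \<noteq> s div 2" for n by (simp add: d_def)
  have "eventually (\<lambda>n. d n = n) F"
  proof -
    have "eventually (\<lambda>n. n \<noteq> s \<and> n \<noteq> t) F" by (intro eventually_conj np[rule_format])
    thus ?thesis by (rule eventually_mono) (use s in \<open>auto simp: d_def; presburger\<close>)
  qed
  hence "eventually (\<lambda>n. Mid n = Mid (d n)) F" by (rule eventually_mono) simp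
  hence lim1: "lim (\<lambda>n. Mid (d n)) (Mid t)"
    using lim_cong[of Mid "f Mid" "\<lambda>n. Mid (d n)"] f[rule_format, of Mid] unfolding t by simp
  let ?E = "{\<lambda>n. Low (d n) s 0, \<lambda>n. Mid (d n), \<lambda>n. Mid s} \<union> ?C"
  have lowY: "Low (d n) s 0 \<in> doubles" for n using d by (simp add: doubles_def)
  obtain h where h: "\<forall>e\<in>?E. lim e (h e)"
    and ab: "above double_rel (h (\<lambda>n. Low (d n) s 0)) = h ` ?E"
    by (rule limits_exist[of ?E "\<lambda>n. Low (d n) s 0"]) (simp_all add: lowY rel_of_above double_up_def insert_commute)
  have "h (\<lambda>n. Mid (d n)) = Mid t" by (rule lim_unique[OF h[rule_format] lim1]) simp
  moreover have "h (\<lambda>n. Mid s) = Mid s" "h (\<lambda>n. Lt) = Lt" "h (\<lambda>n. Rt) = Rt" "h (\<lambda>n. Top) = Top"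
    by (rule lim_unique[OF h[rule_format] lim_const]; simp add: in_Y)+
  moreover obtain x where x: "h (\<lambda>n. Low (d n) s 0) = x" by blast
  moreover have xY: "x \<in> doubles" using h[rule_format, of "\<lambda>n. Low (d n) s 0"] x by (simp add: lim_def)
  ultimately have "double_up x = {x, Mid t, Mid s, Lt, Rt, Top}" using ab by (simp add: rel_of_above insert_commute)
  hence "Mid t \<in> double_up x" "Mid s \<in> double_up x" by simp_all
  thus False using xY s by (auto simp: doubles_def double_up_def)
qed

text \<open>The limit of \<open>Mid\<close> is \<open>Top\<close>, with \<open>t\<close> arbitrary,
  or \<open>Mid t\<close>. In both cases the roots \<open>Low (d n) t u\<close> would converge to a
  point with \<open>Mid t\<close> and \<open>Mid u\<close> and no further \<open>Mid\<close> point
  above it, whereas a root has three.\<close>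

lemma fans_not_completion:
  assumes A: "heyting_algebra A" and iso: "heyting_iso (Up fans fan_rel) (profinite_completion A)"
  shows False
proof -
  obtain g F where "completion_limit fans fan_rel A g (F :: nat filter)"
    and np: "\<forall>m. eventually (\<lambda>n. n \<noteq> m) F"
    by (rule completion_limitI[OF partial_order_fans A iso])
  then interpret completion_limit fans fan_rel A g F by simp
  have in_Y: "Mid n \<in> fans" "Top \<in> fans" for n by (simp_all add: fans_def)
  let ?C = "{\<lambda>n :: nat. Top}"
  obtain f where f: "\<forall>e\<in>insert Mid ?C. lim e (f e)"
    and ab: "above fan_rel (f Mid) = f ` insert Mid ?C"
    by (rule limits_exist[of "insert Mid ?C" Mid]) (simp_all add: in_Y rel_of_above fan_up_def)
  have "f (\<lambda>n. Top) = Top" by (rule lim_unique[OF f[rule_format] lim_const]; simp add: in_Y)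
  moreover have "f Mid \<in> fans" using f[rule_format, of Mid] by (simp add: lim_def)
  ultimately obtain t where t: "f Mid = Top \<or> f Mid = Mid t"
    using ab by (auto simp: fans_def rel_of_above fan_up_def)
  define u where "u = t + 1"
  define d where "d n = (if n = t \<or> n = u then u + 1 else n)" for n
  have d: "d n \<noteq> t" "d n \<noteq> u" for n by (auto simp: d_def u_def)
  have "eventually (\<lambda>n. n \<noteq> t \<and> n \<noteq> u) F" by (intro eventually_conj np[rule_format])
  hence "eventually (\<lambda>n. Mid n = Mid (d n)) F" by (rule eventually_mono) (simp add: d_def)
  hence lim1: "lim (\<lambda>n. Mid (d n)) (f Mid)"
    using lim_cong[of Mid "f Mid" "\<lambda>n. Mid (d n)"] f[rule_format, of Mid] by simp
  let ?E = "{\<lambda>n. Low (d n) t u, \<lambda>n. Mid (d n), \<lambda>n. Mid t, \<lambda>n. Mid u} \<union> ?C"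
  have lowY: "Low (d n) t u \<in> fans" for n using d[of n] by (simp add: fans_def u_def)
  obtain h where h: "\<forall>e\<in>?E. lim e (h e)"
    and ab: "above fan_rel (h (\<lambda>n. Low (d n) t u)) = h ` ?E"
    by (rule limits_exist[of ?E "\<lambda>n. Low (d n) t u"]) (simp_all add: lowY rel_of_above fan_up_def insert_commute)
  have "h (\<lambda>n. Mid (d n)) = f Mid" by (rule lim_unique[OF h[rule_format] lim1]) simp
  moreover have "h (\<lambda>n. Mid t) = Mid t" "h (\<lambda>n. Mid u) = Mid u" "h (\<lambda>n. Top) = Top"
    by (rule lim_unique[OF h[rule_format] lim_const]; simp add: in_Y)+
  moreover obtain x where x: "h (\<lambda>n. Low (d n) t u) = x" by blast
  moreover have xY: "x \<in> fans" using h[rule_format, of "\<lambda>n. Low (d n) t u"] x by (simp add: lim_def)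
  ultimately have "fan_up x = {x, f Mid, Mid t, Mid u, Top}" using ab by (simp add: rel_of_above insert_commute)
  hence "Mid u \<in> fan_up x" "Mid t \<in> fan_up x" "fan_up x \<subseteq> {x, f Mid, Mid t, Mid u, Top}" by simp_all
  thus False using xY t by (auto simp: fans_def fan_up_def u_def)
qed

text \<open>The limit of \<open>Mid\<close> is \<open>Lt\<close>, with \<open>t\<close> arbitrary,
  or \<open>Mid t\<close>. The limit of the roots \<open>Low (d n) t 0\<close> lies below
  \<open>Lt\<close> and \<open>Side t\<close>, so it is a root. In the first case no
  \<open>Mid\<close> point is above it, in the second it would have to be the missing
  \<open>Low t t 0\<close>.\<close>

lemma pentagons_not_completion:
  assumes A: "heyting_algebra A" and iso: "heyting_iso (Up pentagons pentagon_rel) (profinite_completion A)"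
  shows False
proof -
  obtain g F where "completion_limit pentagons pentagon_rel A g (F :: nat filter)"
    and np: "\<forall>m. eventually (\<lambda>n. n \<noteq> m) F"
    by (rule completion_limitI[OF partial_order_pentagons A iso])
  then interpret completion_limit pentagons pentagon_rel A g F by simp
  have in_Y: "Mid n \<in> pentagons" "Side n \<in> pentagons" "Lt \<in> pentagons" "Top \<in> pentagons" for n
    by (simp_all add: pentagons_def)
  let ?C = "{\<lambda>n :: nat. Lt, \<lambda>n. Top}"
  obtain f where f: "\<forall>e\<in>insert Mid ?C. lim e (f e)"
    and ab: "above pentagon_rel (f Mid) = f ` insert Mid ?C"
    by (rule limits_exist[of "insert Mid ?C" Mid]) (simp_all add: in_Y rel_of_above pentagon_up_def)
  have "f (\<lambda>n. Lt) = Lt" "f (\<lambda>n. Top) = Top" by (rule lim_unique[OF f[rule_format] lim_const]; simp add: in_Y)+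
  moreover have "f Mid \<in> pentagons" using f[rule_format, of Mid] by (simp add: lim_def)
  ultimately obtain t where t: "f Mid = Lt \<or> f Mid = Mid t"
    using ab by (auto simp: pentagons_def rel_of_above pentagon_up_def)
  define d where "d n = (if n = t then t + 1 else n)" for n
  have d: "d n \<noteq> t" for n by (auto simp: d_def)
  have "eventually (\<lambda>n. Mid n = Mid (d n)) F" by (rule eventually_mono[OF np[rule_format, of t]]) (simp add: d_def)
  hence lim1: "lim (\<lambda>n. Mid (d n)) (f Mid)"
    using lim_cong[of Mid "f Mid" "\<lambda>n. Mid (d n)"] f[rule_format, of Mid] by simp
  let ?E = "{\<lambda>n. Low (d n) t 0, \<lambda>n. Mid (d n), \<lambda>n. Side t} \<union> ?C"
  have lowY: "Low (d n) t 0 \<in> pentagons" for n using d[of n] by (simp add: pentagons_def)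
  obtain h where h: "\<forall>e\<in>?E. lim e (h e)"
    and ab: "above pentagon_rel (h (\<lambda>n. Low (d n) t 0)) = h ` ?E"
    by (rule limits_exist[of ?E "\<lambda>n. Low (d n) t 0"]) (simp_all add: lowY rel_of_above pentagon_up_def insert_commute)
  have "h (\<lambda>n. Mid (d n)) = f Mid" by (rule lim_unique[OF h[rule_format] lim1]) simp
  moreover have "h (\<lambda>n. Side t) = Side t" "h (\<lambda>n. Lt) = Lt" "h (\<lambda>n. Top) = Top"
    by (rule lim_unique[OF h[rule_format] lim_const]; simp add: in_Y)+
  moreover obtain x where x: "h (\<lambda>n. Low (d n) t 0) = x" by blast
  moreover have xY: "x \<in> pentagons" using h[rule_format, of "\<lambda>n. Low (d n) t 0"] x by (simp add: lim_def)
  ultimately have "pentagon_up x = {x, f Mid, Side t, Lt, Top}" using ab by (simp add: rel_of_above insert_commute)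
  hence "Side t \<in> pentagon_up x" "Lt \<in> pentagon_up x"
    "pentagon_up x \<subseteq> {x, f Mid, Side t, Lt, Top}" by simp_all
  thus False using xY t by (auto simp: pentagons_def pentagon_up_def)
qed

section \<open>Profinite algebras of upsets\<close>

text \<open>Serves two purposes: moving an algebra of upsets into the universe type, and placing
  finite ones on \<open>nat\<close> for the inverse system.\<close>

definition transport :: "('a \<Rightarrow> 'b) \<Rightarrow> 'a heyting \<Rightarrow> 'b heyting" where
  "transport h A = (let k = inv_into (carrier A) h in
     \<lparr>carrier = h ` carrier A,
      meet = (\<lambda>x y. h (meet A (k x) (k y))),
      join = (\<lambda>x y. h (join A (k x) (k y))),
      himp = (\<lambda>x y. h (himp A (k x) (k y))),
      hbot = h (hbot A),
      htop = h (htop A)\<rparr>)"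

locale transported = heyting_algebra +
  fixes h :: "'a \<Rightarrow> 'b"
  assumes inj: "inj_on h (carrier A)"
begin

lemma inv_h [simp]: "x \<in> carrier A \<Longrightarrow> inv_into (carrier A) h (h x) = x"
  by (rule inv_into_f_f[OF inj])

lemma transport_simps:
  "carrier (transport h A) = h ` carrier A"
  "\<lbrakk>x \<in> carrier A; y \<in> carrier A\<rbrakk> \<Longrightarrow> meet (transport h A) (h x) (h y) = h (meet A x y)"
  "\<lbrakk>x \<in> carrier A; y \<in> carrier A\<rbrakk> \<Longrightarrow> join (transport h A) (h x) (h y) = h (join A x y)"
  "\<lbrakk>x \<in> carrier A; y \<in> carrier A\<rbrakk> \<Longrightarrow> himp (transport h A) (h x) (h y) = h (himp A x y)"
  "hbot (transport h A) = h (hbot A)"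
  "htop (transport h A) = h (htop A)"
  by (simp_all add: transport_def Let_def)

lemma transport_le:
  "\<lbrakk>x \<in> carrier A; y \<in> carrier A\<rbrakk> \<Longrightarrow> heyting_le (transport h A) (h x) (h y) \<longleftrightarrow> heyting_le A x y"
  by (simp add: heyting_le_def transport_simps inj_on_eq_iff[OF inj] meet_closed)

lemma transport_heyting: "heyting_algebra (transport h A)"
  by unfold_locales
    (auto simp: transport_simps transport_le meet_closed join_closed himp_closed hbot_closed htop_closed
      meet_assoc join_assoc meet_join_absorb join_meet_absorb hbot_least htop_greatest residuation,
     simp_all add: meet_comm join_comm)

lemma transport_hom: "h \<in> heyting_hom A (transport h A)"
  by (auto simp: heyting_hom_def transport_simps)

lemma transport_bij: "bij_betw h (carrier A) (carrier (transport h A))"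
  using inj by (simp add: transport_simps bij_betw_def)

lemma transport_satisfies:
  assumes "satisfies A e"
  shows "satisfies (transport h A) e"
  unfolding satisfies_def
proof (intro allI impI)
  fix \<rho> :: "nat \<Rightarrow> 'b" assume "range \<rho> \<subseteq> carrier (transport h A)"
  hence \<rho>: "\<rho> n \<in> h ` carrier A" for n by (auto simp: transport_simps)
  define \<sigma> where "\<sigma> n = inv_into (carrier A) h (\<rho> n)" for n
  have \<sigma>: "\<sigma> n \<in> carrier A" "h (\<sigma> n) = \<rho> n" for n
    using \<rho>[of n] by (simp_all add: \<sigma>_def inv_into_into f_inv_into_f)
  have "range \<sigma> \<subseteq> carrier A" using \<sigma>(1) by blast
  thus "heval (transport h A) \<rho> (fst e) = heval (transport h A) \<rho> (snd e)"
    using heval_hom[OF heyting_algebra_axioms transport_hom, of \<sigma>] \<sigma>(2) assms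
    by (simp add: satisfies_def) metis
qed

end

lemma heyting_iso_sym:
  assumes A: "heyting_algebra A" and iso: "heyting_iso A B"
  shows "heyting_iso B A"
proof -
  interpret heyting_algebra A by (rule A)
  obtain h where h: "h \<in> heyting_hom A B" and bij: "bij_betw h (carrier A) (carrier B)"
    using iso by (auto simp: heyting_iso_def)
  define k where "k = inv_into (carrier A) h"
  have k: "bij_betw k (carrier B) (carrier A)" unfolding k_def by (rule bij_betw_inv_into[OF bij])
  have kh: "k (h x) = x" if "x \<in> carrier A" for x
    using bij that by (simp add: k_def bij_betw_def)
  have "k \<in> heyting_hom B A"
  proof -
    have "k (meet B x y) = meet A (k x) (k y) \<and> k (join B x y) = join A (k x) (k y) \<and>
      k (himp B x y) = himp A (k x) (k y)" if xy: "x \<in> carrier B" "y \<in> carrier B" for x y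
    proof -
      obtain a b where ab: "a \<in> carrier A" "x = h a" "b \<in> carrier A" "y = h b"
        using bij xy unfolding bij_betw_def by blast
      have "k (h (meet A a b)) = meet A a b" "k (h (join A a b)) = join A a b" "k (h (himp A a b)) = himp A a b"
        using ab by (simp_all add: kh meet_closed join_closed himp_closed)
      thus ?thesis using ab heyting_homD(2-4)[OF h ab(1,3)] by (simp add: kh)
    qed
    moreover have "k (hbot B) = hbot A" "k (htop B) = htop A"
      using kh[OF hbot_closed] kh[OF htop_closed] heyting_homD(5,6)[OF h] by simp_all
    moreover have "k \<in> carrier B \<rightarrow> carrier A" using k by (auto simp: bij_betw_def)
    ultimately show ?thesis by (simp add: heyting_hom_def)
  qed
  thus ?thesis using k unfolding heyting_iso_def by blast
qed

lemma heyting_iso_trans: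
  assumes "heyting_iso A B" "heyting_iso B C"
  shows "heyting_iso A C"
proof -
  obtain h k where h: "h \<in> heyting_hom A B" "bij_betw h (carrier A) (carrier B)"
    and k: "k \<in> heyting_hom B C" "bij_betw k (carrier B) (carrier C)"
    using assms by (auto simp: heyting_iso_def)
  have "k \<circ> h \<in> heyting_hom A C"
    using heyting_homD[OF h(1)] heyting_homD[OF k(1)] by (simp add: heyting_hom_def)
  thus ?thesis using bij_betw_trans[OF h(2) k(2)] unfolding heyting_iso_def by blast
qed

text \<open>The finite upsets of an image-finite poset form a directed system with union \<open>Y\<close>. Both they
  and their subsets have to be encoded, as the definition of profiniteness fixes the types of indices
  and of finite algebras.\<close>

locale coded_poset = frame Y s for Y :: "'y :: countable set" and s +
  fixes code :: "'y set \<Rightarrow> 'i"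
  assumes fin_above: "y \<in> Y \<Longrightarrow> finite (above s y)"
    and code: "inj code"
begin

definition Fin :: "'y set set" where
  "Fin = {F \<in> upsets Y s. finite F}"

definition dec :: "'i \<Rightarrow> 'y set" where
  "dec = inv code"

definition enc :: "'y set \<Rightarrow> nat" where
  "enc U = set_encode (to_nat ` U)"

definition unenc :: "nat \<Rightarrow> 'y set" where
  "unenc n = from_nat ` set_decode n"

definition H :: "'i \<Rightarrow> nat heyting" where
  "H i = transport enc (Up (dec i) s)"

definition \<phi> :: "'i \<Rightarrow> 'i \<Rightarrow> nat \<Rightarrow> nat" where
  "\<phi> i j x = enc (unenc x \<inter> dec i)"

definition le :: "'i rel" where
  "le = {(code F, code G) | F G. F \<in> Fin \<and> G \<in> Fin \<and> F \<subseteq> G}"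

lemma dec [simp]: "dec (code F) = F"
  by (simp add: dec_def code)

lemma unenc [simp]: "finite U \<Longrightarrow> unenc (enc U) = U"
  by (simp add: unenc_def enc_def image_image)

lemma Fin_frame: "F \<in> Fin \<Longrightarrow> frame F s"
  unfolding Fin_def by (simp add: upset_frame)

lemma Fin_finite: "F \<in> Fin \<Longrightarrow> finite F"
  by (simp add: Fin_def)

lemma sub_finite: "F \<in> Fin \<Longrightarrow> U \<in> upsets F s \<Longrightarrow> finite U"
  using Fin_finite upsets_subset finite_subset by metis

lemma transported: "F \<in> Fin \<Longrightarrow> transported (Up F s) enc"
  unfolding transported_def transported_axioms_def
  by (auto simp: frame.Up_heyting[OF Fin_frame] inj_on_def) (metis sub_finite unenc)+

lemma H_simps:
  assumes "F \<in> Fin"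
  shows "carrier (H (code F)) = enc ` upsets F s"
    "\<lbrakk>U \<in> upsets F s; V \<in> upsets F s\<rbrakk> \<Longrightarrow> meet (H (code F)) (enc U) (enc V) = enc (U \<inter> V)"
    "\<lbrakk>U \<in> upsets F s; V \<in> upsets F s\<rbrakk> \<Longrightarrow> join (H (code F)) (enc U) (enc V) = enc (U \<union> V)"
    "\<lbrakk>U \<in> upsets F s; V \<in> upsets F s\<rbrakk> \<Longrightarrow>
      himp (H (code F)) (enc U) (enc V) = enc {x \<in> F. above s x \<inter> U \<subseteq> V}"
    "hbot (H (code F)) = enc {}"
    "htop (H (code F)) = enc F"
  using transported.transport_simps[OF transported[OF assms]] by (simp_all add: H_def)

lemma restrict_upset: "U \<in> upsets G s \<Longrightarrow> F \<in> Fin \<Longrightarrow> F \<subseteq> G \<Longrightarrow> U \<inter> F \<in> upsets F s"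
  by (auto simp: Fin_def upsets_iff)

lemma restrict_himp:
  assumes "F \<in> Fin" "F \<subseteq> G"
  shows "{x \<in> G. above s x \<inter> U \<subseteq> V} \<inter> F = {x \<in> F. above s x \<inter> (U \<inter> F) \<subseteq> V \<inter> F}"
proof -
  have "above s x \<subseteq> F" if "x \<in> F" for x using assms(1) that by (auto simp: Fin_def upsets_def)
  thus ?thesis using assms(2) by blast
qed

lemma \<phi>_enc: "G \<in> Fin \<Longrightarrow> U \<in> upsets G s \<Longrightarrow> \<phi> (code F) j (enc U) = enc (U \<inter> F)"
  by (simp add: \<phi>_def sub_finite)

lemma \<phi>_hom:
  assumes "F \<in> Fin" "G \<in> Fin" "F \<subseteq> G"
  shows "\<phi> (code F) (code G) \<in> heyting_hom (H (code G)) (H (code F))"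
proof -
  interpret G: frame G s by (rule Fin_frame[OF assms(2)])
  note [simp] = H_simps[OF assms(1)] H_simps[OF assms(2)] \<phi>_enc[OF assms(2)]
  have r: "U \<inter> F \<in> upsets F s" if "U \<in> upsets G s" for U using restrict_upset[OF that assms(1,3)] .
  have "\<phi> (code F) (code G) (meet (H (code G)) (enc U) (enc V)) = meet (H (code F)) (enc (U \<inter> F)) (enc (V \<inter> F))"
    "\<phi> (code F) (code G) (join (H (code G)) (enc U) (enc V)) = join (H (code F)) (enc (U \<inter> F)) (enc (V \<inter> F))"
    "\<phi> (code F) (code G) (himp (H (code G)) (enc U) (enc V)) = himp (H (code F)) (enc (U \<inter> F)) (enc (V \<inter> F))"
    if UV: "U \<in> upsets G s" "V \<in> upsets G s" for U V
  proof -
    have "U \<inter> V \<inter> F = U \<inter> F \<inter> (V \<inter> F)" "(U \<union> V) \<inter> F = U \<inter> F \<union> V \<inter> F" by auto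
    thus "\<phi> (code F) (code G) (meet (H (code G)) (enc U) (enc V)) = meet (H (code F)) (enc (U \<inter> F)) (enc (V \<inter> F))"
      "\<phi> (code F) (code G) (join (H (code G)) (enc U) (enc V)) = join (H (code F)) (enc (U \<inter> F)) (enc (V \<inter> F))"
      "\<phi> (code F) (code G) (himp (H (code G)) (enc U) (enc V)) = himp (H (code F)) (enc (U \<inter> F)) (enc (V \<inter> F))"
      using UV by (simp_all add: r upsets_Int upsets_Un G.himp_upset restrict_himp[OF assms(1,3)])
  qed
  moreover have "G \<in> upsets G s" "G \<inter> F = F" using G.closed assms(3) by (auto simp: upsets_iff)
  moreover have "{} \<in> upsets G s" by (rule upsets_empty)
  ultimately show ?thesis using r by (auto simp: heyting_hom_def)
qed

lemma system: "inverse_system (code ` Fin) le H \<phi>"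
  unfolding inverse_system_def
proof (intro conjI)
  show "code ` Fin \<noteq> {}" using upsets_empty by (auto simp: Fin_def)
  have ci: "code F = code G \<longleftrightarrow> F = G" for F G using code by (simp add: inj_eq)
  show "partial_order_on (code ` Fin) le"
    unfolding partial_order_on_def preorder_on_def
    by (auto simp: refl_on_def trans_def antisym_def le_def ci)
  show "\<forall>i\<in>code ` Fin. \<forall>j\<in>code ` Fin. \<exists>k\<in>code ` Fin. (i, k) \<in> le \<and> (j, k) \<in> le"
  proof (clarify)
    fix F G assume FG: "F \<in> Fin" "G \<in> Fin"
    hence "F \<union> G \<in> Fin" by (simp add: Fin_def upsets_Un)
    thus "\<exists>k\<in>code ` Fin. (code F, k) \<in> le \<and> (code G, k) \<in> le" using FG unfolding le_def by blast
  qed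
  show "\<forall>i\<in>code ` Fin. heyting_algebra (H i)"
    using transported.transport_heyting[OF transported] by (simp add: H_def)
  show "\<forall>(i, j)\<in>le. \<phi> i j \<in> heyting_hom (H j) (H i)"
    using \<phi>_hom by (auto simp: le_def)
  show "\<forall>i\<in>code ` Fin. \<forall>x\<in>carrier (H i). \<phi> i i x = x"
  proof clarify
    fix F x assume F: "F \<in> Fin" and "x \<in> carrier (H (code F))"
    then obtain U where "x = enc U" "U \<in> upsets F s" by (auto simp: H_simps)
    moreover have "U \<inter> F = U" using upsets_subset calculation(2) by blast
    ultimately show "\<phi> (code F) (code F) x = x" using F by (simp add: \<phi>_enc)
  qed
  show "\<forall>i j k. (i, j) \<in> le \<and> (j, k) \<in> le \<longrightarrow> (\<forall>x\<in>carrier (H k). \<phi> i j (\<phi> j k x) = \<phi> i k x)"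
  proof (intro allI impI ballI, elim conjE)
    fix i j k x assume ij: "(i, j) \<in> le" and jk: "(j, k) \<in> le" and x: "x \<in> carrier (H k)"
    obtain F G where FG: "i = code F" "j = code G" "F \<in> Fin" "G \<in> Fin" "F \<subseteq> G" using ij unfolding le_def by blast
    obtain G' K where K: "j = code G'" "k = code K" "K \<in> Fin" "G' \<subseteq> K" using jk unfolding le_def by blast
    have GK: "G \<subseteq> K" using FG K by (simp add: ci)
    obtain U where U: "x = enc U" "U \<in> upsets K s" using x K by (auto simp: H_simps)
    have "U \<inter> G \<inter> F = U \<inter> F" using FG(5) by blast
    thus "\<phi> i j (\<phi> j k x) = \<phi> i k x"
      using \<phi>_enc[OF K(3) U(2)] \<phi>_enc[OF FG(4) restrict_upset[OF U(2) FG(4) GK]]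
      unfolding FG(1,2) K(2) U(1) by simp
  qed
qed

lemma above_Fin: "y \<in> Y \<Longrightarrow> above s y \<in> Fin"
  unfolding Fin_def using fin_above above_upset by blast

text \<open>Image-finiteness puts every \<open>above s y\<close> into the system. An upset is
  determined by its traces on these sets, and a compatible family is glued by testing each
  \<open>y\<close> on \<open>above s y\<close>.\<close>

lemma limit_iso: "heyting_iso (Up Y s) (inverse_limit (code ` Fin) le H \<phi>)"
proof -
  let ?I = "code ` Fin" and ?L = "inverse_limit (code ` Fin) le H \<phi>"
  define \<Phi> where "\<Phi> U = (\<lambda>i\<in>?I. enc (U \<inter> dec i))" for U
  have FY: "F \<subseteq> Y" if "F \<in> Fin" for F using that unfolding Fin_def upsets_def by blast
  have r: "U \<inter> F \<in> upsets F s" if "F \<in> Fin" "U \<in> upsets Y s" for F U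
    using restrict_upset[OF that(2,1)] FY[OF that(1)] .
  have \<Phi>F: "\<Phi> U (code F) = enc (U \<inter> F)" if "F \<in> Fin" for U F using that by (simp add: \<Phi>_def)
  have carr: "f \<in> carrier ?L \<longleftrightarrow> f \<in> extensional ?I \<and> (\<forall>F\<in>Fin. f (code F) \<in> enc ` upsets F s) \<and>
      (\<forall>F\<in>Fin. \<forall>G\<in>Fin. F \<subseteq> G \<longrightarrow> \<phi> (code F) (code G) (f (code G)) = f (code F))" for f
    unfolding inverse_limit_def by (auto simp: PiE_def Pi_def le_def H_simps) blast
  have \<Phi>L: "\<Phi> U \<in> carrier ?L" if U: "U \<in> upsets Y s" for U
    unfolding carr
  proof (intro conjI ballI impI)
    show "\<Phi> U \<in> extensional ?I" by (simp add: \<Phi>_def)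
    fix F assume F: "F \<in> Fin"
    show "\<Phi> U (code F) \<in> enc ` upsets F s" using r[OF F U] by (simp add: \<Phi>F[OF F])
    fix G assume G: "G \<in> Fin" "F \<subseteq> G"
    have "U \<inter> G \<inter> F = U \<inter> F" using G by blast
    thus "\<phi> (code F) (code G) (\<Phi> U (code G)) = \<Phi> U (code F)"
      using \<phi>_enc[OF G(1) r[OF G(1) U]] by (simp add: \<Phi>F F G)
  qed
  have hom: "\<Phi> \<in> heyting_hom (Up Y s) ?L"
  proof -
    have eqI: "f = g" if "f \<in> extensional ?I" "g \<in> extensional ?I" "\<And>F. F \<in> Fin \<Longrightarrow> f (code F) = g (code F)" for f g
      using that by (auto intro: extensionalityI)
    have "\<Phi> (U \<inter> V) = meet ?L (\<Phi> U) (\<Phi> V)" "\<Phi> (U \<union> V) = join ?L (\<Phi> U) (\<Phi> V)"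
      "\<Phi> {x \<in> Y. above s x \<inter> U \<subseteq> V} = himp ?L (\<Phi> U) (\<Phi> V)"
      if UV: "U \<in> upsets Y s" "V \<in> upsets Y s" for U V
    proof -
      have e: "U \<inter> V \<inter> F = U \<inter> F \<inter> (V \<inter> F)" "(U \<union> V) \<inter> F = U \<inter> F \<union> V \<inter> F" for F by auto
      show "\<Phi> (U \<inter> V) = meet ?L (\<Phi> U) (\<Phi> V)"
        by (rule eqI) (simp_all add: \<Phi>F inverse_limit_def H_simps r UV e, simp add: \<Phi>_def)
      show "\<Phi> (U \<union> V) = join ?L (\<Phi> U) (\<Phi> V)"
        by (rule eqI) (simp_all add: \<Phi>F inverse_limit_def H_simps r UV e, simp add: \<Phi>_def)
      show "\<Phi> {x \<in> Y. above s x \<inter> U \<subseteq> V} = himp ?L (\<Phi> U) (\<Phi> V)"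
        by (rule eqI) (simp_all add: \<Phi>F inverse_limit_def H_simps r UV restrict_himp FY, simp add: \<Phi>_def)
    qed
    moreover have "\<Phi> {} = hbot ?L"
      by (rule eqI) (simp_all add: \<Phi>F inverse_limit_def H_simps, simp add: \<Phi>_def)
    moreover have "Y \<inter> F = F" if "F \<in> Fin" for F using FY[OF that] by blast
    hence "\<Phi> Y = htop ?L"
      by (intro eqI) (simp_all add: \<Phi>F inverse_limit_def H_simps, simp add: \<Phi>_def)
    ultimately show ?thesis using \<Phi>L by (simp add: heyting_hom_def)
  qed
  have "bij_betw \<Phi> (upsets Y s) (carrier ?L)"
    unfolding bij_betw_def
  proof
    show "inj_on \<Phi> (upsets Y s)"
    proof (rule inj_onI)
      fix U V assume UV: "U \<in> upsets Y s" "V \<in> upsets Y s" "\<Phi> U = \<Phi> V"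
      have "y \<in> U \<longleftrightarrow> y \<in> V" if y: "y \<in> Y" for y
      proof -
        note F = above_Fin[OF y]
        have "enc (U \<inter> above s y) = enc (V \<inter> above s y)" using UV(3) \<Phi>F[OF F] by metis
        hence "U \<inter> above s y = V \<inter> above s y" using unenc Fin_finite[OF F] by (metis finite_Int)
        thus ?thesis using above_self[OF y] by blast
      qed
      thus "U = V" using UV upsets_subset by blast
    qed
    show "\<Phi> ` upsets Y s = carrier ?L"
    proof
      show "\<Phi> ` upsets Y s \<subseteq> carrier ?L" using \<Phi>L by blast
      show "carrier ?L \<subseteq> \<Phi> ` upsets Y s"
      proof
        fix f assume "f \<in> carrier ?L"
        hence ext: "f \<in> extensional ?I" and val: "\<And>F. F \<in> Fin \<Longrightarrow> f (code F) \<in> enc ` upsets F s"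
          and comp: "\<And>F G. F \<in> Fin \<Longrightarrow> G \<in> Fin \<Longrightarrow> F \<subseteq> G \<Longrightarrow> \<phi> (code F) (code G) (f (code G)) = f (code F)"
          unfolding carr by blast+
        define W where "W F = unenc (f (code F))" for F
        have W: "W F \<in> upsets F s" "f (code F) = enc (W F)" if F: "F \<in> Fin" for F
        proof -
          obtain U where "U \<in> upsets F s" "f (code F) = enc U" using val[OF F] by blast
          thus "W F \<in> upsets F s" "f (code F) = enc (W F)" using sub_finite[OF F] by (simp_all add: W_def)
        qed
        have WW: "W G \<inter> F = W F" if "F \<in> Fin" "G \<in> Fin" "F \<subseteq> G" for F G
        proof -
          have "enc (W G \<inter> F) = enc (W F)"
            using comp[OF that] W[OF that(1)] W[OF that(2)] \<phi>_enc[OF that(2)] by simp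
          thus ?thesis using unenc Fin_finite[OF that(1)] sub_finite[OF that(1) W(1)[OF that(1)]]
            by (metis finite_Int)
        qed
        define U where "U = {y \<in> Y. y \<in> W (above s y)}"
        have UW: "y \<in> U \<longleftrightarrow> y \<in> W F" if F: "F \<in> Fin" "y \<in> F" for y F
        proof -
          have y: "y \<in> Y" using FY F by blast
          have sub: "above s y \<subseteq> F" using F by (auto simp: Fin_def upsets_def)
          show ?thesis
            using WW[OF above_Fin[OF y] F(1) sub] above_self[OF y] y by (auto simp: U_def)
        qed
        have "U \<in> upsets Y s"
          unfolding upsets_iff
        proof (intro conjI ballI allI impI)
          show "U \<subseteq> Y" by (auto simp: U_def)
          fix x y assume x: "x \<in> U" and xy: "(x, y) \<in> s"
          hence xY: "x \<in> Y" by (simp add: U_def)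
          have F: "above s x \<in> Fin" by (rule above_Fin[OF xY])
          have "x \<in> W (above s x)" using x by (simp add: U_def)
          hence "y \<in> W (above s x)" using W(1)[OF F] xy by (auto simp: upsets_iff)
          thus "y \<in> U" using UW[OF F, of y] xy by (simp add: above_def)
        qed
        moreover have "\<Phi> U = f"
        proof (rule extensionalityI)
          show "\<Phi> U \<in> extensional ?I" by (simp add: \<Phi>_def)
          show "f \<in> extensional ?I" by (rule ext)
          fix i assume "i \<in> ?I"
          then obtain F where F: "F \<in> Fin" "i = code F" by blast
          have "U \<inter> F = W F" using UW[OF F(1)] W(1)[OF F(1)] upsets_subset by blast
          thus "\<Phi> U i = f i" using F W(2) by (simp add: \<Phi>F)
        qed
        ultimately show "f \<in> \<Phi> ` upsets Y s" by blast
      qed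
    qed
  qed
  thus ?thesis using hom unfolding heyting_iso_def by auto
qed

lemma H_finite: "i \<in> code ` Fin \<Longrightarrow> finite (carrier (H i))"
  using Fin_finite by (auto simp: H_simps upsets_def)

end

text \<open>Subsets of the countable \<open>Y\<close> inject into \<open>nat set\<close>, and
  through \<open>J\<close> into the universe. The index type of \<open>profinite\<close> consists of
  relations on the carrier type, hence the singleton relations as codes of finite upsets.\<close>

lemma profinite_copy:
  fixes Y :: "'y :: countable set" and J :: "nat set \<Rightarrow> 'u"
  assumes po: "partial_order_on Y s" and fin: "\<And>y. y \<in> Y \<Longrightarrow> finite (above s y)"
    and J: "inj J" and V: "\<And>e. e \<in> V \<Longrightarrow> satisfies (Up Y s) e"
  obtains P :: "'u heyting" where "P \<in> variety V" "profinite P" "heyting_iso (Up Y s) P"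
proof -
  interpret frame Y s by (rule partial_order_frame[OF po])
  define h :: "'y set \<Rightarrow> 'u" where "h U = J (to_nat ` U)" for U
  have inj: "inj h"
  proof (rule injI)
    fix U V :: "'y set" assume "h U = h V"
    hence "to_nat ` U = to_nat ` V" using J by (simp add: h_def inj_eq)
    thus "U = V" by (simp add: inj_image_eq_iff)
  qed
  interpret T: transported "Up Y s" h
    by (intro transported.intro Up_heyting transported_axioms.intro inj_on_subset[OF inj]) simp
  let ?P = "transport h (Up Y s)"
  have iso: "heyting_iso (Up Y s) ?P" using T.transport_hom T.transport_bij unfolding heyting_iso_def by blast
  have "inj (\<lambda>F. {(h F, h F)})" using inj by (auto simp: inj_def)
  then interpret C: coded_poset Y s "\<lambda>F. {(h F, h F)}"
    by unfold_locales (use fin in auto)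
  have "heyting_iso ?P (inverse_limit ((\<lambda>F. {(h F, h F)}) ` C.Fin) C.le C.H C.\<phi>)"
    by (rule heyting_iso_trans[OF heyting_iso_sym[OF Up_heyting iso] C.limit_iso])
  hence "profinite ?P"
    unfolding profinite_def using T.transport_heyting C.system C.H_finite by blast
  moreover have "?P \<in> variety V"
    using T.transport_heyting T.transport_satisfies V by (simp add: variety_def)
  ultimately show thesis using that iso by blast
qed

instance pt :: countable
  by countable_datatype

lemma forbidden_posets:
  assumes "(Y, s) \<in> {(forks, fork_rel), (fans, fan_rel), (pentagons, pentagon_rel), (doubles, double_rel)}"
  shows "partial_order_on Y s" "y \<in> Y \<Longrightarrow> finite (above s y)"
    "heyting_algebra A \<Longrightarrow> \<not> heyting_iso (Up Y s) (profinite_completion A)"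
proof -
  show "partial_order_on Y s"
    using assms partial_order_forks partial_order_fans partial_order_pentagons partial_order_doubles by auto
  show "finite (above s y)" if "y \<in> Y"
    using assms that
    by (auto simp: rel_of_above fork_up_def fan_up_def pentagon_up_def double_up_def split: pt.splits)
  show "heyting_algebra A \<Longrightarrow> \<not> heyting_iso (Up Y s) (profinite_completion A)"
    using assms forks_not_completion fans_not_completion pentagons_not_completion doubles_not_completion by auto
qed

text \<open>The three carrier types are unrelated: an algebra of the variety outside
  \<open>DHA\<close>, however large, only selects one of four fixed countable posets, and the
  contradiction arises from a copy of its algebra of upsets on \<open>'u\<close>.\<close>

theorem theorem5p1:
  fixes V :: "(hterm \<times> hterm) set"
  assumes "universe_type TYPE('u)"
    and "\<forall>P :: 'u heyting. P \<in> variety V \<and> profinite P \<longrightarrow>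
           (\<exists>A :: 'b heyting. heyting_algebra A \<and> heyting_iso P (profinite_completion A))"
  shows "(variety V :: 'c heyting set) \<subseteq> DHA"
proof (rule ccontr)
  assume "\<not> (variety V :: 'c heyting set) \<subseteq> DHA"
  then obtain A :: "'c heyting" where A: "A \<in> variety V" "A \<notin> DHA" by blast
  obtain Y :: "pt set" and s
    where Ys: "(Y, s) \<in> {(forks, fork_rel), (fans, fan_rel), (pentagons, pentagon_rel), (doubles, double_rel)}"
      and V: "\<And>e. e \<in> V \<Longrightarrow> satisfies (Up Y s) e"
    by (rule not_DHA_forbidden[OF A]) blast
  obtain J :: "nat set \<Rightarrow> 'u" where J: "inj J" using assms(1) by (auto simp: universe_type_def)
  obtain P :: "'u heyting" where P: "P \<in> variety V" "profinite P" "heyting_iso (Up Y s) P"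
    using profinite_copy[OF forbidden_posets(1,2)[OF Ys] J V] .
  obtain B :: "'b heyting" where B: "heyting_algebra B" "heyting_iso P (profinite_completion B)"
    using assms(2) P by blast
  show False
    using forbidden_posets(3)[OF Ys B(1)] heyting_iso_trans[OF P(3) B(2)] by simp
qed

end
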